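(* Let $\omega=(\omega_0,\omega_1)$ be a permutation of $\{0,\dots,m\}$ and let $\mathbb T_\omega(\lambda)=\lambda\mathbb M^{\mathcal S}_{-\omega_1}-\mathbb M^{\mathcal S}_{\omega_0}$ be the associated generalized Fiedler pencil (GFP) of $G(\lambda)$, where $0\in\omega_0$. Then $\mathbb T_\omega(\lambda)$ is a Rosenbrock strong linearization of $G(\lambda)$.
   Context: Setting: $P(\lambda)=\sum_{i=0}^m\lambda^iA_i$ with $A_i\in\mathbb C^{n\times n}$, $A_m\neq0$, $m\ge1$; $G(\lambda)=P(\lambda)+C(\lambda E-A)^{-1}B$ is a minimal realization ($r$ smallest possible) with $A,E\in\mathbb C^{r\times r}$, $E$ nonsingular, $C\in\mathbb C^{n\times r}$, $B\in\mathbb C^{r\times n}$; system matrix $\mathcal S(\lambda)=\left[\begin{array}{c|c}P(\lambda)&C\\ \hline B&A-\lambda E\end{array}\right]$. $e_j$ is the $j$-th column of $I_m$. Fiedler matrices: $M_0^P=\mathrm{diag}(I_{(m-1)n},-A_0)$, $M_{-m}^P=\mathrm{diag}(A_m,I_{(m-1)n})$, $M_i^P=\mathrm{diag}\big(I_{(m-i-1)n},\begin{bmatrix}-A_i&I_n\\ I_n&0\end{bmatrix},I_{(i-1)n}\big)$ for $1\le i\le m-1$. $\mathbb M_0^{\mathcal S}=\left[\begin{array}{c|c}M_0^P&-e_m\otimes C\\ \hline -e_m^T\otimes B&-A\end{array}\right]$, $\mathbb M_{-m}^{\mathcal S}=\mathrm{diag}(M_{-m}^P,-E)$, $\mathbb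 M_i^{\mathcal S}=\mathrm{diag}(M_i^P,I_r)$ and $\mathbb M_{-i}^{\mathcal S}=(\mathbb M_i^{\mathcal S})^{-1}$ for $1\le i\le m-1$. When $m\in\omega_0$, the factor $\mathbb M_m^{\mathcal S}$ means $(\mathbb M_{-m}^{\mathcal S})^{-1}$, and $A_m$ is then taken to be nonsingular. For a tuple $\mathbf t=(t_1,\dots,t_k)$, $-\mathbf t=(-t_1,\dots,-t_k)$ and $\mathbb M^{\mathcal S}_{\mathbf t}=\mathbb M^{\mathcal S}_{t_1}\cdots\mathbb M^{\mathcal S}_{t_k}$ (empty product $=$ identity). Here $\omega$ is a tuple listing $\{0,\dots,m\}$ once each, written as the concatenation of the tuples $\omega_0$ and $\omega_1$. A matrix polynomial is unimodular if its determinant is a nonzero constant. A square rational matrix $F(\lambda)$ is biproper if $\lim_{\lambda\to\infty}F(\lambda)$ exists and is nonsingular. Rosenbrock strong linearization: an $(mn+r)\times(mn+r)$ pencil $\mathbb L(\lambda)=\left[\begin{array}{c|c}\mathcal X-\lambda\mathcal Y&\mathcal C\\ \hline\mathcal B&H-\lambda K\end{array}\right]$, with $H-\lambda K$ of size $r\times r$, $K$ nonsingular, and irreducible (i.e. $[\mathcal B\ \ H-\lambda K]$ and $\begin{bmatrix}\mathcal C\\ H-\lambda K\end{bmatrix}$ have rank $r$ for all $\lambda\in\mathbb C$), is a Rosenbrock strong linearization of $G(\lambda)$ if (i) $\mathrm{diag}(U(\lambda),U_0)\,\mathbb L(\lambda)\,\mathrm{diag}(V(\lambda),V_0)=\mathrm{diag}(I_{(m-1)n},\mathcal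 S(\lambda))$ for some $mn\times mn$ unimodular $U,V$ and nonsingular $U_0,V_0\in\mathbb C^{r\times r}$; and (ii) $\mathcal O_\ell(\lambda)\,\lambda^{-1}\mathbb G(\lambda)\,\mathcal O_r(\lambda)=\mathrm{diag}(I_{(m-1)n},\lambda^{-m}G(\lambda))$ for some $mn\times mn$ biproper $\mathcal O_\ell,\mathcal O_r$, where $\mathbb G(\lambda)=\mathcal X-\lambda\mathcal Y+\mathcal C(\lambda K-H)^{-1}\mathcal B$ is the transfer function of $\mathbb L(\lambda)$. *)

theory Defs
  imports
    "HOL-Computational_Algebra.Computational_Algebra"
    "HOL-Computational_Algebra.Field_as_Ring"
    "Jordan_Normal_Form.Gauss_Jordan_Elimination"
    "Jordan_Normal_Form.DL_Rank"
begin

text \<open>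
  Matrix polynomials have type \<^typ>\<open>complex poly mat\<close> and rational matrices have type
  \<^typ>\<open>complex poly fract mat\<close>, so that equality of rational matrices is equality over the
  field of rational functions.  Throughout, \<open>lam\<close> is the indeterminate.
\<close>

abbreviation lam :: "complex poly" where
  "lam \<equiv> [:0, 1:]"

abbreviation const_mat :: "complex mat \<Rightarrow> complex poly mat" where
  "const_mat \<equiv> map_mat (\<lambda>c. [:c:])"

abbreviation rat_mat :: "complex poly mat \<Rightarrow> complex poly fract mat" where
  "rat_mat \<equiv> map_mat to_fract"

definition inv_mat :: "'a :: field mat \<Rightarrow> 'a mat" where
  "inv_mat M = the (mat_inverse M)"

definition kron :: "'a :: semiring_0 mat \<Rightarrow> 'a mat \<Rightarrow> 'a mat" where
  "kron M N = mat (dim_row M * dim_row N) (dim_col M * dim_col N)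
     (\<lambda>(i, j). M $$ (i div dim_row N, j div dim_col N) * N $$ (i mod dim_row N, j mod dim_col N))"


section \<open>Realizations\<close>

definition matrix_poly :: "nat \<Rightarrow> nat \<Rightarrow> (nat \<Rightarrow> complex mat) \<Rightarrow> complex poly mat" where
  "matrix_poly n m Ac = mat n n (\<lambda>(a, b). \<Sum>i\<le>m. monom (Ac i $$ (a, b)) i)"

text \<open>\<open>P(\<lambda>) + C (\<lambda> E - A)\<^sup>-\<^sup>1 B\<close>\<close>

definition transfer_function ::
  "complex poly mat \<Rightarrow> complex mat \<Rightarrow> complex mat \<Rightarrow> complex mat \<Rightarrow> complex mat
    \<Rightarrow> complex poly fract mat" where
  "transfer_function P C A E B =
     rat_mat P + rat_mat (const_mat C)
       * inv_mat (rat_mat (lam \<cdot>\<^sub>m const_mat E - const_mat A)) * rat_mat (const_mat B)"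

definition realization ::
  "nat \<Rightarrow> nat \<Rightarrow> complex poly mat \<Rightarrow> complex mat \<Rightarrow> complex mat \<Rightarrow> complex mat \<Rightarrow> complex mat
    \<Rightarrow> bool" where
  "realization n r P C A E B \<longleftrightarrow>
     P \<in> carrier_mat n n \<and> C \<in> carrier_mat n r \<and> A \<in> carrier_mat r r \<and>
     E \<in> carrier_mat r r \<and> B \<in> carrier_mat r n \<and> det E \<noteq> 0"

definition minimal_realization ::
  "nat \<Rightarrow> nat \<Rightarrow> complex poly mat \<Rightarrow> complex mat \<Rightarrow> complex mat \<Rightarrow> complex mat \<Rightarrow> complex mat
    \<Rightarrow> bool" where
  "minimal_realization n r P C A E B \<longleftrightarrow>
     realization n r P C A E B \<and>
     (\<forall>r' P' C' A' E' B'. realization n r' P' C' A' E' B' \<and>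
        transfer_function P' C' A' E' B' = transfer_function P C A E B \<longrightarrow> r \<le> r')"

definition system_matrix ::
  "complex poly mat \<Rightarrow> complex mat \<Rightarrow> complex mat \<Rightarrow> complex mat \<Rightarrow> complex mat
    \<Rightarrow> complex poly mat" where
  "system_matrix P C A E B =
     four_block_mat P (const_mat C) (const_mat B) (const_mat A - lam \<cdot>\<^sub>m const_mat E)"


section \<open>Fiedler matrices and generalized Fiedler pencils\<close>

definition fiedler_P_zero :: "nat \<Rightarrow> nat \<Rightarrow> (nat \<Rightarrow> complex mat) \<Rightarrow> complex mat" where
  "fiedler_P_zero n m Ac = diag_block_mat [1\<^sub>m ((m - 1) * n), - Ac 0]"

definition fiedler_P_neg_m :: "nat \<Rightarrow> nat \<Rightarrow> (nat \<Rightarrow> complex mat) \<Rightarrow> complex mat" where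
  "fiedler_P_neg_m n m Ac = diag_block_mat [Ac m, 1\<^sub>m ((m - 1) * n)]"

text \<open>For \<open>1 \<le> i \<le> m - 1\<close> only.\<close>

definition fiedler_P_mid :: "nat \<Rightarrow> nat \<Rightarrow> (nat \<Rightarrow> complex mat) \<Rightarrow> nat \<Rightarrow> complex mat" where
  "fiedler_P_mid n m Ac i = diag_block_mat
     [1\<^sub>m ((m - i - 1) * n),
      four_block_mat (- Ac i) (1\<^sub>m n) (1\<^sub>m n) (0\<^sub>m n n),
      1\<^sub>m ((i - 1) * n)]"

text \<open>The last column of \<open>I_m\<close>, as an \<open>m \<times> 1\<close> matrix.\<close>

definition e_last :: "nat \<Rightarrow> complex mat" where
  "e_last m = mat_of_cols m [unit_vec m (m - 1)]"

definition fiedler_S_zero ::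
  "nat \<Rightarrow> nat \<Rightarrow> (nat \<Rightarrow> complex mat) \<Rightarrow> complex mat \<Rightarrow> complex mat \<Rightarrow> complex mat
    \<Rightarrow> complex mat" where
  "fiedler_S_zero n m Ac C A B = four_block_mat
     (fiedler_P_zero n m Ac)                (- kron (e_last m) C)
     (- kron (transpose_mat (e_last m)) B)  (- A)"

definition fiedler_S_neg_m ::
  "nat \<Rightarrow> nat \<Rightarrow> (nat \<Rightarrow> complex mat) \<Rightarrow> complex mat \<Rightarrow> complex mat" where
  "fiedler_S_neg_m n m Ac E = diag_block_mat [fiedler_P_neg_m n m Ac, - E]"

definition fiedler_S_mid ::
  "nat \<Rightarrow> nat \<Rightarrow> nat \<Rightarrow> (nat \<Rightarrow> complex mat) \<Rightarrow> nat \<Rightarrow> complex mat" where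
  "fiedler_S_mid n m r Ac i = diag_block_mat [fiedler_P_mid n m Ac i, 1\<^sub>m r]"

text \<open>Meaningful for \<open>- m \<le> k \<le> m\<close> with \<open>m \<ge> 1\<close>; the index \<open>k = m\<close> requires \<open>Ac m\<close> to be
  nonsingular.\<close>

definition fiedler_S ::
  "nat \<Rightarrow> nat \<Rightarrow> nat \<Rightarrow> (nat \<Rightarrow> complex mat) \<Rightarrow> complex mat \<Rightarrow> complex mat \<Rightarrow> complex mat
    \<Rightarrow> complex mat \<Rightarrow> int \<Rightarrow> complex mat" where
  "fiedler_S n m r Ac C A E B k =
     (if k = 0 then fiedler_S_zero n m Ac C A B
      else if k = - int m then fiedler_S_neg_m n m Ac E
      else if k = int m then inv_mat (fiedler_S_neg_m n m Ac E)
      else if k > 0 then fiedler_S_mid n m r Ac (nat k)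
      else inv_mat (fiedler_S_mid n m r Ac (nat (- k))))"

definition fiedler_S_tuple ::
  "nat \<Rightarrow> nat \<Rightarrow> nat \<Rightarrow> (nat \<Rightarrow> complex mat) \<Rightarrow> complex mat \<Rightarrow> complex mat \<Rightarrow> complex mat
    \<Rightarrow> complex mat \<Rightarrow> int list \<Rightarrow> complex mat" where
  "fiedler_S_tuple n m r Ac C A E B t =
     foldr (\<lambda>k M. fiedler_S n m r Ac C A E B k * M) t (1\<^sub>m (m * n + r))"

definition gen_fiedler_pencil ::
  "nat \<Rightarrow> nat \<Rightarrow> nat \<Rightarrow> (nat \<Rightarrow> complex mat) \<Rightarrow> complex mat \<Rightarrow> complex mat \<Rightarrow> complex mat
    \<Rightarrow> complex mat \<Rightarrow> nat list \<Rightarrow> nat list \<Rightarrow> complex poly mat" where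
  "gen_fiedler_pencil n m r Ac C A E B \<omega>\<^sub>0 \<omega>\<^sub>1 =
     lam \<cdot>\<^sub>m const_mat (fiedler_S_tuple n m r Ac C A E B (map (\<lambda>i. - int i) \<omega>\<^sub>1))
     - const_mat (fiedler_S_tuple n m r Ac C A E B (map int \<omega>\<^sub>0))"


section \<open>Rosenbrock strong linearizations\<close>

definition unimodular :: "nat \<Rightarrow> complex poly mat \<Rightarrow> bool" where
  "unimodular N U \<longleftrightarrow> U \<in> carrier_mat N N \<and> (\<exists>c. c \<noteq> 0 \<and> det U = [:c:])"

text \<open>The value at a pole is irrelevant here (it is \<open>0\<close>), since only limits at infinity are
  taken and there are finitely many poles.\<close>

definition rat_eval :: "complex poly fract \<Rightarrow> complex \<Rightarrow> complex" where
  "rat_eval f z = poly (fst (quot_of_fract f)) z / poly (snd (quot_of_fract f)) z"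

definition biproper :: "nat \<Rightarrow> complex poly fract mat \<Rightarrow> bool" where
  "biproper N F \<longleftrightarrow> F \<in> carrier_mat N N \<and>
     (\<exists>L \<in> carrier_mat N N.
        (\<forall>i<N. \<forall>j<N. ((\<lambda>z. rat_eval (F $$ (i, j)) z) \<longlongrightarrow> L $$ (i, j)) at_infinity) \<and>
        det L \<noteq> 0)"

text \<open>
  \<open>[Bb  H - z K]\<close> has full row rank and \<open>[Cc; H - z K]\<close> has full column rank for all complex
  \<open>z\<close>; here \<open>N\<close> is the number of columns of \<open>Bb\<close> and of rows of \<open>Cc\<close>.  The block row is
  formed by a \<^const>\<open>four_block_mat\<close> whose lower blocks have no rows, and the first argument of
  \<^const>\<open>vec_space.rank\<close> is the number of rows.
\<close>

definition irreducible_system ::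
  "nat \<Rightarrow> nat \<Rightarrow> complex mat \<Rightarrow> complex mat \<Rightarrow> complex mat \<Rightarrow> complex mat \<Rightarrow> bool" where
  "irreducible_system N r Cc H K Bb \<longleftrightarrow>
     (\<forall>z. vec_space.rank r (four_block_mat Bb (H - z \<cdot>\<^sub>m K) (0\<^sub>m 0 N) (0\<^sub>m 0 r)) = r \<and>
          vec_space.rank (N + r) (Cc @\<^sub>r (H - z \<cdot>\<^sub>m K)) = r)"

definition rosenbrock_strong_linearization ::
  "nat \<Rightarrow> nat \<Rightarrow> nat \<Rightarrow> complex poly mat \<Rightarrow> complex mat \<Rightarrow> complex mat \<Rightarrow> complex mat
    \<Rightarrow> complex mat \<Rightarrow> complex poly mat \<Rightarrow> bool" where
  "rosenbrock_strong_linearization n m r P C A E B L \<longleftrightarrow>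
     (\<exists>X Y Cc Bb H K.
        X \<in> carrier_mat (m * n) (m * n) \<and> Y \<in> carrier_mat (m * n) (m * n) \<and>
        Cc \<in> carrier_mat (m * n) r \<and> Bb \<in> carrier_mat r (m * n) \<and>
        H \<in> carrier_mat r r \<and> K \<in> carrier_mat r r \<and>
        L = four_block_mat (const_mat X - lam \<cdot>\<^sub>m const_mat Y) (const_mat Cc)
              (const_mat Bb) (const_mat H - lam \<cdot>\<^sub>m const_mat K) \<and>
        det K \<noteq> 0 \<and>
        irreducible_system (m * n) r Cc H K Bb \<and>
        (\<exists>U V U0 V0.
           unimodular (m * n) U \<and> unimodular (m * n) V \<and>
           U0 \<in> carrier_mat r r \<and> V0 \<in> carrier_mat r r \<and> det U0 \<noteq> 0 \<and> det V0 \<noteq> 0 \<and>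
           diag_block_mat [U, const_mat U0] * L * diag_block_mat [V, const_mat V0] =
             diag_block_mat [1\<^sub>m ((m - 1) * n), system_matrix P C A E B]) \<and>
        (\<exists>Ol Or.
           biproper (m * n) Ol \<and> biproper (m * n) Or \<and>
           Ol * (inverse (to_fract lam) \<cdot>\<^sub>m
                   transfer_function (const_mat X - lam \<cdot>\<^sub>m const_mat Y) Cc H K Bb) * Or =
             diag_block_mat
               [1\<^sub>m ((m - 1) * n),
                inverse (to_fract lam) ^ m \<cdot>\<^sub>m transfer_function P C A E B]))"

end

theory Submission
  imports Defs
begin

text \<open>
  Let \<open>M\<^sub>i\<close> denote the Fiedler matrices of the system matrix.  All factors \<open>M\<^sub>i\<close> with
  \<open>0 < \<bar>i\<bar> < m\<close> have the form \<open>diag(M, I)\<close> with \<open>M\<close> constant and nonsingular, and \<open>M\<^sub>m\<close>, where it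
  occurs, is also block diagonal and nonsingular.  Such factors can be moved across a pencil without
  affecting any property of a Rosenbrock strong linearization.  In this way a generalized Fiedler pencil
  becomes a Fiedler pencil \<open>\<lambda> M\<^sub>-\<^sub>m - M\<^sub>\<sigma>\<close> with \<open>\<sigma>\<close> a permutation of
  \<open>0, \<dots>, m - 1\<close> (lemma \<open>GFP_to_fiedler_pencil\<close>).

  Factors whose indices differ by at least two commute.  Hence the factor of largest index can be moved
  to one end of \<open>M\<^sub>\<sigma>\<close>, and recursively \<open>M\<^sub>\<sigma> = diag(L, I) M\<^sub>0 diag(R, I)\<close>, where \<open>L\<close> and
  \<open>R\<close> are built by attaching one block \<open>[-A\<^sub>i I; I 0]\<close> at a time (lemma
  \<open>fiedler_product_factorization\<close>, predicate \<open>fiedler_factors\<close>).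

  The pencil \<open>\<lambda> diag(X, I) - M\<close> with such a product \<open>M\<close> is reduced by eliminating with an identity
  block of the Fiedler matrix of largest index.  One step splits off an identity block, deletes that
  Fiedler matrix and replaces \<open>X\<close> by \<open>\<lambda> X + A\<^sub>i\<close>.  This is the Horner scheme: from \<open>X = A\<^sub>m\<close> the steps
  lead to \<open>diag(I, P)\<close>, with unimodular factors that leave unchanged the block column and block row
  through which \<open>C\<close> and \<open>B\<close> enter (\<open>fiedler_pencil_system_equiv\<close>).  This is the equivalence with the
  system matrix.

  For the structure at infinity, the transfer function of the pencil is computed as a Schur complement.
  It is the Fiedler pencil of \<open>P\<close> with \<open>A\<^sub>0\<close> replaced by \<open>A\<^sub>0 + C (\<lambda> E - A)\<^sup>-\<^sup>1 B\<close>, which is a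
  proper rational matrix.  After division by \<open>\<lambda>\<close> one eliminates with the identity blocks of the
  leading coefficient instead.  The multipliers are polynomials in \<open>1 / \<lambda>\<close> and in proper matrices, so
  the factors are biproper, and the recursion ends in \<open>\<lambda>\<^sup>-\<^sup>m G\<close>
  (\<open>fiedler_pencil_reversal_equiv\<close>).

  Finally, irreducibility of the pencil reduces to controllability and observability of the given
  realization.  These follow from minimality, because an uncontrollable mode confines the relevant part
  of the state space to an invariant hyperplane and gives a realization with one state less
  (\<open>minimal_imp_controllable\<close>); observability is the transposed statement.
\<close>

section \<open>Matrix algebra with side conditions on dimensions\<close>

text \<open>
  The ring laws of matrices as conditional rewrite rules with equations between dimensions as premises.
  Such premises are solved by rewriting, whereas the size parameters of carrier sets would have to be
  guessed.  Rewriting brings products of rectangular matrices to a normal form: distributed over sums,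
  associated to the right, scalars in front.  Identities of sums are then checked entrywise, with every
  normalised product treated as an atom.
\<close>

lemma mat_mult_assoc: "dim_col A = dim_row B \<Longrightarrow> dim_col B = dim_row C \<Longrightarrow> A * B * C = A * (B * (C :: 'a :: semiring_0 mat))"
  by (rule assoc_mult_mat[of A "dim_row A" "dim_col A" B "dim_col B" C "dim_col C"]) auto

lemma mat_distribs:
  fixes A B C :: "'a :: ring mat"
  shows "dim_row A = dim_row B \<Longrightarrow> dim_col A = dim_col B \<Longrightarrow> dim_col B = dim_row C \<Longrightarrow> (A + B) * C = A * C + B * C"
    "dim_row B = dim_row C \<Longrightarrow> dim_col B = dim_col C \<Longrightarrow> dim_col A = dim_row B \<Longrightarrow> A * (B + C) = A * B + A * C"
    "dim_row A = dim_row B \<Longrightarrow> dim_col A = dim_col B \<Longrightarrow> dim_col B = dim_row C \<Longrightarrow> (A - B) * C = A * C - B * C"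
    "dim_row B = dim_row C \<Longrightarrow> dim_col B = dim_col C \<Longrightarrow> dim_col A = dim_row B \<Longrightarrow> A * (B - C) = A * B - A * C"
    "dim_col A = dim_row B \<Longrightarrow> (- A) * B = - (A * B)"
    "dim_col A = dim_row B \<Longrightarrow> A * (- B) = - (A * B)"
  by (intro add_mult_distrib_mat mult_add_distrib_mat minus_mult_distrib_mat mult_minus_distrib_mat
     uminus_mult_left_mat uminus_mult_right_mat; auto)+

lemma mat_smult_mult:
  fixes A B :: "'a :: comm_ring_1 mat"
  shows "dim_col A = dim_row B \<Longrightarrow> (k \<cdot>\<^sub>m A) * B = k \<cdot>\<^sub>m (A * B)"
    "dim_col A = dim_row B \<Longrightarrow> A * (k \<cdot>\<^sub>m B) = k \<cdot>\<^sub>m (A * B)"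
  by (rule mult_smult_assoc_mat[of A "dim_row A" "dim_col A" B "dim_col B"] mult_smult_distrib[of A "dim_row A" "dim_col A" B "dim_col B"]; auto)+

lemmas mat_ring = mat_mult_assoc mat_distribs mat_smult_mult

lemma four_block_mult:
  fixes A1 :: "'a :: semiring_0 mat"
  assumes "dim_row B1 = dim_row A1" "dim_col C1 = dim_col A1" "dim_row C1 = dim_row D1" "dim_col B1 = dim_col D1"
    "dim_row B2 = dim_row A2" "dim_col C2 = dim_col A2" "dim_row C2 = dim_row D2" "dim_col B2 = dim_col D2"
    "dim_col A1 = dim_row A2" "dim_col D1 = dim_row D2"
  shows "four_block_mat A1 B1 C1 D1 * four_block_mat A2 B2 C2 D2 =
    four_block_mat (A1 * A2 + B1 * C2) (A1 * B2 + B1 * D2) (C1 * A2 + D1 * C2) (C1 * B2 + D1 * D2)"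
  by (rule mult_four_block_mat[of A1 "dim_row A1" "dim_col A1" B1 "dim_col D1" C1 "dim_row D1" D1 A2 "dim_col A2" B2 "dim_col D2" C2 D2])
     (use assms in \<open>auto intro!: carrier_matI\<close>)

lemma four_block_minus:
  assumes "dim_row B1 = dim_row A1" "dim_col C1 = dim_col A1" "dim_row C1 = dim_row D1" "dim_col B1 = dim_col D1"
    "dim_row B2 = dim_row A2" "dim_col C2 = dim_col A2" "dim_row C2 = dim_row D2" "dim_col B2 = dim_col D2"
    "dim_row A1 = dim_row A2" "dim_row D1 = dim_row D2" "dim_col A1 = dim_col A2" "dim_col D1 = dim_col D2"
  shows "four_block_mat A1 B1 C1 D1 - four_block_mat A2 B2 C2 D2 =
    four_block_mat (A1 - A2) (B1 - B2) (C1 - C2) (D1 - D2)"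
  using assms by (intro eq_matI) auto

lemma four_block_smult:
  assumes "dim_row B1 = dim_row A1" "dim_col C1 = dim_col A1" "dim_row C1 = dim_row D1" "dim_col B1 = dim_col D1"
  shows "c \<cdot>\<^sub>m four_block_mat A1 B1 C1 D1 = four_block_mat (c \<cdot>\<^sub>m A1) (c \<cdot>\<^sub>m B1) (c \<cdot>\<^sub>m C1) (c \<cdot>\<^sub>m D1)"
  using assms by (intro eq_matI) auto

section \<open>Fiedler blocks and one elimination step\<close>

text \<open>
  The \<open>n \<times> q\<close> matrix \<open>e = [I 0]\<close>; its transpose embeds the first block.  Together with
  \<open>Z = diag(0, I)\<close> it turns all block manipulations below into computations in \<open>2 \<times> 2\<close> blocks:
  the only relations needed are \<open>e e\<^sup>T = I\<close>, \<open>e Z = 0\<close>, \<open>Z e\<^sup>T = 0\<close>, \<open>Z Z = Z\<close>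
  and \<open>e\<^sup>T e + Z = I\<close>.
\<close>

definition head_proj :: "nat \<Rightarrow> nat \<Rightarrow> 'a :: comm_ring_1 mat" where
  "head_proj n q = mat n q (\<lambda>(i, j). if i = j then 1 else 0)"

definition tail_proj :: "nat \<Rightarrow> nat \<Rightarrow> 'a :: comm_ring_1 mat" where
  "tail_proj n q = mat q q (\<lambda>(i, j). if i = j \<and> n \<le> i then 1 else 0)"

lemma head_tail_dim [simp]: "dim_row (head_proj n q) = n" "dim_col (head_proj n q) = q"
  "dim_row (tail_proj n q) = q" "dim_col (tail_proj n q) = q"
  by (auto simp: head_proj_def tail_proj_def)

lemma if_one_zero_mult:
  "(if P then 1 else 0) * x = (if P then x else (0 :: 'a :: comm_ring_1))"
  "x * (if P then 1 else 0) = (if P then x else (0 :: 'a :: comm_ring_1))"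
  by auto

lemma index_head_proj_mult:
  assumes "n \<le> q" "dim_row X = q" "i < n" "j < dim_col X"
  shows "(head_proj n q * X) $$ (i, j) = X $$ (i, j)"
  using assms by (simp add: scalar_prod_def head_proj_def if_one_zero_mult)

lemma index_head_proj_transpose_mult:
  assumes "n \<le> q" "dim_row X = n" "i < q" "j < dim_col X"
  shows "((head_proj n q)\<^sup>T * X) $$ (i, j) = (if i < n then X $$ (i, j) else 0)"
  using assms by (simp add: scalar_prod_def head_proj_def if_one_zero_mult)

lemma index_mult_head_proj:
  assumes "n \<le> q" "dim_col X = n" "i < dim_row X" "j < q"
  shows "(X * head_proj n q) $$ (i, j) = (if j < n then X $$ (i, j) else 0)"
  using assms by (simp add: scalar_prod_def head_proj_def if_one_zero_mult)

lemma index_tail_proj_mult: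
  assumes "dim_row X = q" "i < q" "j < dim_col X"
  shows "(tail_proj n q * X) $$ (i, j) = (if n \<le> i then X $$ (i, j) else 0)"
  using assms by (cases "n \<le> i") (simp_all add: scalar_prod_def tail_proj_def if_one_zero_mult)

lemma transpose_tail_proj [simp]: "(tail_proj n q)\<^sup>T = tail_proj n q"
  by (rule eq_matI) (auto simp: tail_proj_def)

lemma head_tail_mult:
  assumes "n \<le> q"
  shows "head_proj n q * (head_proj n q)\<^sup>T = (1\<^sub>m n :: 'a :: comm_ring_1 mat)"
    "head_proj n q * tail_proj n q = (0\<^sub>m n q :: 'a mat)"
    "tail_proj n q * (head_proj n q)\<^sup>T = (0\<^sub>m q n :: 'a mat)"
    "tail_proj n q * tail_proj n q = (tail_proj n q :: 'a mat)"
    "(head_proj n q)\<^sup>T * head_proj n q = (1\<^sub>m q - tail_proj n q :: 'a mat)"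
  using assms
  by (auto intro!: eq_matI simp del: index_mult_mat(1) simp add: index_head_proj_mult index_tail_proj_mult index_head_proj_transpose_mult)
     (simp_all add: head_proj_def tail_proj_def)

text \<open>
  The same relations in the form in which they apply inside a product associated to the right.
\<close>

lemma head_tail_mult_assoc:
  fixes X :: "'a :: comm_ring_1 mat"
  assumes "n \<le> q"
  shows "dim_row X = n \<Longrightarrow> head_proj n q * ((head_proj n q)\<^sup>T * X) = X"
    "dim_row X = q \<Longrightarrow> head_proj n q * (tail_proj n q * X) = 0\<^sub>m n (dim_col X)"
    "dim_row X = n \<Longrightarrow> tail_proj n q * ((head_proj n q)\<^sup>T * X) = 0\<^sub>m q (dim_col X)"
    "dim_row X = q \<Longrightarrow> tail_proj n q * (tail_proj n q * X) = tail_proj n q * X"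
    "dim_row X = q \<Longrightarrow> (head_proj n q)\<^sup>T * (head_proj n q * X) = X - tail_proj n q * X"
  by (simp_all flip: mat_mult_assoc add: head_tail_mult[OF assms] mat_distribs)

lemma head_tail_sandwich:
  assumes "dim_row X = n" "dim_col X = n"
  shows "(head_proj n (n + p))\<^sup>T * X * head_proj n (n + p) + tail_proj n (n + p) =
    four_block_mat X (0\<^sub>m n p) (0\<^sub>m p n) (1\<^sub>m p)" (is "?L = ?R")
proof -
  show ?thesis
    using assms
    by (intro eq_matI) (auto simp del: index_mult_mat(1) simp add: index_mult_head_proj index_head_proj_transpose_mult tail_proj_def)
qed

lemma zero_mat_simps: "dim_row A = k \<Longrightarrow> dim_col A = l \<Longrightarrow> A + 0\<^sub>m k l = (A :: 'a :: comm_ring_1 mat)" 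
  "dim_row A = k \<Longrightarrow> dim_col A = l \<Longrightarrow> 0\<^sub>m k l + A = (A :: 'a :: comm_ring_1 mat)" 
  "dim_row A = k \<Longrightarrow> dim_col A = l \<Longrightarrow> A - 0\<^sub>m k l = (A :: 'a :: comm_ring_1 mat)" 
  "dim_row A = k \<Longrightarrow> dim_col A = l \<Longrightarrow> 0\<^sub>m k l - A = (- A :: 'a :: comm_ring_1 mat)" 
  "- 0\<^sub>m k l = (0\<^sub>m k l :: 'a :: comm_ring_1 mat)"
  "c \<cdot>\<^sub>m 0\<^sub>m k l = (0\<^sub>m k l :: 'a :: comm_ring_1 mat)"
  by (auto intro!: eq_matI)

text \<open>
  The matrix \<open>diag([-a I; I 0], I)\<close> of size \<open>n + q\<close>, the nontrivial part of a Fiedler matrix,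
  written with \<open>e\<close> and \<open>Z\<close> so that its first block row and column can be split off; see
  \<open>fiedler_block_dsum\<close> for the usual shape.
\<close>

definition fiedler_block :: "nat \<Rightarrow> nat \<Rightarrow> 'a :: comm_ring_1 mat \<Rightarrow> 'a mat" where
  "fiedler_block n q a = four_block_mat (- a) (head_proj n q) ((head_proj n q)\<^sup>T) (tail_proj n q)"

text \<open>
  One Horner step.  The entry \<open>-e\<^sup>T\<close>, an identity block below the leading block \<open>s X + a\<close>, is used
  as pivot: the right factor clears the \<open>s\<close> in its row and the left factor clears the column above it
  and moves the pivot to the top.  What remains is the pencil of the smaller product \<open>N\<close>, with
  \<open>X\<close> replaced by \<open>s X + a\<close>.  Neither factor depends on \<open>N\<close>.
\<close>

lemma pencil_step_identity:
  fixes s :: "'a :: comm_ring_1"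
  assumes nq: "n \<le> q" and [simp]: "dim_row X = n" "dim_col X = n" "dim_row a = n" "dim_col a = n"
    "dim_row N = q" "dim_col N = q" 
  defines "e \<equiv> head_proj n q" and "Z \<equiv> tail_proj n q" and "X' \<equiv> s \<cdot>\<^sub>m X + a"
  shows "four_block_mat (0\<^sub>m n n) (- e) (e\<^sup>T) (e\<^sup>T * X' * e + Z) *
    (four_block_mat (s \<cdot>\<^sub>m X) (0\<^sub>m n q) (0\<^sub>m q n) (s \<cdot>\<^sub>m 1\<^sub>m q)
      - fiedler_block n q a * four_block_mat (1\<^sub>m n) (0\<^sub>m n q) (0\<^sub>m q n) N)
    * four_block_mat (1\<^sub>m n) (s \<cdot>\<^sub>m e) (0\<^sub>m q n) (1\<^sub>m q)
    = four_block_mat (1\<^sub>m n) (0\<^sub>m n q) (0\<^sub>m q n) (s \<cdot>\<^sub>m (e\<^sup>T * X' * e + Z) - N)"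
  unfolding fiedler_block_def e_def Z_def X'_def
  apply (simp add: four_block_mult four_block_minus mat_ring head_tail_mult[OF nq] head_tail_mult_assoc[OF nq] zero_mat_simps)
  apply (rule cong_four_block_mat)
  apply (rule eq_matI; simp del: index_mult_mat(1) add: algebra_simps)+
  done

text \<open>
  The corresponding step at infinity, where \<open>\<mu>\<close> stands for the inverse of the indeterminate and is
  small, so that the pivot must be an identity block of the leading coefficient: the right factor
  clears the entry to the left of the pivot, the left factor clears the column of the pivot with
  multiples of blocks of \<open>N\<close>.  This leaves powers of \<open>\<mu>\<close> on the first block
  row or column of \<open>N\<close>; the weights \<open>\<alpha>\<close> and \<open>\<beta>\<close> record them and make the identity iterable.
\<close>

lemma reversal_step_identity:
  fixes \<mu> \<alpha> \<beta> :: "'a :: comm_ring_1"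
  assumes nq: "n \<le> q" and [simp]: "dim_row X = n" "dim_col X = n" "dim_row a = n" "dim_col a = n"
    "dim_row N = q" "dim_col N = q" 
  defines "e \<equiv> head_proj n q" and "Z \<equiv> tail_proj n q" and "X' \<equiv> X + (\<mu> * \<alpha> * \<beta>) \<cdot>\<^sub>m a"
  shows "four_block_mat (0\<^sub>m n n) e (e\<^sup>T) Z *
     (four_block_mat (1\<^sub>m n) ((\<mu> * \<alpha>) \<cdot>\<^sub>m (e * N * e\<^sup>T * e)) (0\<^sub>m q n) (1\<^sub>m q + \<mu> \<cdot>\<^sub>m (Z * N * e\<^sup>T * e)) *
    (four_block_mat X (0\<^sub>m n q) (0\<^sub>m q n) (1\<^sub>m q)
      - \<mu> \<cdot>\<^sub>m (four_block_mat (\<alpha> \<cdot>\<^sub>m 1\<^sub>m n) (0\<^sub>m n q) (0\<^sub>m q n) (1\<^sub>m q) * 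
      (fiedler_block n q a * four_block_mat (1\<^sub>m n) (0\<^sub>m n q) (0\<^sub>m q n) N) *
      four_block_mat (\<beta> \<cdot>\<^sub>m 1\<^sub>m n) (0\<^sub>m n q) (0\<^sub>m q n) (1\<^sub>m q)))
    * four_block_mat (1\<^sub>m n) (0\<^sub>m n q) ((\<mu> * \<beta>) \<cdot>\<^sub>m e\<^sup>T) (1\<^sub>m q))
   * four_block_mat (0\<^sub>m n n) e (e\<^sup>T) Z
    = four_block_mat (1\<^sub>m n) (0\<^sub>m n q) (0\<^sub>m q n) ((e\<^sup>T * X' * e + Z) - 
      \<mu> \<cdot>\<^sub>m ((e\<^sup>T * (\<alpha> \<cdot>\<^sub>m 1\<^sub>m n) * e + Z) * N * (e\<^sup>T * ((\<mu> * \<beta>) \<cdot>\<^sub>m 1\<^sub>m n) * e + Z)))"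
  unfolding fiedler_block_def e_def Z_def X'_def
  apply (simp add: four_block_mult four_block_minus four_block_smult mat_ring head_tail_mult[OF nq] head_tail_mult_assoc[OF nq] zero_mat_simps)
  apply (intro cong_four_block_mat)
  apply (rule eq_matI; simp del: index_mult_mat(1) add: algebra_simps)+
  done

section \<open>Direct sums and equivalence over a coefficient ring\<close>

definition dsum :: "'a :: zero mat \<Rightarrow> 'a mat \<Rightarrow> 'a mat" (infixr "\<boxplus>" 66) where
  "dsum A B = four_block_mat A (0\<^sub>m (dim_row A) (dim_col B)) (0\<^sub>m (dim_row B) (dim_col A)) B"

lemma dsum_dim [simp]: "dim_row (A \<boxplus> B) = dim_row A + dim_row B" "dim_col (A \<boxplus> B) = dim_col A + dim_col B"
  by (auto simp: dsum_def)

lemma dsum_carrier [simp]: "A \<in> carrier_mat k l \<Longrightarrow> B \<in> carrier_mat k' l' \<Longrightarrow> A \<boxplus> B \<in> carrier_mat (k + k') (l + l')"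
  by (auto simp: dsum_def)

lemma index_dsum:
  "i < dim_row A + dim_row B \<Longrightarrow> j < dim_col A + dim_col B \<Longrightarrow> (A \<boxplus> B) $$ (i, j) =
   (if i < dim_row A then if j < dim_col A then A $$ (i, j) else 0
    else if j < dim_col A then 0 else B $$ (i - dim_row A, j - dim_col A))"
  by (auto simp: dsum_def)

lemma dsum_assoc: "(A \<boxplus> B) \<boxplus> C = A \<boxplus> (B \<boxplus> C)"
  unfolding dsum_def by (rule assoc_four_block_mat[symmetric])

lemma dsum_one: "1\<^sub>m k \<boxplus> 1\<^sub>m l = 1\<^sub>m (k + l)"
  by (rule eq_matI) (auto simp: index_dsum)

lemma dsum_one_one: "1\<^sub>m k \<boxplus> (1\<^sub>m l \<boxplus> A) = 1\<^sub>m (k + l) \<boxplus> A"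
  by (simp add: dsum_one flip: dsum_assoc)

lemma dsum_empty [simp]: "1\<^sub>m 0 \<boxplus> A = A" "A \<boxplus> 1\<^sub>m 0 = A"
  by (rule eq_matI; auto simp: index_dsum)+

lemma dsum_mult:
  fixes A :: "'a :: comm_ring_1 mat"
  shows "dim_col A = dim_row A' \<Longrightarrow> dim_col B = dim_row B' \<Longrightarrow> (A \<boxplus> B) * (A' \<boxplus> B') = (A * A') \<boxplus> (B * B')"
  by (simp add: dsum_def four_block_mult zero_mat_simps)

lemma dsum_transpose: "(A \<boxplus> B)\<^sup>T = A\<^sup>T \<boxplus> B\<^sup>T"
  by (rule eq_matI) (auto simp: index_dsum)

lemma dsum_map: "f 0 = 0 \<Longrightarrow> map_mat f (A \<boxplus> B) = map_mat f A \<boxplus> map_mat f B"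
  by (rule eq_matI) (auto simp: index_dsum)

lemma mat_transpose_mult: "dim_col A = dim_row B \<Longrightarrow> (A * (B :: 'a :: comm_ring_1 mat))\<^sup>T = B\<^sup>T * A\<^sup>T"
  by (rule transpose_mult[of A "dim_row A" "dim_col A" B "dim_col B"]) auto

definition entries_in :: "'a set \<Rightarrow> 'a mat \<Rightarrow> bool" where
  "entries_in S A \<longleftrightarrow> (\<forall>i<dim_row A. \<forall>j<dim_col A. A $$ (i, j) \<in> S)"

lemma entries_in_UNIV [simp]: "entries_in UNIV A"
  by (simp add: entries_in_def)

text \<open>
  Invertibility of a matrix within the matrices over a set \<open>S\<close> of coefficients.  Unimodular matrices
  are the case of all polynomials, biproper matrices the case of the rational functions that have a
  limit at infinity, so one notion serves both equivalences.
\<close>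

definition invertible_over :: "'a :: comm_ring_1 set \<Rightarrow> nat \<Rightarrow> 'a mat \<Rightarrow> bool" where
  "invertible_over S N U \<longleftrightarrow> U \<in> carrier_mat N N \<and> entries_in S U \<and>
     (\<exists>U' \<in> carrier_mat N N. entries_in S U' \<and> U * U' = 1\<^sub>m N \<and> U' * U = 1\<^sub>m N)"

lemma invertible_overD: "invertible_over S N U \<Longrightarrow> dim_row U = N" "invertible_over S N U \<Longrightarrow> dim_col U = N"
  by (auto simp: invertible_over_def)

lemma invertible_overI:
  assumes "dim_row U = N" "dim_col U = N" "dim_row U' = N" "dim_col U' = N" 
   "entries_in S U" "entries_in S U'" "U * U' = 1\<^sub>m N" "U' * U = 1\<^sub>m N"
  shows "invertible_over S N U"
  using assms unfolding invertible_over_def by (auto intro!: bexI[of _ U'])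

locale coefficient_ring =
  fixes S :: "'a :: comm_ring_1 set"
  assumes zero_in: "0 \<in> S" and one_in: "1 \<in> S"
    and add_in: "x \<in> S \<Longrightarrow> y \<in> S \<Longrightarrow> x + y \<in> S"
    and mult_in: "x \<in> S \<Longrightarrow> y \<in> S \<Longrightarrow> x * y \<in> S"
    and uminus_in: "x \<in> S \<Longrightarrow> - x \<in> S"
begin

lemma sum_in: "(\<And>i. i \<in> I \<Longrightarrow> f i \<in> S) \<Longrightarrow> sum f I \<in> S"
  by (induction I rule: infinite_finite_induct) (auto intro: zero_in add_in)

lemma prod_in: "(\<And>i. i \<in> I \<Longrightarrow> f i \<in> S) \<Longrightarrow> prod f I \<in> S"
  by (induction I rule: infinite_finite_induct) (auto intro: one_in mult_in)

lemma power_in: "x \<in> S \<Longrightarrow> x ^ k \<in> S"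
  by (induction k) (auto intro: one_in mult_in)

lemma entries_mult: "dim_col A = dim_row B \<Longrightarrow> entries_in S A \<Longrightarrow> entries_in S B \<Longrightarrow> entries_in S (A * B)"
  by (auto simp: entries_in_def scalar_prod_def intro!: sum_in mult_in)

lemma entries_add: "dim_row A = dim_row B \<Longrightarrow> dim_col A = dim_col B \<Longrightarrow> entries_in S A \<Longrightarrow> entries_in S B \<Longrightarrow> entries_in S (A + B)"
  by (auto simp: entries_in_def intro!: add_in)

lemma entries_uminus: "entries_in S A \<Longrightarrow> entries_in S (- A)"
  by (auto simp: entries_in_def intro!: uminus_in)

lemma entries_smult: "c \<in> S \<Longrightarrow> entries_in S A \<Longrightarrow> entries_in S (c \<cdot>\<^sub>m A)"
  by (auto simp: entries_in_def intro!: mult_in)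

lemma entries_transpose: "entries_in S A \<Longrightarrow> entries_in S (A\<^sup>T)"
  by (auto simp: entries_in_def)

lemma entries_basic: "entries_in S (0\<^sub>m k l)" "entries_in S (1\<^sub>m k)" "entries_in S (head_proj k l)" "entries_in S (tail_proj k l)"
  by (auto simp: entries_in_def head_proj_def tail_proj_def zero_in one_in)

lemma entries_four_block:
  assumes "dim_row B = dim_row A" "dim_col C = dim_col A" "dim_row C = dim_row D" "dim_col B = dim_col D"
    and "entries_in S A" "entries_in S B" "entries_in S C" "entries_in S D"
  shows "entries_in S (four_block_mat A B C D)"
  using assms by (auto simp: entries_in_def)

lemma entries_dsum: "entries_in S A \<Longrightarrow> entries_in S B \<Longrightarrow> entries_in S (A \<boxplus> B)"
  by (auto simp: dsum_def intro!: entries_four_block entries_basic)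

lemmas entries_intros = entries_mult entries_add entries_uminus entries_smult entries_transpose
  entries_basic entries_four_block entries_dsum

lemma invertible_over_mult:
  assumes "invertible_over S N U" "invertible_over S N V"
  shows "invertible_over S N (U * V)"
proof -
  from assms obtain U' V' where *: "U \<in> carrier_mat N N" "V \<in> carrier_mat N N" "U' \<in> carrier_mat N N" "V' \<in> carrier_mat N N"
    "entries_in S U" "entries_in S V" "entries_in S U'" "entries_in S V'"
    "U * U' = 1\<^sub>m N" "U' * U = 1\<^sub>m N" "V * V' = 1\<^sub>m N" "V' * V = 1\<^sub>m N"
    unfolding invertible_over_def by blast
  have d: "dim_row U = N" "dim_row V = N" "dim_row U' = N" "dim_row V' = N"
     "dim_col U = N" "dim_col V = N" "dim_col U' = N" "dim_col V' = N" using * by auto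
  have "U * V * (V' * U') = U * (V * V') * U'" "V' * U' * (U * V) = V' * (U' * U) * V"
    using d by (simp_all add: mat_mult_assoc)
  then have inv: "U * V * (V' * U') = 1\<^sub>m N" "V' * U' * (U * V) = 1\<^sub>m N"
    using * d by simp_all
  show ?thesis
    by (rule invertible_overI[OF _ _ _ _ _ _ inv]) (use * d in \<open>simp_all add: entries_mult\<close>)
qed

lemma invertible_over_transpose:
  assumes "invertible_over S N U"
  shows "invertible_over S N (U\<^sup>T)"
proof -
  from assms obtain U' where *: "U \<in> carrier_mat N N" "U' \<in> carrier_mat N N" 
    "entries_in S U" "entries_in S U'" "U * U' = 1\<^sub>m N" "U' * U = 1\<^sub>m N"
    unfolding invertible_over_def by blast
  have "U\<^sup>T * U'\<^sup>T = 1\<^sub>m N" "U'\<^sup>T * U\<^sup>T = 1\<^sub>m N"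
    using * by (simp_all flip: mat_transpose_mult)
  with * show ?thesis
    unfolding invertible_over_def by (auto intro!: bexI[of _ "U'\<^sup>T"] entries_transpose)
qed

lemma invertible_over_dsum_one:
  assumes "invertible_over S N U"
  shows "invertible_over S (k + N) (1\<^sub>m k \<boxplus> U)"
proof -
  from assms obtain U' where *: "U \<in> carrier_mat N N" "U' \<in> carrier_mat N N" 
    "entries_in S U" "entries_in S U'" "U * U' = 1\<^sub>m N" "U' * U = 1\<^sub>m N"
    unfolding invertible_over_def by blast
  then show ?thesis
    unfolding invertible_over_def
    by (auto intro!: bexI[of _ "1\<^sub>m k \<boxplus> U'"] entries_dsum entries_basic simp: dsum_mult dsum_one)
qed

end

interpretation univ: coefficient_ring UNIV
  by unfold_locales auto

text \<open>
  Padding with zero rows is used for the block column \<open>[0; \<dots>; 0; I]\<close>, through which \<open>C\<close> and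
  \<open>B\<close> enter the system matrix.
\<close>

definition top_zero :: "nat \<Rightarrow> 'a :: zero mat \<Rightarrow> 'a mat" where
  "top_zero k Y = 0\<^sub>m k (dim_col Y) @\<^sub>r Y"

lemma top_zero_dim [simp]: "dim_row (top_zero k Y) = k + dim_row Y" "dim_col (top_zero k Y) = dim_col Y"
  by (auto simp: top_zero_def append_rows_def)

lemma index_top_zero: "i < k + dim_row Y \<Longrightarrow> j < dim_col Y \<Longrightarrow> top_zero k Y $$ (i, j) = (if i < k then 0 else Y $$ (i - k, j))"
  by (auto simp: top_zero_def append_rows_def)

lemma top_zero_top_zero: "top_zero k (top_zero l Y) = top_zero (k + l) Y"
  by (rule eq_matI) (auto simp: index_top_zero)

lemma top_zero_0 [simp]: "top_zero 0 Y = Y"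
  by (rule eq_matI) (auto simp: index_top_zero)

lemma four_block_top_zero:
  fixes A :: "'a :: comm_ring_1 mat"
  assumes "dim_row B = dim_row A" "dim_col C = dim_col A" "dim_row C = dim_row D" "dim_col B = dim_col D"
    "dim_col A = k" "dim_col D = dim_row Y"
  shows "four_block_mat A B C D * top_zero k Y = (B * Y) @\<^sub>r (D * Y)"
  using assms by (simp add: top_zero_def append_rows_def four_block_mult zero_mat_simps) 

lemma dsum_top_zero:
  fixes A :: "'a :: comm_ring_1 mat"
  assumes "dim_col A = k" "dim_col B = dim_row Y"
  shows "(A \<boxplus> B) * top_zero k Y = top_zero (dim_row A) (B * Y)"
  using assms by (simp add: dsum_def four_block_top_zero) (simp add: top_zero_def)

text \<open>
  Equivalence of a pencil \<open>F\<close> together with an input column \<open>G\<close> and an output row \<open>H\<close>.  Bordering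
  \<open>F\<close> by \<open>G C\<close> and \<open>B H\<close> gives a system matrix, and such an equivalence extends to it with identity
  transformations on the state space, whatever \<open>B\<close> and \<open>C\<close> are.
\<close>

definition system_equiv :: "nat \<Rightarrow> 'a :: comm_ring_1 mat \<Rightarrow> 'a mat \<Rightarrow> 'a mat \<Rightarrow> 'a mat \<Rightarrow> 'a mat \<Rightarrow> 'a mat \<Rightarrow> bool" where
  "system_equiv N F G H F' G' H' \<longleftrightarrow> (\<exists>U V. invertible_over UNIV N U \<and> invertible_over UNIV N V \<and>
     U * F * V = F' \<and> U * G = G' \<and> H * V = H')"

lemma system_equiv_transpose:
  assumes "system_equiv N F G H F' G' H'" "F \<in> carrier_mat N N" "dim_row G = N" "dim_col H = N" 
  shows "system_equiv N (F\<^sup>T) (H\<^sup>T) (G\<^sup>T) (F'\<^sup>T) (H'\<^sup>T) (G'\<^sup>T)"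
proof -
  from assms(1) obtain U V where *: "invertible_over UNIV N U" "invertible_over UNIV N V" 
     "U * F * V = F'" "U * G = G'" "H * V = H'" unfolding system_equiv_def by blast
  note d = invertible_overD[OF *(1)] invertible_overD[OF *(2)]
  show ?thesis unfolding system_equiv_def
  proof (intro exI conjI)
    show "invertible_over UNIV N (V\<^sup>T)" "invertible_over UNIV N (U\<^sup>T)"
      using * by (auto intro: univ.invertible_over_transpose)
    have "V\<^sup>T * F\<^sup>T * U\<^sup>T = (U * F * V)\<^sup>T"
      using d assms(2-) by (simp add: mat_transpose_mult mat_mult_assoc)
    then show "V\<^sup>T * F\<^sup>T * U\<^sup>T = F'\<^sup>T" by (simp only: *)
  qed (use assms(2-) d in \<open>simp_all flip: *(3-5) add: mat_transpose_mult\<close>)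
qed

lemma system_equiv_trans:
  assumes "system_equiv N F G H F' G' H'" "system_equiv N F' G' H' F'' G'' H''"
    "F \<in> carrier_mat N N" "dim_row G = N" "dim_col H = N" 
  shows "system_equiv N F G H F'' G'' H''"
proof -
  from assms obtain U V U' V' where *: "invertible_over UNIV N U" "invertible_over UNIV N V" 
     "invertible_over UNIV N U'" "invertible_over UNIV N V'" 
     "U * F * V = F'" "U * G = G'" "H * V = H'" "U' * F' * V' = F''" "U' * G' = G''" "H' * V' = H''" unfolding system_equiv_def by blast
  note d = invertible_overD[OF *(1)] invertible_overD[OF *(2)] invertible_overD[OF *(3)] invertible_overD[OF *(4)]
  show ?thesis unfolding system_equiv_def
  proof (intro exI conjI)
    show "invertible_over UNIV N (U' * U)" "invertible_over UNIV N (V * V')"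
      using * by (auto intro: univ.invertible_over_mult)
    have [simp]: "dim_row F = N" "dim_col F = N" using assms(3) by auto
    have "U' * U * F * (V * V') = U' * (U * F * V) * V'"
      using d by (simp add: mat_mult_assoc)
    then show "U' * U * F * (V * V') = F''" by (simp only: *)
    have "U' * U * G = U' * (U * G)" "H * (V * V') = H * V * V'"
      using d assms(4,5) by (simp_all add: mat_mult_assoc)
    then show "U' * U * G = G''" "H * (V * V') = H''" by (simp_all only: *)
  qed
qed

lemma system_equiv_dsum_one:
  assumes "system_equiv N F G H F' G' H'" "F \<in> carrier_mat N N" "dim_row G = N" "dim_col H = N" 
  shows "system_equiv (k + N) (1\<^sub>m k \<boxplus> F) (top_zero k G) ((top_zero k (H\<^sup>T))\<^sup>T) 
    (1\<^sub>m k \<boxplus> F') (top_zero k G') ((top_zero k (H'\<^sup>T))\<^sup>T)"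
proof -
  from assms(1) obtain U V where *: "invertible_over UNIV N U" "invertible_over UNIV N V" 
     "U * F * V = F'" "U * G = G'" "H * V = H'" unfolding system_equiv_def by blast
  note d = invertible_overD[OF *(1)] invertible_overD[OF *(2)]
  have "(top_zero k (H\<^sup>T))\<^sup>T * (1\<^sub>m k \<boxplus> V) 
     = ((1\<^sub>m k \<boxplus> V)\<^sup>T * top_zero k (H\<^sup>T))\<^sup>T"
    using assms(4) d by (simp add: mat_transpose_mult)
  also have "\<dots> = (top_zero k ((H * V)\<^sup>T))\<^sup>T"
    using assms(4) d by (simp add: dsum_transpose dsum_top_zero mat_transpose_mult)
  finally have H: "(top_zero k (H\<^sup>T))\<^sup>T * (1\<^sub>m k \<boxplus> V) 
     = (top_zero k ((H * V)\<^sup>T))\<^sup>T" .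
  show ?thesis unfolding system_equiv_def
  proof (intro exI conjI)
    show "invertible_over UNIV (k + N) (1\<^sub>m k \<boxplus> U)" "invertible_over UNIV (k + N) (1\<^sub>m k \<boxplus> V)"
      using * by (auto intro: univ.invertible_over_dsum_one)
    have [simp]: "dim_row F = N" "dim_col F = N" using assms(2) by auto
    have "(1\<^sub>m k \<boxplus> U) * (1\<^sub>m k \<boxplus> F) * (1\<^sub>m k \<boxplus> V) = 1\<^sub>m k \<boxplus> (U * F * V)"
      using d by (simp add: dsum_mult)
    then show "(1\<^sub>m k \<boxplus> U) * (1\<^sub>m k \<boxplus> F) * (1\<^sub>m k \<boxplus> V) = 1\<^sub>m k \<boxplus> F'" by (simp only: *)
    have "(1\<^sub>m k \<boxplus> U) * top_zero k G = top_zero k (U * G)"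
      using d assms(3) by (simp add: dsum_top_zero)
    then show "(1\<^sub>m k \<boxplus> U) * top_zero k G = top_zero k G'" by (simp only: *)
  qed (use H in \<open>simp only: *\<close>)
qed

lemma entries_fiedler_block:
  assumes "coefficient_ring S" "dim_row a = n" "dim_col a = n" "entries_in S a"
  shows "entries_in S (fiedler_block n q a)"
  unfolding fiedler_block_def using assms by (intro coefficient_ring.entries_intros) auto

lemma fiedler_block_dim [simp]: "dim_row (fiedler_block n q a) = dim_row a + q" "dim_col (fiedler_block n q a) = dim_col a + q"
  by (auto simp: fiedler_block_def)

lemma fiedler_block_transpose: "(fiedler_block n q a)\<^sup>T = fiedler_block n q (a\<^sup>T)"
  if "dim_row a = n" "dim_col a = n" for a :: "'a :: comm_ring_1 mat"
  unfolding fiedler_block_def using that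
  by (subst transpose_four_block_mat[of _ n n _ q _ q]) (auto intro!: carrier_matI simp: transpose_uminus)

lemma pencil_step_invertible:
  fixes X :: "'a :: comm_ring_1 mat" and s :: 'a
  assumes nq: "n \<le> q" and [simp]: "dim_row X = n" "dim_col X = n"
  shows "invertible_over UNIV (n + q) (four_block_mat (0\<^sub>m n n) (- head_proj n q) ((head_proj n q)\<^sup>T) ((head_proj n q)\<^sup>T * X * head_proj n q + tail_proj n q))"
    (is "invertible_over _ _ (four_block_mat _ (- ?e) ?t (_ + ?Z))")
    and "invertible_over UNIV (n + q) (four_block_mat (1\<^sub>m n) (s \<cdot>\<^sub>m head_proj n q) (0\<^sub>m q n) (1\<^sub>m q))"
proof -
  note simps = four_block_mult mat_ring head_tail_mult[OF nq] head_tail_mult_assoc[OF nq] zero_mat_simps 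
  show "invertible_over UNIV (n + q) (four_block_mat (0\<^sub>m n n) (- ?e) ?t (?t * X * ?e + ?Z))"
    apply (rule invertible_overI[of _ _ "four_block_mat X ?e (- ?t) ?Z"])
    apply (simp_all add: simps flip: four_block_one_mat)
    apply (rule cong_four_block_mat; (rule refl)?; rule eq_matI; simp del: index_mult_mat(1) add: algebra_simps)+
    done
  show "invertible_over UNIV (n + q) (four_block_mat (1\<^sub>m n) (s \<cdot>\<^sub>m ?e) (0\<^sub>m q n) (1\<^sub>m q))"
    apply (rule invertible_overI[of _ _ "four_block_mat (1\<^sub>m n) (- s \<cdot>\<^sub>m ?e) (0\<^sub>m q n) (1\<^sub>m q)"])
    apply (simp_all add: simps flip: four_block_one_mat)
    apply (rule cong_four_block_mat; (rule refl)?; rule eq_matI; simp del: index_mult_mat(1) add: algebra_simps)+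
    done
qed

text \<open>
  The Horner step when the Fiedler matrix of largest index stands on the left of the product
  \<open>L D R\<close>.  The transformations also respect the column \<open>[0; J]\<close> and the row \<open>[0, J\<^sup>T]\<close>, because
  the left factor times the Fiedler block is lower triangular with identity in its last block and the
  right factor is upper triangular.
\<close>

lemma pencil_step_left:
  fixes s :: "'a :: comm_ring_1"
  assumes [simp]: "dim_row X = n" "dim_col X = n" "dim_row a = n" "dim_col a = n"
    and dims: "dim_row L = n + p" "dim_col L = n + p" "dim_row R = n + p" "dim_col R = n + p" "dim_row D = n + p" "dim_col D = n + p"
    "dim_row J = n + p"
  assumes IH: "system_equiv (n + p) (s \<cdot>\<^sub>m ((s \<cdot>\<^sub>m X + a) \<boxplus> 1\<^sub>m p) - L * D * R) (L * J) (J\<^sup>T * R) F' J (J\<^sup>T)"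
  defines "B \<equiv> fiedler_block n (n + p) a"
  shows "system_equiv (n + (n + p)) (s \<cdot>\<^sub>m (X \<boxplus> 1\<^sub>m (n + p)) - (B * (1\<^sub>m n \<boxplus> L)) * (1\<^sub>m n \<boxplus> D) * (1\<^sub>m n \<boxplus> R))
    ((B * (1\<^sub>m n \<boxplus> L)) * top_zero n J) ((top_zero n J)\<^sup>T * (1\<^sub>m n \<boxplus> R))
    (1\<^sub>m n \<boxplus> F') (top_zero n J) ((top_zero n J)\<^sup>T)"
proof -
  define q where "q = n + p"
  have nq: "n \<le> q" by (simp add: q_def)
  let ?e = "head_proj n q :: 'a mat" let ?t = "(head_proj n q)\<^sup>T :: 'a mat" let ?Z = "tail_proj n q :: 'a mat"
  let ?X' = "s \<cdot>\<^sub>m X + a"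
  let ?U = "four_block_mat (0\<^sub>m n n) (- ?e) ?t (?t * ?X' * ?e + ?Z)"
  let ?V = "four_block_mat (1\<^sub>m n) (s \<cdot>\<^sub>m ?e) (0\<^sub>m q n) (1\<^sub>m q)"
  have [simp]: "dim_row L = q" "dim_col L = q" "dim_row R = q" "dim_col R = q" "dim_row D = q" "dim_col D = q"
    "dim_row J = q" by (simp_all add: q_def dims)
  have B: "B = fiedler_block n q a" "dim_row B = n + q" "dim_col B = n + q" by (simp_all add: B_def q_def)
  define N where "N = L * D * R"
  have [simp]: "dim_row N = q" "dim_col N = q" by (simp_all add: N_def)
  have BN: "(B * (1\<^sub>m n \<boxplus> L)) * (1\<^sub>m n \<boxplus> D) * (1\<^sub>m n \<boxplus> R) = B * (1\<^sub>m n \<boxplus> N)"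
    by (simp add: N_def B dsum_mult mat_mult_assoc)
  have X': "?t * ?X' * ?e + ?Z = ?X' \<boxplus> 1\<^sub>m p"
    unfolding q_def by (simp add: head_tail_sandwich dsum_def)
  have sX: "s \<cdot>\<^sub>m (X \<boxplus> 1\<^sub>m (n + p)) = four_block_mat (s \<cdot>\<^sub>m X) (0\<^sub>m n q) (0\<^sub>m q n) (s \<cdot>\<^sub>m 1\<^sub>m q)"
    by (simp add: dsum_def q_def four_block_smult zero_mat_simps)
  have "?U * (s \<cdot>\<^sub>m (X \<boxplus> 1\<^sub>m (n + p)) - B * (1\<^sub>m n \<boxplus> N)) * ?V = 1\<^sub>m n \<boxplus> (s \<cdot>\<^sub>m (?X' \<boxplus> 1\<^sub>m p) - N)"
    using pencil_step_identity[OF nq, of X a N s] unfolding sX B X' by (simp add: dsum_def q_def)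
  moreover have "?U * (B * (1\<^sub>m n \<boxplus> L) * top_zero n J) = top_zero n (L * J)"
  proof -
    have "?U * (B * (1\<^sub>m n \<boxplus> L) * top_zero n J) = ?U * B * top_zero n (L * J)"
      by (simp add: mat_mult_assoc B dsum_top_zero)
    also have "?U * B = four_block_mat (- 1\<^sub>m n) (0\<^sub>m n q) (?t * (?X' - a)) (1\<^sub>m q)"
      unfolding B fiedler_block_def
      apply (simp add: four_block_mult mat_ring head_tail_mult[OF nq] head_tail_mult_assoc[OF nq] zero_mat_simps)
      apply (intro cong_four_block_mat; rule eq_matI; simp del: index_mult_mat(1) add: algebra_simps)
      done
    also have "\<dots> * top_zero n (L * J) = top_zero n (L * J)"
      by (simp add: four_block_top_zero) (simp add: top_zero_def)
    finally show ?thesis .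
  qed
  moreover have "(top_zero n J)\<^sup>T * (1\<^sub>m n \<boxplus> R) * ?V = (top_zero n ((J\<^sup>T * R)\<^sup>T))\<^sup>T"
  proof -
    have 1: "?V\<^sup>T = four_block_mat (1\<^sub>m n) (0\<^sub>m n q) (s \<cdot>\<^sub>m ?t) (1\<^sub>m q)"
      by (subst transpose_four_block_mat[of _ n n _ q _ q]) (auto intro!: carrier_matI eq_matI)
    have "(top_zero n J)\<^sup>T * (1\<^sub>m n \<boxplus> R) * ?V
       = (?V\<^sup>T * ((1\<^sub>m n \<boxplus> R)\<^sup>T * top_zero n J))\<^sup>T"
      by (simp add: mat_transpose_mult mat_mult_assoc del: transpose_four_block_mat)
    also have "(1\<^sub>m n \<boxplus> R)\<^sup>T * top_zero n J = top_zero n (R\<^sup>T * J)"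
      by (simp add: dsum_transpose dsum_top_zero)
    also have "?V\<^sup>T * \<dots> = top_zero n (R\<^sup>T * J)"
      unfolding 1 by (simp add: four_block_top_zero) (simp add: top_zero_def)
    finally show ?thesis by (simp add: mat_transpose_mult)
  qed
  ultimately have "system_equiv (n + q) (s \<cdot>\<^sub>m (X \<boxplus> 1\<^sub>m (n + p)) - B * (1\<^sub>m n \<boxplus> N))
    ((B * (1\<^sub>m n \<boxplus> L)) * top_zero n J) ((top_zero n J)\<^sup>T * (1\<^sub>m n \<boxplus> R))
    (1\<^sub>m n \<boxplus> (s \<cdot>\<^sub>m (?X' \<boxplus> 1\<^sub>m p) - N)) (top_zero n (L * J)) ((top_zero n ((J\<^sup>T * R)\<^sup>T))\<^sup>T)"
    unfolding system_equiv_def using pencil_step_invertible(1)[OF nq, of ?X'] pencil_step_invertible(2)[OF nq, of ?X' s] by (intro exI conjI) auto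
  moreover have "system_equiv (n + q) (1\<^sub>m n \<boxplus> (s \<cdot>\<^sub>m (?X' \<boxplus> 1\<^sub>m p) - N)) (top_zero n (L * J)) ((top_zero n ((J\<^sup>T * R)\<^sup>T))\<^sup>T)
    (1\<^sub>m n \<boxplus> F') (top_zero n J) ((top_zero n ((J\<^sup>T)\<^sup>T))\<^sup>T)"
    using IH unfolding N_def[symmetric] q_def[symmetric]
    by (rule system_equiv_dsum_one) (auto intro!: carrier_matI simp: q_def)
  ultimately show ?thesis unfolding BN transpose_transpose q_def[symmetric]
    by (rule system_equiv_trans) (auto intro!: carrier_matI simp: B)
qed

lemma mat_transpose_add:
  "dim_row A = dim_row B \<Longrightarrow> dim_col A = dim_col B \<Longrightarrow> (A + B)\<^sup>T = A\<^sup>T + B\<^sup>T"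
  "dim_row A = dim_row B \<Longrightarrow> dim_col A = dim_col B \<Longrightarrow> (A - B)\<^sup>T = A\<^sup>T - B\<^sup>T"
  "(k \<cdot>\<^sub>m A)\<^sup>T = k \<cdot>\<^sub>m A\<^sup>T"
  by (auto intro!: eq_matI)

lemmas mat_transpose = mat_transpose_add mat_transpose_mult dsum_transpose

lemma system_equiv_transposeI:
  assumes "system_equiv N F G H F' G' H'" "dim_row F = N" "dim_col F = N" "dim_row G = N" "dim_col H = N"
    and "F0 = F\<^sup>T" "G0 = H\<^sup>T" "H0 = G\<^sup>T"
    and "F0' = F'\<^sup>T" "G0' = H'\<^sup>T" "H0' = G'\<^sup>T"
  shows "system_equiv N F0 G0 H0 F0' G0' H0'"
  unfolding assms(6-) using system_equiv_transpose[OF assms(1) carrier_matI] assms(2-5) by blast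

text \<open>
  The mirror image of the preceding step, obtained from it by transposition, which exchanges the
  roles of \<open>L\<close> and \<open>R\<close>.
\<close>

lemma pencil_step_right:
  fixes s :: "'a :: comm_ring_1"
  assumes [simp]: "dim_row X = n" "dim_col X = n" "dim_row a = n" "dim_col a = n"
    and dims [simp]: "dim_row L = n + p" "dim_col L = n + p" "dim_row R = n + p" "dim_col R = n + p" "dim_row D = n + p" "dim_col D = n + p"
    "dim_row J = n + p"
  assumes IH: "system_equiv (n + p) (s \<cdot>\<^sub>m ((s \<cdot>\<^sub>m X + a) \<boxplus> 1\<^sub>m p) - L * D * R) (L * J) (J\<^sup>T * R) F' J (J\<^sup>T)"
  defines "B \<equiv> fiedler_block n (n + p) a"
  shows "system_equiv (n + (n + p)) (s \<cdot>\<^sub>m (X \<boxplus> 1\<^sub>m (n + p)) - (1\<^sub>m n \<boxplus> L) * (1\<^sub>m n \<boxplus> D) * ((1\<^sub>m n \<boxplus> R) * B))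
    ((1\<^sub>m n \<boxplus> L) * top_zero n J) ((top_zero n J)\<^sup>T * ((1\<^sub>m n \<boxplus> R) * B))
    (1\<^sub>m n \<boxplus> F') (top_zero n J) ((top_zero n J)\<^sup>T)"
proof -
  let ?T = transpose_mat
  have "system_equiv (n + p) (s \<cdot>\<^sub>m ((s \<cdot>\<^sub>m ?T X + ?T a) \<boxplus> 1\<^sub>m p) - ?T R * ?T D * ?T L) (?T R * J) (?T J * ?T L) (?T F') J (?T J)"
    by (rule system_equiv_transposeI[OF IH]) (simp_all add: mat_transpose mat_mult_assoc)
  from pencil_step_left[OF _ _ _ _ _ _ _ _ _ _ _ this]
  have "system_equiv (n + (n + p)) (s \<cdot>\<^sub>m (?T X \<boxplus> 1\<^sub>m (n + p)) - (?T B * (1\<^sub>m n \<boxplus> ?T R)) * (1\<^sub>m n \<boxplus> ?T D) * (1\<^sub>m n \<boxplus> ?T L))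
    ((?T B * (1\<^sub>m n \<boxplus> ?T R)) * top_zero n J) ((top_zero n J)\<^sup>T * (1\<^sub>m n \<boxplus> ?T L))
    (1\<^sub>m n \<boxplus> ?T F') (top_zero n J) ((top_zero n J)\<^sup>T)"
    by (simp add: B_def fiedler_block_transpose)
  then show ?thesis
    by (rule system_equiv_transposeI) (simp_all add: mat_transpose mat_mult_assoc B_def)
qed

definition equiv_over :: "'a :: comm_ring_1 set \<Rightarrow> nat \<Rightarrow> 'a mat \<Rightarrow> 'a mat \<Rightarrow> bool" where
  "equiv_over S N F F' \<longleftrightarrow> (\<exists>U V. invertible_over S N U \<and> invertible_over S N V \<and> U * F * V = F')"

context coefficient_ring begin

lemma equiv_over_transpose:
  assumes "equiv_over S N F F'" and [simp]: "dim_row F = N" "dim_col F = N"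
  shows "equiv_over S N (F\<^sup>T) (F'\<^sup>T)"
proof -
  from assms(1) obtain U V where *: "invertible_over S N U" "invertible_over S N V" "U * F * V = F'"
    unfolding equiv_over_def by blast
  note d [simp] = invertible_overD[OF *(1)] invertible_overD[OF *(2)]
  have "V\<^sup>T * F\<^sup>T * U\<^sup>T = (U * F * V)\<^sup>T"
    by (simp add: mat_transpose_mult mat_mult_assoc)
  then have "V\<^sup>T * F\<^sup>T * U\<^sup>T = F'\<^sup>T" by (simp only: *)
  with *(1,2) show ?thesis unfolding equiv_over_def by (blast intro: invertible_over_transpose)
qed

lemma equiv_over_transposeI:
  assumes "equiv_over S N F F'" "dim_row F = N" "dim_col F = N"
    and "F0 = F\<^sup>T" "F0' = F'\<^sup>T"
  shows "equiv_over S N F0 F0'"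
  unfolding assms(4-) using equiv_over_transpose[OF assms(1-3)] .

lemma equiv_over_trans:
  assumes "equiv_over S N F F'" "equiv_over S N F' F''" and [simp]: "dim_row F = N" "dim_col F = N"
  shows "equiv_over S N F F''"
proof -
  from assms obtain U V U' V' where *: "invertible_over S N U" "invertible_over S N V" 
     "invertible_over S N U'" "invertible_over S N V'" "U * F * V = F'" "U' * F' * V' = F''"
    unfolding equiv_over_def by blast
  note d [simp] = invertible_overD[OF *(1)] invertible_overD[OF *(2)] invertible_overD[OF *(3)] invertible_overD[OF *(4)]
  have "U' * U * F * (V * V') = U' * (U * F * V) * V'" by (simp add: mat_mult_assoc)
  then have "U' * U * F * (V * V') = F''" by (simp only: *)
  with *(1-4) show ?thesis unfolding equiv_over_def by (blast intro: invertible_over_mult)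
qed

lemma equiv_over_dsum_one:
  assumes "equiv_over S N F F'" and [simp]: "dim_row F = N" "dim_col F = N"
  shows "equiv_over S (k + N) (1\<^sub>m k \<boxplus> F) (1\<^sub>m k \<boxplus> F')"
proof -
  from assms(1) obtain U V where *: "invertible_over S N U" "invertible_over S N V" "U * F * V = F'"
    unfolding equiv_over_def by blast
  note d [simp] = invertible_overD[OF *(1)] invertible_overD[OF *(2)]
  have "(1\<^sub>m k \<boxplus> U) * (1\<^sub>m k \<boxplus> F) * (1\<^sub>m k \<boxplus> V) = 1\<^sub>m k \<boxplus> (U * F * V)"
    by (simp add: dsum_mult)
  then have "(1\<^sub>m k \<boxplus> U) * (1\<^sub>m k \<boxplus> F) * (1\<^sub>m k \<boxplus> V) = 1\<^sub>m k \<boxplus> F'" by (simp only: *)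
  with *(1,2) show ?thesis unfolding equiv_over_def by (blast intro: invertible_over_dsum_one)
qed

text \<open>
  The factor that depends on \<open>N\<close> differs from the identity by a matrix of square zero, since
  \<open>e Z = 0\<close>; changing the sign of this difference gives the inverse.
\<close>

lemma reversal_step_invertible:
  assumes nq: "n \<le> q" and N [simp]: "dim_row N = q" "dim_col N = q" and S: "entries_in S N" "c \<in> S" "\<mu> \<in> S"
  defines "e \<equiv> head_proj n q" and "t \<equiv> (head_proj n q)\<^sup>T" and "Z \<equiv> tail_proj n q"
  shows "invertible_over S (n + q) (four_block_mat (0\<^sub>m n n) e t Z)"
    and "invertible_over S (n + q) (four_block_mat (1\<^sub>m n) (c \<cdot>\<^sub>m (e * N * t * e)) (0\<^sub>m q n) (1\<^sub>m q + \<mu> \<cdot>\<^sub>m (Z * N * t * e)))"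
    and "invertible_over S (n + q) (four_block_mat (1\<^sub>m n) (0\<^sub>m n q) (c \<cdot>\<^sub>m t) (1\<^sub>m q))"
proof -
  note simps = four_block_mult mat_ring head_tail_mult[OF nq] head_tail_mult_assoc[OF nq] zero_mat_simps e_def t_def Z_def
  show "invertible_over S (n + q) (four_block_mat (0\<^sub>m n n) e t Z)"
    apply (rule invertible_overI[of _ _ "four_block_mat (0\<^sub>m n n) e t Z"])
    apply (simp_all add: simps entries_intros flip: four_block_one_mat)
    apply (rule cong_four_block_mat; (rule refl)?; rule eq_matI; simp del: index_mult_mat(1) add: algebra_simps)+
    done
  show "invertible_over S (n + q) (four_block_mat (1\<^sub>m n) (0\<^sub>m n q) (c \<cdot>\<^sub>m t) (1\<^sub>m q))"
    apply (rule invertible_overI[of _ _ "four_block_mat (1\<^sub>m n) (0\<^sub>m n q) (- c \<cdot>\<^sub>m t) (1\<^sub>m q)"])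
    apply (simp_all add: simps entries_intros uminus_in S flip: four_block_one_mat)
    apply (rule cong_four_block_mat; (rule refl)?; rule eq_matI; simp del: index_mult_mat(1) add: algebra_simps)+
    done
  show "invertible_over S (n + q) (four_block_mat (1\<^sub>m n) (c \<cdot>\<^sub>m (e * N * t * e)) (0\<^sub>m q n) (1\<^sub>m q + \<mu> \<cdot>\<^sub>m (Z * N * t * e)))"
    apply (rule invertible_overI[of _ _ "four_block_mat (1\<^sub>m n) (- c \<cdot>\<^sub>m (e * N * t * e)) (0\<^sub>m q n) (1\<^sub>m q + - \<mu> \<cdot>\<^sub>m (Z * N * t * e))"])
    apply (simp_all add: e_def t_def Z_def entries_intros uminus_in S)
    apply (simp_all add: simps flip: four_block_one_mat)
    apply (rule cong_four_block_mat; (rule refl)?; rule eq_matI; simp del: index_mult_mat(1) add: algebra_simps)+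
    done
qed

lemma reversal_step_left:
  assumes [simp]: "dim_row X = n" "dim_col X = n" "dim_row a = n" "dim_col a = n"
    and dims: "dim_row N = n + p" "dim_col N = n + p"
    and S: "entries_in S N" "\<mu> \<in> S" "\<alpha> \<in> S" "\<beta> \<in> S"
    and IH: "equiv_over S (n + p) (((X + (\<mu> * \<alpha> * \<beta>) \<cdot>\<^sub>m a) \<boxplus> 1\<^sub>m p) 
      - \<mu> \<cdot>\<^sub>m (((\<alpha> \<cdot>\<^sub>m 1\<^sub>m n) \<boxplus> 1\<^sub>m p) * N * (((\<mu> * \<beta>) \<cdot>\<^sub>m 1\<^sub>m n) \<boxplus> 1\<^sub>m p))) F'"
  shows "equiv_over S (n + (n + p)) ((X \<boxplus> 1\<^sub>m (n + p)) 
      - \<mu> \<cdot>\<^sub>m (((\<alpha> \<cdot>\<^sub>m 1\<^sub>m n) \<boxplus> 1\<^sub>m (n + p)) * (fiedler_block n (n + p) a * (1\<^sub>m n \<boxplus> N)) * ((\<beta> \<cdot>\<^sub>m 1\<^sub>m n) \<boxplus> 1\<^sub>m (n + p))))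
      (1\<^sub>m n \<boxplus> F')"
proof -
  define q where "q = n + p"
  have nq: "n \<le> q" by (simp add: q_def)
  have [simp]: "dim_row N = q" "dim_col N = q" by (simp_all add: q_def dims)
  let ?e = "head_proj n q :: 'a mat" let ?t = "(head_proj n q)\<^sup>T :: 'a mat" let ?Z = "tail_proj n q :: 'a mat"
  let ?K = "four_block_mat (0\<^sub>m n n) ?e ?t ?Z"
  let ?U = "four_block_mat (1\<^sub>m n) ((\<mu> * \<alpha>) \<cdot>\<^sub>m (?e * N * ?t * ?e)) (0\<^sub>m q n) (1\<^sub>m q + \<mu> \<cdot>\<^sub>m (?Z * N * ?t * ?e))"
  let ?V = "four_block_mat (1\<^sub>m n) (0\<^sub>m n q) ((\<mu> * \<beta>) \<cdot>\<^sub>m ?t) (1\<^sub>m q)"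
  let ?F = "(X \<boxplus> 1\<^sub>m q) - \<mu> \<cdot>\<^sub>m (((\<alpha> \<cdot>\<^sub>m 1\<^sub>m n) \<boxplus> 1\<^sub>m q) * (fiedler_block n q a * (1\<^sub>m n \<boxplus> N)) * ((\<beta> \<cdot>\<^sub>m 1\<^sub>m n) \<boxplus> 1\<^sub>m q))"
  let ?F1 = "((X + (\<mu> * \<alpha> * \<beta>) \<cdot>\<^sub>m a) \<boxplus> 1\<^sub>m p) - \<mu> \<cdot>\<^sub>m (((\<alpha> \<cdot>\<^sub>m 1\<^sub>m n) \<boxplus> 1\<^sub>m p) * N * (((\<mu> * \<beta>) \<cdot>\<^sub>m 1\<^sub>m n) \<boxplus> 1\<^sub>m p))"
  have sandwich: "?t * Y * ?e + ?Z = Y \<boxplus> 1\<^sub>m p" if "dim_row Y = n" "dim_col Y = n" for Y :: "'a mat"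
    unfolding q_def by (simp add: head_tail_sandwich dsum_def that)
  have step: "?K * (?U * ?F * ?V) * ?K = 1\<^sub>m n \<boxplus> ?F1"
    using reversal_step_identity[OF nq, of X a N \<mu> \<alpha> \<beta>] by (simp add: sandwich) (simp add: dsum_def q_def)
  have "?K * ?U * ?F * (?V * ?K) = ?K * (?U * ?F * ?V) * ?K"
    by (simp add: mat_mult_assoc)
  also note step
  finally have "equiv_over S (n + q) ?F (1\<^sub>m n \<boxplus> ?F1)"
    unfolding equiv_over_def using S
    by (intro exI[of _ "?K * ?U"] exI[of _ "?V * ?K"] conjI invertible_over_mult reversal_step_invertible[OF nq] mult_in) auto
  moreover have "equiv_over S (n + q) (1\<^sub>m n \<boxplus> ?F1) (1\<^sub>m n \<boxplus> F')"
    using IH unfolding q_def by (rule equiv_over_dsum_one) auto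
  ultimately show ?thesis unfolding q_def[symmetric] by (rule equiv_over_trans) auto
qed

lemma reversal_step_right:
  assumes [simp]: "dim_row X = n" "dim_col X = n" "dim_row a = n" "dim_col a = n"
    and dims [simp]: "dim_row N = n + p" "dim_col N = n + p"
    and S: "entries_in S N" "\<mu> \<in> S" "\<alpha> \<in> S" "\<beta> \<in> S"
    and IH: "equiv_over S (n + p) (((X + (\<mu> * \<alpha> * \<beta>) \<cdot>\<^sub>m a) \<boxplus> 1\<^sub>m p) 
      - \<mu> \<cdot>\<^sub>m ((((\<mu> * \<alpha>) \<cdot>\<^sub>m 1\<^sub>m n) \<boxplus> 1\<^sub>m p) * N * ((\<beta> \<cdot>\<^sub>m 1\<^sub>m n) \<boxplus> 1\<^sub>m p))) F'"
  shows "equiv_over S (n + (n + p)) ((X \<boxplus> 1\<^sub>m (n + p)) 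
      - \<mu> \<cdot>\<^sub>m (((\<alpha> \<cdot>\<^sub>m 1\<^sub>m n) \<boxplus> 1\<^sub>m (n + p)) * ((1\<^sub>m n \<boxplus> N) * fiedler_block n (n + p) a) * ((\<beta> \<cdot>\<^sub>m 1\<^sub>m n) \<boxplus> 1\<^sub>m (n + p))))
      (1\<^sub>m n \<boxplus> F')"
proof -
  let ?T = transpose_mat
  have "equiv_over S (n + p) (((?T X + (\<mu> * \<beta> * \<alpha>) \<cdot>\<^sub>m ?T a) \<boxplus> 1\<^sub>m p) 
      - \<mu> \<cdot>\<^sub>m (((\<beta> \<cdot>\<^sub>m 1\<^sub>m n) \<boxplus> 1\<^sub>m p) * ?T N * (((\<mu> * \<alpha>) \<cdot>\<^sub>m 1\<^sub>m n) \<boxplus> 1\<^sub>m p))) (?T F')"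
    by (rule equiv_over_transposeI[OF IH]) (simp_all add: mat_transpose mat_mult_assoc mult_ac)
  then have "equiv_over S (n + (n + p)) ((?T X \<boxplus> 1\<^sub>m (n + p)) 
      - \<mu> \<cdot>\<^sub>m (((\<beta> \<cdot>\<^sub>m 1\<^sub>m n) \<boxplus> 1\<^sub>m (n + p)) * (fiedler_block n (n + p) (?T a) * (1\<^sub>m n \<boxplus> ?T N)) * ((\<alpha> \<cdot>\<^sub>m 1\<^sub>m n) \<boxplus> 1\<^sub>m (n + p))))
      (1\<^sub>m n \<boxplus> ?T F')"
    using S by (intro reversal_step_left) (simp_all add: entries_transpose)
  then show ?thesis
    by (rule equiv_over_transposeI) (simp_all add: mat_transpose mat_mult_assoc fiedler_block_transpose)
qed

end

section \<open>Reduction of Fiedler pencils\<close>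

text \<open>
  The left and right factors of a Fiedler product \<open>L diag(I, -A\<^sub>0) R\<close> of the coefficients with
  indices \<open>0, \<dots>, k\<close>: each new coefficient of larger index is put at the left end of \<open>L\<close> or at the
  right end of \<open>R\<close>, next to the previous factors shifted by one block.  The coefficient of index 0
  is kept apart because it is the one that becomes rational in the transfer function.
\<close>

inductive fiedler_factors :: "nat \<Rightarrow> (nat \<Rightarrow> 'a :: comm_ring_1 mat) \<Rightarrow> nat \<Rightarrow> 'a mat \<Rightarrow> 'a mat \<Rightarrow> bool" for n Ac where
  base: "fiedler_factors n Ac 0 (1\<^sub>m n) (1\<^sub>m n)"
| left: "fiedler_factors n Ac k L R \<Longrightarrow>
    fiedler_factors n Ac (Suc k) (fiedler_block n (n + k * n) (Ac (Suc k)) * (1\<^sub>m n \<boxplus> L)) (1\<^sub>m n \<boxplus> R)"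
| right: "fiedler_factors n Ac k L R \<Longrightarrow>
    fiedler_factors n Ac (Suc k) (1\<^sub>m n \<boxplus> L) ((1\<^sub>m n \<boxplus> R) * fiedler_block n (n + k * n) (Ac (Suc k)))"

lemma fiedler_factors_dim:
  assumes "fiedler_factors n Ac k L R" "\<And>i. i \<le> k \<Longrightarrow> Ac i \<in> carrier_mat n n"
  shows "dim_row L = n + k * n \<and> dim_col L = n + k * n \<and> dim_row R = n + k * n \<and> dim_col R = n + k * n"
  using assms by (induction rule: fiedler_factors.induct) auto

lemma fiedler_block_invertible:
  fixes a :: "'a :: comm_ring_1 mat"
  assumes nq: "n \<le> q" and [simp]: "dim_row a = n" "dim_col a = n"
  shows "invertible_over UNIV (n + q) (fiedler_block n q a)"
  apply (rule invertible_overI[of _ _ "four_block_mat (0\<^sub>m n n) (head_proj n q) ((head_proj n q)\<^sup>T) ((head_proj n q)\<^sup>T * a * head_proj n q + tail_proj n q)"])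
  apply (simp_all add: fiedler_block_def four_block_mult mat_ring head_tail_mult[OF nq] head_tail_mult_assoc[OF nq] zero_mat_simps flip: four_block_one_mat)
  apply (rule cong_four_block_mat; (rule refl)?; rule eq_matI; simp del: index_mult_mat(1) add: algebra_simps)+
  done

lemma fiedler_factors_invertible:
  assumes "fiedler_factors n Ac k L R" "\<And>i. i \<le> k \<Longrightarrow> Ac i \<in> carrier_mat n n"
  shows "invertible_over UNIV (n + k * n) L \<and> invertible_over UNIV (n + k * n) R"
  using assms
proof (induction rule: fiedler_factors.induct)
  case base
  then show ?case by (auto intro!: invertible_overI[of _ _ "1\<^sub>m n"])
next
  case (left k L R)
  then show ?case
    by (auto intro!: univ.invertible_over_mult fiedler_block_invertible univ.invertible_over_dsum_one)
next
  case (right k L R)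
  then show ?case
    by (auto intro!: univ.invertible_over_mult fiedler_block_invertible univ.invertible_over_dsum_one)
qed

lemma fiedler_factors_hom:
  assumes "fiedler_factors n Ac k L R" "comm_ring_hom h" "\<And>i. i \<le> k \<Longrightarrow> Ac i \<in> carrier_mat n n"
    "\<And>i. 0 < i \<Longrightarrow> i \<le> k \<Longrightarrow> Ac' i = map_mat h (Ac i)"
  shows "fiedler_factors n Ac' k (map_mat h L) (map_mat h R)"
proof -
  interpret comm_ring_hom h by fact
  have one: "map_mat h (1\<^sub>m n) = 1\<^sub>m n" for n by (rule eq_matI) auto
  have blk: "map_mat h (fiedler_block n q a) = fiedler_block n q (map_mat h a)" if "a \<in> carrier_mat n n" for q a
    using that by (intro eq_matI) (auto simp: fiedler_block_def head_proj_def tail_proj_def hom_distribs)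
  have mult: "map_mat h (M * N) = map_mat h M * map_mat h N" if "dim_col M = dim_row N" for M N
    by (rule mat_hom_mult[of M "dim_row M" "dim_col M" N "dim_col N"]) (use that in auto)
  show ?thesis using assms(1,3,4)
  proof (induction rule: fiedler_factors.induct)
    case base
    then show ?case by (simp add: one fiedler_factors.base)
  next
    case (left k L R)
    from left.IH left.prems have "fiedler_factors n Ac' k (map_mat h L) (map_mat h R)" by simp
    moreover have "dim_row (Ac (Suc k)) = n" "dim_col (Ac (Suc k)) = n" using left.prems by auto
    ultimately show ?case using fiedler_factors.left[of n Ac' k "map_mat h L" "map_mat h R"] left.prems fiedler_factors_dim[OF left.hyps]
      by (simp add: mult blk dsum_map one)
  next
    case (right k L R)
    from right.IH right.prems have "fiedler_factors n Ac' k (map_mat h L) (map_mat h R)" by simp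
    moreover have "dim_row (Ac (Suc k)) = n" "dim_col (Ac (Suc k)) = n" using right.prems by auto
    ultimately show ?case using fiedler_factors.right[of n Ac' k "map_mat h L" "map_mat h R"] right.prems fiedler_factors_dim[OF right.hyps]
      by (simp add: mult blk dsum_map one)
  qed
qed

text \<open>
  The value at \<open>s\<close> of the matrix polynomial with leading coefficient \<open>X\<close> and lower coefficients
  \<open>Ac k, \<dots>, Ac 0\<close>; passing from \<open>k + 1\<close> to \<open>k\<close> is one step of the Horner scheme.
\<close>

definition poly_value :: "nat \<Rightarrow> 'a :: comm_ring_1 \<Rightarrow> (nat \<Rightarrow> 'a mat) \<Rightarrow> nat \<Rightarrow> 'a mat \<Rightarrow> 'a mat" where
  "poly_value n s Ac k X = mat n n (\<lambda>ij. s ^ Suc k * X $$ ij + (\<Sum>l\<le>k. s ^ l * Ac l $$ ij))"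

text \<open>
  The reversed polynomial in \<open>\<mu>\<close>, with \<open>j\<close> the exponent already accumulated when coefficient
  \<open>k\<close> is absorbed.
\<close>

definition rev_value :: "nat \<Rightarrow> 'a :: comm_ring_1 \<Rightarrow> (nat \<Rightarrow> 'a mat) \<Rightarrow> nat \<Rightarrow> nat \<Rightarrow> 'a mat \<Rightarrow> 'a mat" where
  "rev_value n \<mu> Ac k j X = mat n n (\<lambda>ij. X $$ ij + (\<Sum>l\<le>k. \<mu> ^ (j + Suc k - l) * Ac l $$ ij))"

lemma poly_value_Suc:
  assumes "X \<in> carrier_mat n n" "Ac (Suc k) \<in> carrier_mat n n"
  shows "poly_value n s Ac (Suc k) X = poly_value n s Ac k (s \<cdot>\<^sub>m X + Ac (Suc k))"
  using assms by (intro eq_matI) (auto simp: poly_value_def algebra_simps)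

lemma rev_value_Suc:
  assumes "X \<in> carrier_mat n n" "Ac (Suc k) \<in> carrier_mat n n"
  shows "rev_value n \<mu> Ac (Suc k) j X = rev_value n \<mu> Ac k (Suc j) (X + \<mu> ^ Suc j \<cdot>\<^sub>m Ac (Suc k))"
  using assms by (intro eq_matI) (auto simp: rev_value_def algebra_simps)

abbreviation last_block :: "nat \<Rightarrow> nat \<Rightarrow> 'a :: comm_ring_1 mat" where
  "last_block n k \<equiv> top_zero (k * n) (1\<^sub>m n)"

lemma top_zero_last_block: "top_zero n (last_block n k) = last_block n (Suc k)"
  by (simp add: top_zero_top_zero)

text \<open>
  A Fiedler pencil reduces to \<open>diag(I, P)\<close>, where \<open>P\<close> is the matrix polynomial with the given
  coefficients: every step of the recursion removes one coefficient and performs one Horner step.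
\<close>

theorem fiedler_pencil_system_equiv:
  assumes "fiedler_factors n Ac k L R" "\<And>i. i \<le> k \<Longrightarrow> Ac i \<in> carrier_mat n n" "X \<in> carrier_mat n n"
  shows "system_equiv (n + k * n) (s \<cdot>\<^sub>m (X \<boxplus> 1\<^sub>m (k * n)) - L * (1\<^sub>m (k * n) \<boxplus> - Ac 0) * R)
    (L * last_block n k) ((last_block n k)\<^sup>T * R)
    (1\<^sub>m (k * n) \<boxplus> poly_value n s Ac k X) (last_block n k) ((last_block n k)\<^sup>T)"
  using assms
proof (induction arbitrary: X rule: fiedler_factors.induct)
  case base
  from base have [simp]: "dim_row X = n" "dim_col X = n" "dim_row (Ac 0) = n" "dim_col (Ac 0) = n" by auto
  have "s \<cdot>\<^sub>m X - - Ac 0 = poly_value n s Ac 0 X"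
    by (intro eq_matI) (auto simp: poly_value_def)
  then show ?case
    by (auto simp: system_equiv_def intro!: exI[of _ "1\<^sub>m n"] invertible_overI[of "1\<^sub>m n" _ "1\<^sub>m n"] simp: poly_value_def)
next
  case (left k L R)
  let ?A = "Ac (Suc k)"
  have d: "dim_row X = n" "dim_col X = n" "dim_row ?A = n" "dim_col ?A = n" "dim_row (Ac 0) = n" "dim_col (Ac 0) = n"
    using left.prems by auto
  have LR: "dim_row L = n + k * n" "dim_col L = n + k * n" "dim_row R = n + k * n" "dim_col R = n + k * n"
    using fiedler_factors_dim[OF left.hyps] left.prems by auto
  have "system_equiv (n + k * n) (s \<cdot>\<^sub>m ((s \<cdot>\<^sub>m X + ?A) \<boxplus> 1\<^sub>m (k * n)) - L * (1\<^sub>m (k * n) \<boxplus> - Ac 0) * R)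
    (L * last_block n k) ((last_block n k)\<^sup>T * R)
    (1\<^sub>m (k * n) \<boxplus> poly_value n s Ac k (s \<cdot>\<^sub>m X + ?A)) (last_block n k) ((last_block n k)\<^sup>T)"
    using left.prems by (intro left.IH) auto
  from pencil_step_left[OF d(1-4) LR _ _ _ this] d show ?case
    using left.prems by (simp add: poly_value_Suc top_zero_last_block dsum_one_one add_ac)
next
  case (right k L R)
  let ?A = "Ac (Suc k)"
  have d: "dim_row X = n" "dim_col X = n" "dim_row ?A = n" "dim_col ?A = n" "dim_row (Ac 0) = n" "dim_col (Ac 0) = n"
    using right.prems by auto
  have LR: "dim_row L = n + k * n" "dim_col L = n + k * n" "dim_row R = n + k * n" "dim_col R = n + k * n"
    using fiedler_factors_dim[OF right.hyps] right.prems by auto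
  have "system_equiv (n + k * n) (s \<cdot>\<^sub>m ((s \<cdot>\<^sub>m X + ?A) \<boxplus> 1\<^sub>m (k * n)) - L * (1\<^sub>m (k * n) \<boxplus> - Ac 0) * R)
    (L * last_block n k) ((last_block n k)\<^sup>T * R)
    (1\<^sub>m (k * n) \<boxplus> poly_value n s Ac k (s \<cdot>\<^sub>m X + ?A)) (last_block n k) ((last_block n k)\<^sup>T)"
    using right.prems by (intro right.IH) auto
  from pencil_step_right[OF d(1-4) LR _ _ _ this] d show ?case
    using right.prems by (simp add: poly_value_Suc top_zero_last_block dsum_one_one add_ac)
qed

lemma (in coefficient_ring) fiedler_factors_entries:
  assumes "fiedler_factors n Ac k L R" "\<And>i. i \<le> k \<Longrightarrow> Ac i \<in> carrier_mat n n" "\<And>i. i \<le> k \<Longrightarrow> entries_in S (Ac i)"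
  shows "entries_in S L \<and> entries_in S R"
  using assms
proof (induction rule: fiedler_factors.induct)
  case (left k L R)
  note D = fiedler_factors_dim[OF left.hyps]
  from left D show ?case
    by (intro conjI entries_mult entries_dsum entries_basic entries_fiedler_block coefficient_ring_axioms) (auto)
next
  case (right k L R)
  note D = fiedler_factors_dim[OF right.hyps]
  from right D show ?case
    by (intro conjI entries_mult entries_dsum entries_basic entries_fiedler_block coefficient_ring_axioms) (auto)
qed (auto intro: entries_basic)

text \<open>
  The same recursion at infinity, ending in the reversed polynomial.  The exponents \<open>a\<close> and \<open>b\<close>
  only serve the induction: a factor on the left adds to the power on the right and conversely, so
  that their sum alone enters the result.  The theorem is used with \<open>a = b = 0\<close>.
\<close>

theorem (in coefficient_ring) fiedler_pencil_reversal_equiv: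
  assumes "fiedler_factors n Ac k L R" "\<And>i. i \<le> k \<Longrightarrow> Ac i \<in> carrier_mat n n" "X \<in> carrier_mat n n"
    "\<And>i. i \<le> k \<Longrightarrow> entries_in S (Ac i)" "\<mu> \<in> S"
  shows "equiv_over S (n + k * n) ((X \<boxplus> 1\<^sub>m (k * n)) -
     \<mu> \<cdot>\<^sub>m (((\<mu> ^ a \<cdot>\<^sub>m 1\<^sub>m n) \<boxplus> 1\<^sub>m (k * n)) * (L * (1\<^sub>m (k * n) \<boxplus> - Ac 0) * R) * ((\<mu> ^ b \<cdot>\<^sub>m 1\<^sub>m n) \<boxplus> 1\<^sub>m (k * n))))
    (1\<^sub>m (k * n) \<boxplus> rev_value n \<mu> Ac k (a + b) X)"
  using assms
proof (induction arbitrary: X a b rule: fiedler_factors.induct)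
  case base
  from base have [simp]: "dim_row X = n" "dim_col X = n" "dim_row (Ac 0) = n" "dim_col (Ac 0) = n" by auto
  have "X - \<mu> \<cdot>\<^sub>m (\<mu> ^ a \<cdot>\<^sub>m 1\<^sub>m n * - Ac 0 * (\<mu> ^ b \<cdot>\<^sub>m 1\<^sub>m n)) = rev_value n \<mu> Ac 0 (a + b) X"
    by (intro eq_matI) (auto simp: rev_value_def mat_ring power_add simp del: index_mult_mat(1))
  then show ?case
    by (auto simp: equiv_over_def intro!: exI[of _ "1\<^sub>m n"] invertible_overI[of "1\<^sub>m n" _ "1\<^sub>m n"] entries_basic simp: rev_value_def)
next
  case (left k L R)
  let ?A = "Ac (Suc k)"
  have d: "dim_row X = n" "dim_col X = n" "dim_row ?A = n" "dim_col ?A = n" "dim_row (Ac 0) = n" "dim_col (Ac 0) = n"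
    using left.prems by auto
  have LR: "dim_row L = n + k * n" "dim_col L = n + k * n" "dim_row R = n + k * n" "dim_col R = n + k * n"
    using fiedler_factors_dim[OF left.hyps] left.prems by auto
  let ?N = "L * (1\<^sub>m (k * n) \<boxplus> - Ac 0) * R"
  have "equiv_over S (n + k * n) (((X + (\<mu> * \<mu> ^ a * \<mu> ^ b) \<cdot>\<^sub>m ?A) \<boxplus> 1\<^sub>m (k * n)) -
     \<mu> \<cdot>\<^sub>m (((\<mu> ^ a \<cdot>\<^sub>m 1\<^sub>m n) \<boxplus> 1\<^sub>m (k * n)) * ?N * (((\<mu> * \<mu> ^ b) \<cdot>\<^sub>m 1\<^sub>m n) \<boxplus> 1\<^sub>m (k * n))))
    (1\<^sub>m (k * n) \<boxplus> rev_value n \<mu> Ac k (a + Suc b) (X + (\<mu> * \<mu> ^ a * \<mu> ^ b) \<cdot>\<^sub>m ?A))"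
    using left.prems left.IH[of "X + (\<mu> * \<mu> ^ a * \<mu> ^ b) \<cdot>\<^sub>m ?A" a "Suc b"] by auto
  moreover have "entries_in S ?N"
    using fiedler_factors_entries[OF left.hyps] left.prems LR d
    by (intro entries_mult entries_dsum entries_basic entries_uminus) auto
  ultimately have "equiv_over S (n + (n + k * n)) ((X \<boxplus> 1\<^sub>m (n + k * n)) 
      - \<mu> \<cdot>\<^sub>m (((\<mu> ^ a \<cdot>\<^sub>m 1\<^sub>m n) \<boxplus> 1\<^sub>m (n + k * n)) * (fiedler_block n (n + k * n) ?A * (1\<^sub>m n \<boxplus> ?N)) * ((\<mu> ^ b \<cdot>\<^sub>m 1\<^sub>m n) \<boxplus> 1\<^sub>m (n + k * n))))
      (1\<^sub>m n \<boxplus> (1\<^sub>m (k * n) \<boxplus> rev_value n \<mu> Ac k (a + Suc b) (X + (\<mu> * \<mu> ^ a * \<mu> ^ b) \<cdot>\<^sub>m ?A)))"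
    using d LR left.prems by (intro reversal_step_left) (auto intro: power_in)
  moreover have "fiedler_block n (n + k * n) ?A * (1\<^sub>m n \<boxplus> ?N) =
    fiedler_block n (n + k * n) ?A * (1\<^sub>m n \<boxplus> L) * (1\<^sub>m (Suc k * n) \<boxplus> - Ac 0) * (1\<^sub>m n \<boxplus> R)"
    using d LR by (simp add: mat_mult_assoc dsum_mult flip: dsum_one_one)
  ultimately show ?case
    using left.prems by (simp add: rev_value_Suc dsum_one_one power_add add_ac mult.assoc)
next
  case (right k L R)
  let ?A = "Ac (Suc k)"
  have d: "dim_row X = n" "dim_col X = n" "dim_row ?A = n" "dim_col ?A = n" "dim_row (Ac 0) = n" "dim_col (Ac 0) = n"
    using right.prems by auto
  have LR: "dim_row L = n + k * n" "dim_col L = n + k * n" "dim_row R = n + k * n" "dim_col R = n + k * n"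
    using fiedler_factors_dim[OF right.hyps] right.prems by auto
  let ?N = "L * (1\<^sub>m (k * n) \<boxplus> - Ac 0) * R"
  have "equiv_over S (n + k * n) (((X + (\<mu> * \<mu> ^ a * \<mu> ^ b) \<cdot>\<^sub>m ?A) \<boxplus> 1\<^sub>m (k * n)) -
     \<mu> \<cdot>\<^sub>m ((((\<mu> * \<mu> ^ a) \<cdot>\<^sub>m 1\<^sub>m n) \<boxplus> 1\<^sub>m (k * n)) * ?N * ((\<mu> ^ b \<cdot>\<^sub>m 1\<^sub>m n) \<boxplus> 1\<^sub>m (k * n))))
    (1\<^sub>m (k * n) \<boxplus> rev_value n \<mu> Ac k (Suc a + b) (X + (\<mu> * \<mu> ^ a * \<mu> ^ b) \<cdot>\<^sub>m ?A))"
    using right.prems right.IH[of "X + (\<mu> * \<mu> ^ a * \<mu> ^ b) \<cdot>\<^sub>m ?A" "Suc a" b] by auto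
  moreover have "entries_in S ?N"
    using fiedler_factors_entries[OF right.hyps] right.prems LR d
    by (intro entries_mult entries_dsum entries_basic entries_uminus) auto
  ultimately have "equiv_over S (n + (n + k * n)) ((X \<boxplus> 1\<^sub>m (n + k * n)) 
      - \<mu> \<cdot>\<^sub>m (((\<mu> ^ a \<cdot>\<^sub>m 1\<^sub>m n) \<boxplus> 1\<^sub>m (n + k * n)) * ((1\<^sub>m n \<boxplus> ?N) * fiedler_block n (n + k * n) ?A) * ((\<mu> ^ b \<cdot>\<^sub>m 1\<^sub>m n) \<boxplus> 1\<^sub>m (n + k * n))))
      (1\<^sub>m n \<boxplus> (1\<^sub>m (k * n) \<boxplus> rev_value n \<mu> Ac k (Suc a + b) (X + (\<mu> * \<mu> ^ a * \<mu> ^ b) \<cdot>\<^sub>m ?A)))"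
    using d LR right.prems by (intro reversal_step_right) (auto intro: power_in)
  moreover have "(1\<^sub>m n \<boxplus> ?N) * fiedler_block n (n + k * n) ?A =
    (1\<^sub>m n \<boxplus> L) * (1\<^sub>m (Suc k * n) \<boxplus> - Ac 0) * ((1\<^sub>m n \<boxplus> R) * fiedler_block n (n + k * n) ?A)"
    using d LR by (simp add: dsum_mult flip: dsum_one_one mat_mult_assoc)
  ultimately show ?case
    using right.prems by (simp add: rev_value_Suc dsum_one_one power_add add_ac mult.assoc)
qed

section \<open>Rational functions at infinity\<close>

text \<open>
  Although \<open>rat_eval\<close> is defined by the reduced fraction, it agrees near infinity with the quotient of
  any representation, since polynomials have finitely many roots.  Limits at infinity are therefore
  compatible with the field operations.
\<close>

definition limit_at_inf :: "complex poly fract \<Rightarrow> complex \<Rightarrow> bool" where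
  "limit_at_inf f l \<longleftrightarrow> (rat_eval f \<longlongrightarrow> l) at_infinity"

definition proper :: "complex poly fract set" where
  "proper = {f. \<exists>l. limit_at_inf f l}"

abbreviation frac_const :: "complex \<Rightarrow> complex poly fract" where
  "frac_const c \<equiv> to_fract [:c:]"

lemma eventually_poly_nonzero:
  assumes "p \<noteq> (0 :: complex poly)"
  shows "\<forall>\<^sub>F z in at_infinity. poly p z \<noteq> 0"
proof -
  have "\<forall>\<^sub>F z in at_infinity. \<forall>r\<in>{r. poly p r = 0}. z \<noteq> r"
    using poly_roots_finite[OF assms] by (intro eventually_ball_finite) (auto intro: eventually_not_equal_at_infinity)
  then show ?thesis by eventually_elim auto
qed

lemma rat_eval_Fract:
  assumes "b \<noteq> 0"
  shows "\<forall>\<^sub>F z in at_infinity. rat_eval (Fract a b) z = poly a z / poly b z"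
proof -
  define p d where "p = fst (quot_of_fract (Fract a b))" and "d = snd (quot_of_fract (Fract a b))"
  have d: "d \<noteq> 0" by (simp add: d_def)
  have "Fract p d = Fract a b" by (simp add: p_def d_def)
  with assms d have "p * b = a * d" by (simp add: eq_fract)
  then have *: "poly p z * poly b z = poly a z * poly d z" for z by (metis poly_mult)
  show ?thesis
    using eventually_poly_nonzero[OF assms] eventually_poly_nonzero[OF d]
    by eventually_elim (use * in \<open>simp add: rat_eval_def field_simps flip: p_def d_def\<close>)
qed

lemma fract_cases_nonzero:
  obtains a b where "x = Fract a b" "b \<noteq> (0 :: complex poly)"
  by (metis Fract_quot_of_fract snd_quot_of_fract_nonzero)

lemma limit_at_inf_Fract:
  "b \<noteq> 0 \<Longrightarrow> limit_at_inf (Fract a b) l \<longleftrightarrow> ((\<lambda>z. poly a z / poly b z) \<longlongrightarrow> l) at_infinity"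
  unfolding limit_at_inf_def by (rule tendsto_cong[OF rat_eval_Fract])

lemma limit_at_inf_const: "limit_at_inf (frac_const c) c"
  by (simp add: to_fract_def limit_at_inf_Fract)

lemma limit_at_inf_add:
  assumes "limit_at_inf x k" "limit_at_inf y l"
  shows "limit_at_inf (x + y) (k + l)"
proof -
  obtain a b where x: "x = Fract a b" "b \<noteq> 0" by (rule fract_cases_nonzero)
  obtain c d where y: "y = Fract c d" "d \<noteq> 0" by (rule fract_cases_nonzero)
  have "((\<lambda>z. poly a z / poly b z + poly c z / poly d z) \<longlongrightarrow> k + l) at_infinity"
    using assms x y by (intro tendsto_add) (simp_all add: limit_at_inf_Fract)
  moreover have "\<forall>\<^sub>F z in at_infinity. poly a z / poly b z + poly c z / poly d z = poly (a * d + c * b) z / poly (b * d) z"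
    using eventually_poly_nonzero[OF x(2)] eventually_poly_nonzero[OF y(2)]
    by eventually_elim (simp add: add_frac_eq)
  ultimately have "((\<lambda>z. poly (a * d + c * b) z / poly (b * d) z) \<longlongrightarrow> k + l) at_infinity"
    by (rule Lim_transform_eventually)
  then show ?thesis using x y by (simp add: limit_at_inf_Fract add_fract)
qed

lemma limit_at_inf_mult:
  assumes "limit_at_inf x k" "limit_at_inf y l"
  shows "limit_at_inf (x * y) (k * l)"
proof -
  obtain a b where x: "x = Fract a b" "b \<noteq> 0" by (rule fract_cases_nonzero)
  obtain c d where y: "y = Fract c d" "d \<noteq> 0" by (rule fract_cases_nonzero)
  have "((\<lambda>z. poly a z / poly b z * (poly c z / poly d z)) \<longlongrightarrow> k * l) at_infinity"
    using assms x y by (intro tendsto_mult) (simp_all add: limit_at_inf_Fract)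
  then show ?thesis using x y by (simp add: limit_at_inf_Fract)
qed

lemma limit_at_inf_uminus: "limit_at_inf x k \<Longrightarrow> limit_at_inf (- x) (- k)"
proof -
  assume "limit_at_inf x k"
  from limit_at_inf_mult[OF limit_at_inf_const[of "- 1"] this] have "limit_at_inf (frac_const (- 1) * x) (- k)"
    by simp
  moreover have "frac_const (- 1) = - 1"
    by (metis minus_pCons minus_zero one_pCons to_fract_1 to_fract_uminus)
  ultimately show ?thesis by simp
qed

lemma limit_at_inf_unique: "limit_at_inf x k \<Longrightarrow> limit_at_inf x l \<Longrightarrow> k = l"
proof -
  have "at_infinity \<noteq> (bot :: complex filter)"
  proof
    assume "at_infinity = (bot :: complex filter)"
    then have "eventually (\<lambda>z :: complex. False) at_infinity" by simp
    then obtain b where "\<forall>z :: complex. \<not> b \<le> norm z" by (auto simp: eventually_at_infinity)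
    from this[rule_format, of "of_real b"] show False by simp
  qed
  moreover assume "limit_at_inf x k" "limit_at_inf x l"
  ultimately show ?thesis unfolding limit_at_inf_def by (rule tendsto_unique)
qed

lemma limit_at_inf_0_1: "limit_at_inf 0 0" "limit_at_inf 1 1"
  using limit_at_inf_const[of 0] limit_at_inf_const[of 1] by (simp_all flip: one_pCons)

lemma limit_at_inf_inverse:
  assumes "limit_at_inf x k" "k \<noteq> 0"
  shows "limit_at_inf (inverse x) (inverse k)"
proof -
  obtain a b where x: "x = Fract a b" "b \<noteq> 0" by (rule fract_cases_nonzero)
  have a: "a \<noteq> 0" using assms x limit_at_inf_unique[OF limit_at_inf_0_1(1)] by (auto simp: fract_collapse)
  have "((\<lambda>z. inverse (poly a z / poly b z)) \<longlongrightarrow> inverse k) at_infinity"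
    using assms x by (intro tendsto_inverse) (simp_all add: limit_at_inf_Fract)
  then show ?thesis using x a by (simp add: limit_at_inf_Fract)
qed

lemma limit_at_inf_inverse_lam: "limit_at_inf (inverse (to_fract lam)) 0"
  by (simp add: to_fract_def limit_at_inf_Fract) (intro tendsto_inverse_0 tendsto_eq_rhs[OF tendsto_divide_0[OF tendsto_const]] filterlim_ident, auto)

interpretation proper: coefficient_ring proper
proof
  fix x y assume "x \<in> proper" "y \<in> proper"
  then show "x + y \<in> proper" "x * y \<in> proper" "- x \<in> proper"
    by (auto simp: proper_def intro: limit_at_inf_add limit_at_inf_mult limit_at_inf_uminus)
qed (auto simp: proper_def intro: limit_at_inf_0_1)

lemma limit_at_inf_sum: "(\<And>i. i \<in> I \<Longrightarrow> limit_at_inf (f i) (g i)) \<Longrightarrow> limit_at_inf (sum f I) (sum g I)"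
  by (induction I rule: infinite_finite_induct) (auto intro: limit_at_inf_0_1 limit_at_inf_add)

lemma limit_at_inf_prod: "(\<And>i. i \<in> I \<Longrightarrow> limit_at_inf (f i) (g i)) \<Longrightarrow> limit_at_inf (prod f I) (prod g I)"
  by (induction I rule: infinite_finite_induct) (auto intro: limit_at_inf_0_1 limit_at_inf_mult)

definition mat_limit :: "complex poly fract mat \<Rightarrow> complex mat \<Rightarrow> bool" where
  "mat_limit F L \<longleftrightarrow> dim_row F = dim_row L \<and> dim_col F = dim_col L \<and>
    (\<forall>i<dim_row L. \<forall>j<dim_col L. limit_at_inf (F $$ (i, j)) (L $$ (i, j)))"

lemma mat_limit_mult: "mat_limit F L \<Longrightarrow> mat_limit G M \<Longrightarrow> dim_col L = dim_row M \<Longrightarrow> mat_limit (F * G) (L * M)"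
  by (auto simp: mat_limit_def scalar_prod_def intro!: limit_at_inf_sum limit_at_inf_mult)

lemma mat_limit_unique: "mat_limit F L \<Longrightarrow> mat_limit F M \<Longrightarrow> L = M"
  by (intro eq_matI) (auto simp: mat_limit_def, metis limit_at_inf_unique)

lemma mat_limit_one: "mat_limit (1\<^sub>m n) (1\<^sub>m n)"
  by (auto simp: mat_limit_def intro: limit_at_inf_0_1)

lemma entries_proper_limit:
  assumes "entries_in proper F"
  obtains L where "mat_limit F L" "dim_row L = dim_row F" "dim_col L = dim_col F"
proof -
  from assms have "\<forall>i<dim_row F. \<forall>j<dim_col F. \<exists>l. limit_at_inf (F $$ (i, j)) l"
    by (auto simp: entries_in_def proper_def)
  then obtain l where "\<forall>i<dim_row F. \<forall>j<dim_col F. limit_at_inf (F $$ (i, j)) (l i j)" by metis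
  then have "mat_limit F (mat (dim_row F) (dim_col F) (\<lambda>(i, j). l i j))" by (auto simp: mat_limit_def)
  then show thesis by (rule that) auto
qed

text \<open>
  The limits of a matrix and of its inverse multiply to the identity, so the limit is nonsingular.
\<close>

lemma invertible_over_proper_imp_biproper:
  assumes "invertible_over proper N F"
  shows "biproper N F"
proof -
  from assms obtain G where FG: "F \<in> carrier_mat N N" "G \<in> carrier_mat N N" "entries_in proper F" "entries_in proper G" "F * G = 1\<^sub>m N"
    unfolding invertible_over_def by blast
  obtain L where L: "mat_limit F L" "dim_row L = N" "dim_col L = N" using entries_proper_limit[OF FG(3)] FG by auto
  obtain M where M: "mat_limit G M" "dim_row M = N" "dim_col M = N" using entries_proper_limit[OF FG(4)] FG by auto
  have "L * M = 1\<^sub>m N"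
    using mat_limit_unique[OF mat_limit_mult[OF L(1) M(1)]] mat_limit_one[of N] L M FG by auto
  moreover have "L \<in> carrier_mat N N" "M \<in> carrier_mat N N" using L M by auto
  ultimately have "det L * det M = 1" using det_mult[of L N M] by simp
  then have "det L \<noteq> 0" by auto
  with L FG show ?thesis unfolding biproper_def
    by (intro conjI bexI[of _ L]) (auto simp: mat_limit_def limit_at_inf_def intro!: carrier_matI)
qed

lemma invertible_over_imp_unimodular:
  assumes "invertible_over UNIV N U"
  shows "unimodular N U"
proof -
  from assms obtain V where UV: "U \<in> carrier_mat N N" "V \<in> carrier_mat N N" "U * V = 1\<^sub>m N"
    unfolding invertible_over_def by blast
  then have "det U * det V = 1" by (simp flip: det_mult[of _ N])
  then have "det U dvd 1" by (metis dvd_triv_left)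
  then obtain c where "det U = [:c:]" "c dvd 1" by (auto simp: is_unit_poly_iff)
  then have "det U = [:c:]" "c \<noteq> 0" by auto
  with UV show ?thesis unfolding unimodular_def by auto
qed

lemma comm_ring_hom_const: "comm_ring_hom (\<lambda>c::complex. [:c:])"
  by unfold_locales (auto simp: one_pCons)

lemma comm_ring_hom_frac_const: "comm_ring_hom frac_const"
proof
  fix x y :: complex
  show "frac_const (x + y) = frac_const x + frac_const y" using to_fract_add[of "[:x:]" "[:y:]"] by simp
  show "frac_const (x * y) = frac_const x * frac_const y" using to_fract_mult[of "[:x:]" "[:y:]"] by (simp add: mult.commute)
qed (simp_all flip: one_pCons)

lemma invertible_over_const_hom:
  assumes "invertible_over UNIV N (U :: complex mat)"
  shows "invertible_over UNIV N (const_mat U)" "invertible_over proper N (map_mat frac_const U)"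
proof -
  from assms obtain V where UV: "U \<in> carrier_mat N N" "V \<in> carrier_mat N N" "U * V = 1\<^sub>m N" "V * U = 1\<^sub>m N"
    unfolding invertible_over_def by blast
  interpret c: comm_ring_hom "\<lambda>c::complex. [:c:]" by (rule comm_ring_hom_const)
  interpret f: comm_ring_hom frac_const by (rule comm_ring_hom_frac_const)
  have "const_mat U * const_mat V = 1\<^sub>m N" "const_mat V * const_mat U = 1\<^sub>m N"
    using UV c.mat_hom_mult[of U N N V N] c.mat_hom_mult[of V N N U N] by (simp_all add: c.mat_hom_one)
  then show "invertible_over UNIV N (const_mat U)"
    using UV by (intro invertible_overI[of _ _ "const_mat V"]) auto
  have "map_mat frac_const U * map_mat frac_const V = 1\<^sub>m N" "map_mat frac_const V * map_mat frac_const U = 1\<^sub>m N"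
    using UV f.mat_hom_mult[of U N N V N] f.mat_hom_mult[of V N N U N] by (simp_all add: f.mat_hom_one)
  then show "invertible_over proper N (map_mat frac_const U)"
    using UV by (intro invertible_overI[of _ _ "map_mat frac_const V"])
      (auto simp: entries_in_def proper_def intro: limit_at_inf_const)
qed

lemma inv_mat_unique:
  fixes M :: "'a :: field mat"
  assumes "M \<in> carrier_mat n n" "X \<in> carrier_mat n n" "M * X = 1\<^sub>m n"
  shows "inv_mat M = X"
proof -
  have XM: "X * M = 1\<^sub>m n" using mat_mult_left_right_inverse[OF assms] .
  have "M \<in> Units (ring_mat TYPE('a) n ())"
    unfolding Units_def using assms XM by (auto simp: ring_mat_simps intro!: bexI[of _ X])
  then obtain Y where Y: "mat_inverse M = Some Y"
    using mat_inverse(1)[OF assms(1), of "()"] by (cases "mat_inverse M") auto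
  then have "M * Y = 1\<^sub>m n" "Y * M = 1\<^sub>m n" "Y \<in> carrier_mat n n" using mat_inverse(2)[OF assms(1)] by auto
  then have "Y = Y * (M * X)" using assms(3) by simp
  also have "\<dots> = (Y * M) * X" by (rule assoc_mult_mat[symmetric]) (use assms \<open>Y \<in> _\<close> in auto)
  finally have "Y = X" using \<open>Y * M = _\<close> assms by simp
  then show ?thesis using Y by (simp add: inv_mat_def)
qed

lemma (in coefficient_ring) det_in:
  assumes "M \<in> carrier_mat n n" "entries_in S M"
  shows "det M \<in> S"
proof -
  have "of_int (sign p) \<in> S" for p :: "nat \<Rightarrow> nat"
    by (auto simp: sign_def intro: one_in uminus_in)
  then show ?thesis unfolding det_def'[OF assms(1)] using assms
    by (intro sum_in mult_in prod_in) (auto simp: entries_in_def dest: permutes_in_image)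
qed

lemma mat_limit_det:
  assumes "mat_limit F L" "L \<in> carrier_mat n n"
  shows "limit_at_inf (det F) (det L)"
proof -
  have F: "F \<in> carrier_mat n n" using assms by (auto simp: mat_limit_def)
  have "limit_at_inf (of_int (sign p)) (of_int (sign p))" for p :: "nat \<Rightarrow> nat"
    by (auto simp: sign_def intro: limit_at_inf_0_1 limit_at_inf_uminus)
  then show ?thesis unfolding det_def'[OF F] det_def'[OF assms(2)]
    using assms by (intro limit_at_inf_sum limit_at_inf_mult limit_at_inf_prod)
     (auto simp: mat_limit_def dest: permutes_in_image)
qed

text \<open>
  Conversely, by Cramer's rule: the determinant has the nonzero limit \<open>det L\<close>, hence a reciprocal
  with a limit, and the cofactors are polynomials in the entries.
\<close>

lemma mat_limit_invertible:
  assumes "mat_limit F L" "L \<in> carrier_mat n n" "det L \<noteq> 0"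
  shows "invertible_over proper n F"
proof -
  have F: "F \<in> carrier_mat n n" using assms by (auto simp: mat_limit_def)
  have S: "entries_in proper F" using assms by (auto simp: mat_limit_def entries_in_def proper_def)
  have lim: "limit_at_inf (det F) (det L)" using mat_limit_det[OF assms(1,2)] .
  then have "det F \<noteq> 0" using limit_at_inf_unique[OF limit_at_inf_0_1(1)] assms(3) by auto
  have i: "inverse (det F) \<in> proper" using limit_at_inf_inverse[OF lim assms(3)] by (auto simp: proper_def)
  have "entries_in proper (adj_mat F)"
    unfolding entries_in_def adj_mat_def
  proof (intro allI impI)
    fix i j assume "i < dim_row (mat (dim_row F) (dim_col F) (\<lambda>(i, j). cofactor F j i))"
      "j < dim_col (mat (dim_row F) (dim_col F) (\<lambda>(i, j). cofactor F j i))"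
    then have ij: "i < n" "j < n" using F by auto
    have "entries_in proper (mat_delete F j i)"
      using S F ij by (auto simp: entries_in_def mat_delete_def)
    then have "det (mat_delete F j i) \<in> proper"
      using F mat_delete_carrier[OF F] by (intro proper.det_in)
    then show "mat (dim_row F) (dim_col F) (\<lambda>(i, j). cofactor F j i) $$ (i, j) \<in> proper"
      using ij F by (auto simp: cofactor_def intro!: proper.mult_in proper.power_in proper.uminus_in proper.one_in)
  qed
  then have "entries_in proper (inverse (det F) \<cdot>\<^sub>m adj_mat F)" using i by (intro proper.entries_smult)
  moreover have "F * (inverse (det F) \<cdot>\<^sub>m adj_mat F) = 1\<^sub>m n" "(inverse (det F) \<cdot>\<^sub>m adj_mat F) * F = 1\<^sub>m n"
    using adj_mat[OF F] F \<open>det F \<noteq> 0\<close> by (auto simp: mat_smult_mult intro!: eq_matI)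
  ultimately show ?thesis using S F adj_mat(1)[OF F] unfolding invertible_over_def by auto
qed

section \<open>Rank, controllability and observability\<close>

lemma full_column_rank:
  fixes M :: "'a :: field mat"
  assumes M: "M \<in> carrier_mat k r" and ker: "\<And>v. v \<in> carrier_vec r \<Longrightarrow> M *\<^sub>v v = 0\<^sub>v k \<Longrightarrow> v = 0\<^sub>v r"
  shows "vec_space.rank k M = r"
proof -
  interpret vec_space "TYPE('a)" k .
  have dist: "distinct (cols M)"
  proof (rule ccontr)
    assume "\<not> distinct (cols M)"
    then obtain i j where ij: "i < r" "j < r" "i \<noteq> j" "col M i = col M j"
      using M by (auto simp: distinct_conv_nth)
    let ?v = "unit_vec r i - unit_vec r j :: 'a vec"
    have "M *\<^sub>v ?v = M *\<^sub>v unit_vec r i - M *\<^sub>v unit_vec r j"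
      by (rule mult_minus_distrib_mat_vec[OF M]) auto
    also have "\<dots> = col M i - col M j" using ij(1,2) M by (intro eq_vecI) (auto simp: scalar_prod_right_unit)
    also have "\<dots> = 0\<^sub>v k" using ij M by auto
    finally have "?v = 0\<^sub>v r" by (intro ker) auto
    then have "?v $ i = 0" using ij by simp
    then show False using ij by simp
  qed
  moreover have "lin_indpt (set (cols M))"
    using lin_depE[OF M _ dist] ker by metis
  ultimately show ?thesis by (rule lin_indpt_full_rank[OF M])
qed

text \<open>
  If a maximal independent set \<open>S\<close> of columns had fewer than \<open>r\<close> elements, then the square matrix with
  the elements of \<open>S\<close> as rows, filled up with zero rows, would be singular, and a vector in its
  kernel would annihilate all columns.
\<close>

lemma full_row_rank:
  fixes M :: "'a :: field mat"
  assumes M: "M \<in> carrier_mat r k"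
    and ker: "\<And>w. w \<in> carrier_vec r \<Longrightarrow> (\<And>j. j < k \<Longrightarrow> w \<bullet> col M j = 0) \<Longrightarrow> w = 0\<^sub>v r"
  shows "vec_space.rank r M = r"
proof (rule ccontr)
  interpret vec_space "TYPE('a)" r .
  assume neq: "rank M \<noteq> r"
  let ?C = "set (cols M)"
  have C: "?C \<subseteq> carrier_vec r" using cols_dim M by blast
  obtain S where S: "finite S" "maximal S (\<lambda>T. T \<subseteq> ?C \<and> lin_indpt T)"
  proof -
    have "lin_indpt {}" by (auto simp: lin_dep_def)
    then show thesis
      using maximal_exists_superset[of ?C "\<lambda>T. T \<subseteq> ?C \<and> lin_indpt T" "{}"] that by auto
  qed
  have SC: "S \<subseteq> ?C" "lin_indpt S" using S(2) by (auto simp: maximal_def)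
  then have Scar: "S \<subseteq> carrier_vec r" using C by auto
  have rank: "rank M = card S" using rank_card_indpt[OF M S(2)] .
  have "card S \<le> r" using li_le_dim(2)[of S] Scar SC(2) dim_is_n by (simp add: fin_dim)
  with neq rank have less: "card S < r" by simp
  have span: "c \<in> span S" if "c \<in> ?C" for c
  proof (rule ccontr)
    assume c: "c \<notin> span S"
    have cS: "c \<notin> S" using c span_mem[OF Scar] by auto
    have "lin_indpt (insert c S)"
      using lin_dep_iff_in_span[of S c] c cS Scar SC(2) that C by auto
    then have "insert c S = S" using S(2) that SC unfolding maximal_def by blast
    with cS show False by auto
  qed
  obtain ss where ss: "set ss = S" "length ss = card S"
    using finite_distinct_list[OF S(1)] distinct_card by metis
  \<comment> \<open>Row card S of this matrix is zero.\<close>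
  let ?N = "mat r r (\<lambda>(i, j). if i < card S then ss ! i $ j else 0)"
  have "det (?N\<^sup>T) = 0"
    unfolding det_0_iff_vec_prod_zero_field[OF transpose_carrier_mat[THEN iffD2, OF mat_carrier]]
    by (rule exI[of _ "unit_vec r (card S)"]) (use less in \<open>auto intro!: eq_vecI simp: scalar_prod_right_unit\<close>)
  then have "det ?N = 0" by (simp add: det_transpose[of _ r])
  then obtain w where w: "w \<in> carrier_vec r" "w \<noteq> 0\<^sub>v r" "?N *\<^sub>v w = 0\<^sub>v r"
    using det_0_iff_vec_prod_zero_field[of ?N r] by auto
  have "w \<bullet> s = 0" if "s \<in> S" for s
  proof -
    have "s \<in> set ss" using that ss(1) by simp
    then obtain i where i: "i < card S" "s = ss ! i" unfolding in_set_conv_nth ss(2) by blast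
    have s: "s \<in> carrier_vec r" using that Scar by auto
    have "(?N *\<^sub>v w) $ i = row ?N i \<bullet> w" using i less by simp
    also have "row ?N i = s" using i less s by (intro eq_vecI) auto
    finally have "s \<bullet> w = 0" using w i less by simp
    then show ?thesis using comm_scalar_prod[OF s w(1)] by simp
  qed
  then have "w \<in> orthogonal_complement S" using w by (auto simp: orthogonal_complement_def)
  then have "w \<in> orthogonal_complement (span S)" using in_orthogonal_complement_span[OF Scar] by simp
  then have "w \<bullet> col M j = 0" if "j < k" for j
    using span[of "col M j"] that M by (auto simp: orthogonal_complement_def in_set_conv_nth cols_def)
  with ker[OF w(1)] w(2) show False by simp
qed

text \<open>
  The columns of \<open>Q\<close> form a basis of the hyperplane \<open>u x = 0\<close>: if \<open>u\<^sub>k \<noteq> 0\<close>, they are the vectors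
  \<open>e\<^sub>j - (u\<^sub>j / u\<^sub>k) e\<^sub>k\<close> for \<open>j \<noteq> k\<close>, and the coordinates of a matrix \<open>X\<close> with \<open>u X = 0\<close> in
  this basis are its rows other than row \<open>k\<close>.
\<close>

lemma row_kernel_basis:
  fixes u :: "'a :: field mat"
  assumes u: "u \<in> carrier_mat 1 r" "u \<noteq> 0\<^sub>m 1 r"
  obtains Q where "Q \<in> carrier_mat r (r - 1)" "u * Q = 0\<^sub>m 1 (r - 1)" "r \<ge> 1"
    "\<And>X. dim_row X = r \<Longrightarrow> u * X = 0\<^sub>m 1 (dim_col X) \<Longrightarrow> \<exists>Z \<in> carrier_mat (r - 1) (dim_col X). X = Q * Z"
proof -
  have "\<exists>k<r. u $$ (0, k) \<noteq> 0"
  proof (rule ccontr)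
    assume "\<not> ?thesis"
    then have "u = 0\<^sub>m 1 r" using u(1) by (intro eq_matI) auto
    with u(2) show False by simp
  qed
  then obtain k where k: "k < r" "u $$ (0, k) \<noteq> 0" by auto
  then obtain r' where r: "r = Suc r'" by (cases r) auto
  let ?i = "insert_index k"
  have ins: "?i l < r" if "l < r'" for l using that by (auto simp: insert_index_def r)
  have split: "sum f {0..<r} = f k + (\<Sum>l\<in>{0..<r'}. f (?i l))" for f :: "nat \<Rightarrow> 'a"
  proof -
    have "sum f {0..<r} = f k + sum f ({0..<r} - {k})" using k by (intro sum.remove) auto
    also have "{0..<r} - {k} = ?i ` {0..<r'}" using insert_index_image k r by auto
    finally show ?thesis by (simp add: sum.reindex[OF insert_index_inj_on])
  qed
  define Q where "Q = mat r r' (\<lambda>(i, j). if i = k then - u $$ (0, ?i j) / u $$ (0, k) else if i = ?i j then 1 else 0)"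
  have Q: "Q \<in> carrier_mat r r'" by (simp add: Q_def)
  have row_u: "(u * X) $$ (0, j) = u $$ (0, k) * X $$ (k, j) + (\<Sum>l\<in>{0..<r'}. u $$ (0, ?i l) * X $$ (?i l, j))"
    if "dim_row X = r" "j < dim_col X" for X j
    using that u k by (simp add: scalar_prod_def split ins)
  have "u * Q = 0\<^sub>m 1 r'"
  proof (rule eq_matI)
    fix i j assume "i < dim_row (0\<^sub>m 1 r')" "j < dim_col (0\<^sub>m 1 r')"
    then have ij: "i = 0" "j < r'" by auto
    have "(u * Q) $$ (0, j) = - u $$ (0, ?i j) + (\<Sum>l\<in>{0..<r'}. if ?i l = ?i j then u $$ (0, ?i l) else 0)"
      using ij k Q by (subst row_u) (auto simp: Q_def ins intro!: sum.cong)
    also have "(\<Sum>l\<in>{0..<r'}. if ?i l = ?i j then u $$ (0, ?i l) else 0) = (\<Sum>l\<in>{0..<r'}. if l = j then u $$ (0, ?i l) else 0)"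
      by (intro sum.cong) (auto dest: arg_cong[of _ _ "delete_index k"])
    finally show "(u * Q) $$ (i, j) = 0\<^sub>m 1 r' $$ (i, j)" using ij by simp
  qed (use u Q in auto)
  moreover have "\<exists>Z \<in> carrier_mat r' (dim_col X). X = Q * Z" if X: "dim_row X = r" "u * X = 0\<^sub>m 1 (dim_col X)" for X
  proof
    define Z where "Z = mat r' (dim_col X) (\<lambda>(i, j). X $$ (?i i, j))"
    show "Z \<in> carrier_mat r' (dim_col X)" by (simp add: Z_def)
    show "X = Q * Z"
    proof (rule eq_matI)
      fix i j assume "i < dim_row (Q * Z)" "j < dim_col (Q * Z)"
      then have ij: "i < r" "j < dim_col X" by (auto simp: Q_def Z_def)
      have QZ: "(Q * Z) $$ (i, j) = (\<Sum>l\<in>{0..<r'}. Q $$ (i, l) * X $$ (?i l, j))"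
        using ij by (simp add: Q_def Z_def scalar_prod_def)
      show "X $$ (i, j) = (Q * Z) $$ (i, j)"
      proof (cases "i = k")
        case True
        have "u $$ (0, k) * X $$ (k, j) + (\<Sum>l\<in>{0..<r'}. u $$ (0, ?i l) * X $$ (?i l, j)) = 0"
          using row_u[OF X(1) ij(2)] X ij by simp
        then have "u $$ (0, k) * X $$ (k, j) = - (\<Sum>l\<in>{0..<r'}. u $$ (0, ?i l) * X $$ (?i l, j))"
          by (simp only: add_eq_0_iff2)
        then have "X $$ (k, j) = - (\<Sum>l\<in>{0..<r'}. u $$ (0, ?i l) * X $$ (?i l, j)) / u $$ (0, k)"
          using k(2) by (metis nonzero_mult_div_cancel_left)
        also have "\<dots> = (\<Sum>l\<in>{0..<r'}. Q $$ (k, l) * X $$ (?i l, j))"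
          using k by (simp add: Q_def sum_divide_distrib sum_negf)
        finally show ?thesis using QZ True by simp
      next
        case False
        have "(Q * Z) $$ (i, j) = (\<Sum>l\<in>{0..<r'}. if i = ?i l then X $$ (?i l, j) else 0)"
          unfolding QZ using False ij by (intro sum.cong) (auto simp: Q_def)
        also have "\<dots> = (\<Sum>l\<in>{0..<r}. if i = l then X $$ (l, j) else 0)"
          using False by (simp add: split)
        finally show ?thesis using ij by simp
      qed
    qed (use X in \<open>auto simp: Q_def Z_def\<close>)
  qed
  ultimately show thesis using that[of Q] Q r by auto
qed

abbreviation fmat :: "complex mat \<Rightarrow> complex poly fract mat" where
  "fmat \<equiv> map_mat frac_const"

abbreviation \<Lambda> :: "complex poly fract" where
  "\<Lambda> \<equiv> to_fract lam"

lemma fmat_simps: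
  "rat_mat (const_mat X) = fmat X"
  "dim_col X = dim_row Y \<Longrightarrow> fmat (X * Y) = fmat X * fmat Y"
  "fmat (X\<^sup>T) = (fmat X)\<^sup>T"
  "fmat (1\<^sub>m n) = 1\<^sub>m n"
  "dim_row X = dim_row Z \<Longrightarrow> dim_col X = dim_col Z \<Longrightarrow> rat_mat (lam \<cdot>\<^sub>m const_mat X - const_mat Z) = \<Lambda> \<cdot>\<^sub>m fmat X - fmat Z"
  "dim_row X = dim_row Z \<Longrightarrow> dim_col X = dim_col Z \<Longrightarrow> fmat (X - Z) = fmat X - fmat Z"
  "fmat (- X) = - fmat X"
proof -
  interpret h: comm_ring_hom frac_const by (rule comm_ring_hom_frac_const)
  show "rat_mat (const_mat X) = fmat X" by (rule eq_matI) auto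
  show "dim_col X = dim_row Y \<Longrightarrow> fmat (X * Y) = fmat X * fmat Y"
    by (rule h.mat_hom_mult[of X "dim_row X" "dim_col X" Y "dim_col Y"]) auto
  show "fmat (X\<^sup>T) = (fmat X)\<^sup>T" by (rule eq_matI) auto
  show "fmat (1\<^sub>m n) = 1\<^sub>m n" by (rule h.mat_hom_one)
  show "dim_row X = dim_row Z \<Longrightarrow> dim_col X = dim_col Z \<Longrightarrow> rat_mat (lam \<cdot>\<^sub>m const_mat X - const_mat Z) = \<Lambda> \<cdot>\<^sub>m fmat X - fmat Z"
  proof -
    have "to_fract (lam * [:x:] - [:y:]) = \<Lambda> * frac_const x - frac_const y" for x y
      by (simp only: to_fract_diff to_fract_mult)
    then show "dim_row X = dim_row Z \<Longrightarrow> dim_col X = dim_col Z \<Longrightarrow> rat_mat (lam \<cdot>\<^sub>m const_mat X - const_mat Z) = \<Lambda> \<cdot>\<^sub>m fmat X - fmat Z"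
      by (intro eq_matI) auto
  qed
  show "dim_row X = dim_row Z \<Longrightarrow> dim_col X = dim_col Z \<Longrightarrow> fmat (X - Z) = fmat X - fmat Z"
    by (rule eq_matI) (auto simp: h.hom_minus)
  show "fmat (- X) = - fmat X"
    by (rule eq_matI) (auto simp: h.hom_uminus)
qed

lemma Lam_nonzero: "\<Lambda> \<noteq> 0"
  by simp

text \<open>
  The inverse of \<open>\<lambda> E - A\<close> exists and is proper, because \<open>\<lambda> E - A = \<lambda> (E - A / \<lambda>)\<close> and the
  second factor tends to the nonsingular matrix \<open>E\<close>.
\<close>

lemma resolvent:
  assumes "E \<in> carrier_mat r r" "A \<in> carrier_mat r r" "det E \<noteq> 0"
  obtains W where "W \<in> carrier_mat r r" "entries_in proper W" "(\<Lambda> \<cdot>\<^sub>m fmat E - fmat A) * W = 1\<^sub>m r"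
    "W * (\<Lambda> \<cdot>\<^sub>m fmat E - fmat A) = 1\<^sub>m r" 
    "\<And>P C B. transfer_function P C A E B = rat_mat P + fmat C * W * fmat B"
proof -
  define \<mu> where "\<mu> = inverse \<Lambda>"
  have \<mu>: "\<Lambda> * \<mu> = 1" "limit_at_inf \<mu> 0" "\<mu> \<in> proper" using Lam_nonzero limit_at_inf_inverse_lam by (auto simp: \<mu>_def proper_def)
  let ?M = "fmat E - \<mu> \<cdot>\<^sub>m fmat A"
  have [simp]: "dim_row E = r" "dim_col E = r" "dim_row A = r" "dim_col A = r" using assms by auto
  have "limit_at_inf (frac_const x + - (\<mu> * frac_const y)) (x + - (0 * y))" for x y
    using \<mu> by (intro limit_at_inf_add limit_at_inf_const limit_at_inf_mult limit_at_inf_uminus)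
  then have "mat_limit ?M E"
    by (auto simp: mat_limit_def)
  from mat_limit_invertible[OF this assms(1,3)] obtain W' where
    W': "W' \<in> carrier_mat r r" "entries_in proper W'" "?M * W' = 1\<^sub>m r" "W' * ?M = 1\<^sub>m r"
    unfolding invertible_over_def by blast
  let ?W = "\<mu> \<cdot>\<^sub>m W'" let ?R = "\<Lambda> \<cdot>\<^sub>m fmat E - fmat A"
  have [simp]: "dim_row W' = r" "dim_col W' = r" using W' by auto
  have "\<mu> \<cdot>\<^sub>m ?R = ?M" using \<mu>(1) by (intro eq_matI) (auto simp: algebra_simps)
  have "?R * ?W = (\<mu> \<cdot>\<^sub>m ?R) * W'" "?W * ?R = W' * (\<mu> \<cdot>\<^sub>m ?R)"
    by (simp_all add: mat_smult_mult)
  then have inv: "?R * ?W = 1\<^sub>m r" "?W * ?R = 1\<^sub>m r"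
    unfolding \<open>\<mu> \<cdot>\<^sub>m ?R = ?M\<close> W' by simp_all
  have "inv_mat ?R = ?W" by (rule inv_mat_unique[of _ r]) (use inv in \<open>auto intro!: carrier_matI\<close>)
  then have "transfer_function P C A E B = rat_mat P + fmat C * ?W * fmat B" for P C B
    by (simp add: transfer_function_def fmat_simps)
  with that[of ?W] inv W' \<mu> show thesis by (auto intro: proper.entries_smult)
qed

text \<open>
  A nonzero row \<open>w\<close> with \<open>w B = 0\<close> and \<open>w A = z w E\<close> makes one state superfluous.  Put \<open>u = w E\<close>.
  The hyperplane \<open>u x = 0\<close> contains the columns of \<open>E\<^sup>-\<^sup>1 B\<close> and is invariant under
  \<open>E\<^sup>-\<^sup>1 A\<close>.  With a basis \<open>Q\<close> of it, \<open>A Q = E Q A\<^sub>2\<close> and \<open>B = E Q B\<^sub>2\<close>, whence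
  \<open>(\<lambda> E - A)\<^sup>-\<^sup>1 B = Q (\<lambda> - A\<^sub>2)\<^sup>-\<^sup>1 B\<^sub>2\<close>, a realization with \<open>r - 1\<close> states.
\<close>

lemma minimal_imp_controllable:
  assumes min: "minimal_realization n r P C A E B"
    and w: "w \<in> carrier_mat 1 r" "w * B = 0\<^sub>m 1 n" "w * A = z \<cdot>\<^sub>m (w * E)"
  shows "w = 0\<^sub>m 1 r"
proof (rule ccontr)
  assume "w \<noteq> 0\<^sub>m 1 r"
  from min have re: "realization n r P C A E B" by (simp add: minimal_realization_def)
  then have carr: "P \<in> carrier_mat n n" "C \<in> carrier_mat n r" "A \<in> carrier_mat r r" "E \<in> carrier_mat r r" "B \<in> carrier_mat r n"
    and detE: "det E \<noteq> 0" by (auto simp: realization_def)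
  have [simp]: "dim_row P = n" "dim_col P = n" "dim_row C = n" "dim_col C = r" "dim_row A = r" "dim_col A = r" "dim_row E = r" "dim_col E = r"
    "dim_row B = r" "dim_col B = n" "dim_row w = 1" "dim_col w = r" using carr w by auto
  from det_non_zero_imp_unit[OF carr(4) detE, unfolded Units_def, of "()"]
  obtain Ei where Ei: "Ei \<in> carrier_mat r r" "E * Ei = 1\<^sub>m r" "Ei * E = 1\<^sub>m r" by (auto simp: ring_mat_simps)
  have [simp]: "dim_row Ei = r" "dim_col Ei = r" using Ei by auto
  have u0: "w * E \<noteq> 0\<^sub>m 1 r"
  proof
    assume "w * E = 0\<^sub>m 1 r"
    then have "w * E * Ei = 0\<^sub>m 1 r" by simp
    then have "w = 0\<^sub>m 1 r" by (simp add: mat_mult_assoc Ei)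
    with \<open>w \<noteq> 0\<^sub>m 1 r\<close> show False by simp
  qed
  have EEi: "w * E * (Ei * X) = w * X" if "dim_row X = r" for X
  proof -
    have "w * E * (Ei * X) = w * (E * Ei) * X" using that by (simp add: mat_mult_assoc)
    then show ?thesis by (simp add: Ei)
  qed
  have EEi': "w * (E * (Ei * X)) = w * X" if "dim_row X = r" for X
    using EEi[OF that] that by (simp add: mat_mult_assoc)
  from u0 obtain Q where Q: "Q \<in> carrier_mat r (r - 1)" "w * E * Q = 0\<^sub>m 1 (r - 1)" "r \<ge> 1"
    and factor: "\<And>X. dim_row X = r \<Longrightarrow> w * E * X = 0\<^sub>m 1 (dim_col X) \<Longrightarrow> \<exists>Z \<in> carrier_mat (r - 1) (dim_col X). X = Q * Z"
    by (rule row_kernel_basis[of "w * E" r, rotated]) auto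
  have [simp]: "dim_row Q = r" "dim_col Q = r - 1" using Q by auto
  have "w * E * (Ei * (A * Q)) = w * A * Q" by (simp add: EEi' mat_mult_assoc)
  also have "\<dots> = z \<cdot>\<^sub>m (w * E * Q)" by (simp add: w mat_smult_mult)
  finally have "w * E * (Ei * (A * Q)) = 0\<^sub>m 1 (r - 1)" by (simp add: Q zero_mat_simps)
  then obtain A2 where A2: "A2 \<in> carrier_mat (r - 1) (r - 1)" "Ei * (A * Q) = Q * A2"
    using factor[of "Ei * (A * Q)"] by auto
  obtain B2 where B2: "B2 \<in> carrier_mat (r - 1) n" "Ei * B = Q * B2"
    using factor[of "Ei * B"] EEi[of B] w by auto
  have [simp]: "dim_row A2 = r - 1" "dim_col A2 = r - 1" "dim_row B2 = r - 1" "dim_col B2 = n" using A2 B2 by auto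
  have "E * (Ei * (A * Q)) = E * Ei * (A * Q)" "E * (Ei * B) = E * Ei * B" by (simp_all add: mat_mult_assoc)
  then have AQ: "A * Q = E * (Q * A2)" and BQ: "B = E * (Q * B2)" using A2 B2 Ei by simp_all
  have re2: "realization n (r - 1) P (C * Q) A2 (1\<^sub>m (r - 1)) B2"
    using carr Q A2 B2 by (simp add: realization_def)
  obtain W where W: "W \<in> carrier_mat r r" "W * (\<Lambda> \<cdot>\<^sub>m fmat E - fmat A) = 1\<^sub>m r" 
    "transfer_function P C A E B = rat_mat P + fmat C * W * fmat B"
    using resolvent[OF carr(4,3) detE] by metis
  have "det (1\<^sub>m (r - 1) :: complex mat) \<noteq> 0" by simp
  then obtain W2 where W2: "W2 \<in> carrier_mat (r - 1) (r - 1)" "(\<Lambda> \<cdot>\<^sub>m 1\<^sub>m (r - 1) - fmat A2) * W2 = 1\<^sub>m (r - 1)" 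
    "transfer_function P (C * Q) A2 (1\<^sub>m (r - 1)) B2 = rat_mat P + fmat (C * Q) * W2 * fmat B2"
    using resolvent[OF one_carrier_mat A2(1)] by (metis fmat_simps(4))
  have [simp]: "dim_row W = r" "dim_col W = r" "dim_row W2 = r - 1" "dim_col W2 = r - 1" using W W2 by auto
  have "(\<Lambda> \<cdot>\<^sub>m fmat E - fmat A) * fmat Q = fmat E * fmat Q * (\<Lambda> \<cdot>\<^sub>m 1\<^sub>m (r - 1) - fmat A2)"
  proof -
    have "(\<Lambda> \<cdot>\<^sub>m fmat E - fmat A) * fmat Q = \<Lambda> \<cdot>\<^sub>m (fmat E * fmat Q) - fmat (A * Q)"
      by (simp add: mat_ring fmat_simps)
    also have "\<dots> = fmat E * fmat Q * (\<Lambda> \<cdot>\<^sub>m 1\<^sub>m (r - 1) - fmat A2)"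
      unfolding AQ by (simp add: mat_ring fmat_simps)
    finally show ?thesis .
  qed
  then have "(\<Lambda> \<cdot>\<^sub>m fmat E - fmat A) * fmat Q * (W2 * fmat B2) 
     = fmat E * fmat Q * ((\<Lambda> \<cdot>\<^sub>m 1\<^sub>m (r - 1) - fmat A2) * W2) * fmat B2"
    by (simp add: mat_mult_assoc)
  also have "\<dots> = fmat B" unfolding W2 by (simp add: BQ fmat_simps mat_mult_assoc)
  finally have "W * fmat B = W * (\<Lambda> \<cdot>\<^sub>m fmat E - fmat A) * (fmat Q * (W2 * fmat B2))"
    by (simp add: mat_mult_assoc)
  also have "\<dots> = fmat Q * (W2 * fmat B2)" unfolding W by simp
  finally have "transfer_function P (C * Q) A2 (1\<^sub>m (r - 1)) B2 = transfer_function P C A E B"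
    unfolding W W2 by (simp add: mat_mult_assoc fmat_simps)
  with min re2 have "r \<le> r - 1" unfolding minimal_realization_def by blast
  with Q(3) show False by simp
qed

text \<open>
  Transposition exchanges \<open>B\<close> and \<open>C\<close>, hence controllability and observability.
\<close>

lemma realization_transpose:
  assumes "realization n r P C A E B"
  shows "realization n r (P\<^sup>T) (B\<^sup>T) (A\<^sup>T) (E\<^sup>T) (C\<^sup>T)"
    and "transfer_function (P\<^sup>T) (B\<^sup>T) (A\<^sup>T) (E\<^sup>T) (C\<^sup>T)
      = (transfer_function P C A E B)\<^sup>T"
proof -
  let ?T = transpose_mat
  from assms have carr: "P \<in> carrier_mat n n" "C \<in> carrier_mat n r" "A \<in> carrier_mat r r" "E \<in> carrier_mat r r" "B \<in> carrier_mat r n"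
    and detE: "det E \<noteq> 0" by (auto simp: realization_def)
  have [simp]: "dim_row P = n" "dim_col P = n" "dim_row C = n" "dim_col C = r" "dim_row A = r" "dim_col A = r" "dim_row E = r" "dim_col E = r"
    "dim_row B = r" "dim_col B = n" using carr by auto
  have detET: "det (?T E) \<noteq> 0" using detE carr by (simp add: det_transpose)
  then show "realization n r (?T P) (?T B) (?T A) (?T E) (?T C)"
    using carr by (simp add: realization_def)
  obtain W where W: "W \<in> carrier_mat r r" "W * (\<Lambda> \<cdot>\<^sub>m fmat E - fmat A) = 1\<^sub>m r" 
    "transfer_function P C A E B = rat_mat P + fmat C * W * fmat B"
    using resolvent[OF carr(4,3) detE] by metis
  obtain W2 where W2: "W2 \<in> carrier_mat r r" "W2 * (\<Lambda> \<cdot>\<^sub>m fmat (?T E) - fmat (?T A)) = 1\<^sub>m r" 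
    "transfer_function (?T P) (?T B) (?T A) (?T E) (?T C) = rat_mat (?T P) + fmat (?T B) * W2 * fmat (?T C)"
    using resolvent[of "?T E" r "?T A"] detET carr by (metis transpose_carrier_mat)
  have [simp]: "dim_row W = r" "dim_col W = r" "dim_row W2 = r" "dim_col W2 = r" using W W2 by auto
  have RT: "\<Lambda> \<cdot>\<^sub>m fmat (?T E) - fmat (?T A) = ?T (\<Lambda> \<cdot>\<^sub>m fmat E - fmat A)"
    by (intro eq_matI) auto
  have "?T (\<Lambda> \<cdot>\<^sub>m fmat E - fmat A) * ?T W = ?T (W * (\<Lambda> \<cdot>\<^sub>m fmat E - fmat A))"
    by (simp add: mat_transpose_mult)
  then have RW: "?T (\<Lambda> \<cdot>\<^sub>m fmat E - fmat A) * ?T W = 1\<^sub>m r" unfolding W by simp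
  have "W2 = W2 * (?T (\<Lambda> \<cdot>\<^sub>m fmat E - fmat A) * ?T W)" unfolding RW by simp
  also have "\<dots> = W2 * ?T (\<Lambda> \<cdot>\<^sub>m fmat E - fmat A) * ?T W" by (simp add: mat_mult_assoc)
  also have "\<dots> = ?T W" unfolding W2(2)[unfolded RT] by simp
  finally have "W2 = ?T W" .
  moreover have "rat_mat (?T P) = ?T (rat_mat P)" by (intro eq_matI) auto
  moreover have "?T (rat_mat P + fmat C * W * fmat B) = ?T (rat_mat P) + ?T (fmat C * W * fmat B)"
    by (intro transpose_add carrier_matI) auto
  ultimately show "transfer_function (?T P) (?T B) (?T A) (?T E) (?T C) = ?T (transfer_function P C A E B)"
    unfolding W(3) W2(3) by (simp add: mat_transpose_mult fmat_simps(3) mat_mult_assoc)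
qed

lemma minimal_realization_transpose:
  assumes "minimal_realization n r P C A E B"
  shows "minimal_realization n r (P\<^sup>T) (B\<^sup>T) (A\<^sup>T) (E\<^sup>T) (C\<^sup>T)"
proof -
  let ?T = transpose_mat
  have re: "realization n r P C A E B" using assms by (simp add: minimal_realization_def)
  {
    fix r' P' C' A' E' B'
    assume *: "realization n r' P' C' A' E' B'" 
      "transfer_function P' C' A' E' B' = transfer_function (?T P) (?T B) (?T A) (?T E) (?T C)"
    then have "transfer_function (?T P') (?T B') (?T A') (?T E') (?T C') = transfer_function P C A E B"
      by (simp add: realization_transpose(2)[OF *(1)] realization_transpose(2)[OF re])
    with realization_transpose(1)[OF *(1)] assms have "r \<le> r'" unfolding minimal_realization_def by blast
  }
  with realization_transpose(1)[OF re] show ?thesis unfolding minimal_realization_def by blast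
qed

lemma minimal_imp_observable:
  assumes min: "minimal_realization n r P C A E B"
    and v: "v \<in> carrier_mat r 1" "C * v = 0\<^sub>m n 1" "A * v = z \<cdot>\<^sub>m (E * v)"
  shows "v = 0\<^sub>m r 1"
proof -
  let ?T = transpose_mat
  from min have carr: "P \<in> carrier_mat n n" "C \<in> carrier_mat n r" "A \<in> carrier_mat r r" "E \<in> carrier_mat r r" "B \<in> carrier_mat r n"
    by (auto simp: realization_def minimal_realization_def)
  have dims: "dim_row v = r" "dim_col C = r" "dim_col A = r" "dim_col E = r" using carr v by auto
  have "?T v * ?T C = ?T (C * v)" using dims by (simp add: mat_transpose_mult)
  then have 1: "?T v * ?T C = 0\<^sub>m 1 n" unfolding v by simp
  have "?T v * ?T A = ?T (A * v)" using dims by (simp add: mat_transpose_mult)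
  also have "\<dots> = z \<cdot>\<^sub>m ?T (E * v)" unfolding v by (intro eq_matI) auto
  also have "\<dots> = z \<cdot>\<^sub>m (?T v * ?T E)" using dims by (simp add: mat_transpose_mult)
  finally have 2: "?T v * ?T A = z \<cdot>\<^sub>m (?T v * ?T E)" .
  from 1 2 have "?T v = 0\<^sub>m 1 r"
    using v by (intro minimal_imp_controllable[OF minimal_realization_transpose[OF min]]) auto
  then have "?T (?T v) = ?T (0\<^sub>m 1 r)" by simp
  then show ?thesis by simp
qed

section \<open>Products of Fiedler matrices\<close>

lemma diag_block_mat_dsum: "diag_block_mat [A, B] = A \<boxplus> B" "diag_block_mat [A, B, C] = A \<boxplus> (B \<boxplus> C)"
proof -
  have 1: "diag_block_mat (M # Ms) = M \<boxplus> diag_block_mat Ms" for M and Ms :: "'a mat list"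
    by (simp add: dsum_def Let_def)
  show "diag_block_mat [A, B] = A \<boxplus> B" "diag_block_mat [A, B, C] = A \<boxplus> (B \<boxplus> C)"
    by (simp_all only: 1[of A "[B]"] 1[of A "[B, C]"] 1[of B "[C]"] diag_block_mat_singleton)
qed

lemma fiedler_block_dsum:
  assumes "dim_row a = n" "dim_col a = n"
  shows "fiedler_block n (n + p) a = four_block_mat (- a) (1\<^sub>m n) (1\<^sub>m n) (0\<^sub>m n n) \<boxplus> 1\<^sub>m p"
proof (rule eq_matI)
  fix i j assume "i < dim_row (four_block_mat (- a) (1\<^sub>m n) (1\<^sub>m n) (0\<^sub>m n n) \<boxplus> 1\<^sub>m p)"
    "j < dim_col (four_block_mat (- a) (1\<^sub>m n) (1\<^sub>m n) (0\<^sub>m n n) \<boxplus> 1\<^sub>m p)"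
  then have "i < n + (n + p)" "j < n + (n + p)" using assms by auto
  then show "fiedler_block n (n + p) a $$ (i, j) = (four_block_mat (- a) (1\<^sub>m n) (1\<^sub>m n) (0\<^sub>m n n) \<boxplus> 1\<^sub>m p) $$ (i, j)"
    using assms
    by (cases "i < n"; cases "j < n"; cases "i < n + n"; cases "j < n + n")
      (auto simp: fiedler_block_def head_proj_def tail_proj_def index_dsum)
qed (use assms in auto)

lemma top_zero_mult:
  assumes "dim_col Y = dim_row Z"
  shows "top_zero k Y * Z = top_zero k (Y * (Z :: 'a :: comm_ring_1 mat))"
proof (rule eq_matI)
  fix i j assume "i < dim_row (top_zero k (Y * Z))" "j < dim_col (top_zero k (Y * Z))"
  then have ij: "i < k + dim_row Y" "j < dim_col Z" by auto
  show "(top_zero k Y * Z) $$ (i, j) = top_zero k (Y * Z) $$ (i, j)"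
  proof (cases "i < k")
    case True
    then show ?thesis using ij assms by (simp add: scalar_prod_def index_top_zero)
  next
    case False
    then show ?thesis using ij assms by (simp add: scalar_prod_def index_top_zero)
  qed
qed auto

lemma fiedler_P_mid_eq:
  assumes "Ac i \<in> carrier_mat n n" "0 < i"
  shows "fiedler_P_mid n m Ac i = 1\<^sub>m ((m - i - 1) * n) \<boxplus> fiedler_block n (n + (i - 1) * n) (Ac i)"
  using assms by (simp add: fiedler_P_mid_def diag_block_mat_dsum fiedler_block_dsum del: diag_block_mat.simps)

text \<open>
  \<open>e\<^sub>m \<otimes> X\<close> is \<open>X\<close> below \<open>m - 1\<close> zero blocks.
\<close>

lemma kron_e_last:
  assumes "X \<in> carrier_mat k l"
  shows "kron (e_last (Suc m)) X = top_zero (m * k) X"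
proof (rule eq_matI)
  have [simp]: "dim_row X = k" "dim_col X = l" using assms by auto
  have e: "dim_row (e_last (Suc m)) = Suc m" "dim_col (e_last (Suc m)) = 1"
    "\<And>i. i < Suc m \<Longrightarrow> e_last (Suc m) $$ (i, 0) = (if i = m then 1 else 0)"
    by (auto simp: e_last_def mat_of_cols_def)
  show "dim_row (kron (e_last (Suc m)) X) = dim_row (top_zero (m * k) X)" "dim_col (kron (e_last (Suc m)) X) = dim_col (top_zero (m * k) X)"
    by (simp_all add: kron_def e)
  fix i j assume "i < dim_row (top_zero (m * k) X)" "j < dim_col (top_zero (m * k) X)"
  then have ij: "i < m * k + k" "j < l" by auto
  then have k: "k > 0" by (cases k) auto
  have div: "i div k < Suc m" using ij k by (simp add: less_mult_imp_div_less add.commute)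
  have "i div k = m \<longleftrightarrow> m * k \<le> i"
  proof
    show "i div k = m \<Longrightarrow> m * k \<le> i" using div_times_less_eq_dividend[of i k] by auto
    show "m * k \<le> i \<Longrightarrow> i div k = m" using ij by (intro div_nat_eqI) (simp_all add: mult.commute)
  qed
  moreover have "i mod k = i - m * k" if "m * k \<le> i"
  proof -
    have "i = m * k + (i - m * k)" using that by simp
    then have "i mod k = (i - m * k) mod k" by (metis mod_mult_self3)
    then show ?thesis using ij that by simp
  qed
  ultimately show "kron (e_last (Suc m)) X $$ (i, j) = top_zero (m * k) X $$ (i, j)"
    using ij div by (auto simp: kron_def e index_top_zero)
qed

lemma kron_transpose: "(kron X Y)\<^sup>T = kron (X\<^sup>T) (Y\<^sup>T)"
proof (rule eq_matI)
  fix i j assume "i < dim_row (kron (X\<^sup>T) (Y\<^sup>T))" "j < dim_col (kron (X\<^sup>T) (Y\<^sup>T))"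
  then have ij: "i < dim_col X * dim_col Y" "j < dim_row X * dim_row Y" by (auto simp: kron_def)
  then have "dim_col Y > 0" "dim_row Y > 0" by (auto intro: Nat.gr0I)
  then have "i div dim_col Y < dim_col X" "i mod dim_col Y < dim_col Y" "j div dim_row Y < dim_row X" "j mod dim_row Y < dim_row Y"
    using ij by (auto simp: less_mult_imp_div_less)
  then show "(kron X Y)\<^sup>T $$ (i, j) = kron (X\<^sup>T) (Y\<^sup>T) $$ (i, j)"
    using ij by (simp add: kron_def)
qed (auto simp: kron_def)

lemma fiedler_S_zero_eq:
  assumes "Ac 0 \<in> carrier_mat n n" "C \<in> carrier_mat n r" "B \<in> carrier_mat r n" "A \<in> carrier_mat r r"
  shows "fiedler_S_zero n (Suc k) Ac C A B = four_block_mat (1\<^sub>m (k * n) \<boxplus> - Ac 0) (- (last_block n k * C))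
     (- (B * (last_block n k)\<^sup>T)) (- A)" (is "_ = ?M")
    and "fiedler_S_zero n (Suc k) Ac C A B = 1\<^sub>m (k * n) \<boxplus> four_block_mat (- Ac 0) (- C) (- B) (- A)"
proof -
  have [simp]: "dim_row C = n" "dim_col C = r" "dim_row B = r" "dim_col B = n" "dim_row A = r" "dim_col A = r" "dim_row (Ac 0) = n" "dim_col (Ac 0) = n"
    using assms by auto
  have 1: "kron (e_last (Suc k)) C = last_block n k * C"
    using kron_e_last[OF assms(2)] by (simp add: top_zero_mult)
  have "kron ((e_last (Suc k))\<^sup>T) B = (kron (e_last (Suc k)) (B\<^sup>T))\<^sup>T"
    by (simp add: kron_transpose)
  also have "\<dots> = (last_block n k * B\<^sup>T)\<^sup>T"
    using assms by (simp add: kron_e_last[of _ n r] top_zero_mult)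
  also have "\<dots> = B * (last_block n k)\<^sup>T" by (simp add: mat_transpose_mult)
  finally have 2: "kron ((e_last (Suc k))\<^sup>T) B = B * (last_block n k)\<^sup>T" .
  show *: "fiedler_S_zero n (Suc k) Ac C A B = ?M"
    by (simp add: fiedler_S_zero_def fiedler_P_zero_def diag_block_mat_dsum 1 2 del: diag_block_mat.simps)
  have BJ: "B * (last_block n k)\<^sup>T = (top_zero (k * n) (B\<^sup>T))\<^sup>T"
    by (metis \<open>dim_col B = n\<close> \<open>(last_block n k * B\<^sup>T)\<^sup>T = B * (last_block n k)\<^sup>T\<close> index_one_mat(3) index_transpose_mat(2) left_mult_one_mat' top_zero_mult)
  show "fiedler_S_zero n (Suc k) Ac C A B = 1\<^sub>m (k * n) \<boxplus> four_block_mat (- Ac 0) (- C) (- B) (- A)"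
    unfolding * BJ by (intro eq_matI) (auto simp: index_dsum top_zero_mult index_top_zero)
qed

definition mprod :: "nat \<Rightarrow> ('i \<Rightarrow> 'a :: comm_ring_1 mat) \<Rightarrow> 'i list \<Rightarrow> 'a mat" where
  "mprod N f t = foldr (\<lambda>i M. f i * M) t (1\<^sub>m N)"

lemma mprod_simps [simp]: "mprod N f [] = 1\<^sub>m N" "mprod N f (i # t) = f i * mprod N f t"
  by (simp_all add: mprod_def)

lemma mprod_map: "mprod N f (map g t) = mprod N (\<lambda>i. f (g i)) t"
  by (induction t) auto

lemma mprod_carrier:
  assumes "\<And>i. i \<in> set t \<Longrightarrow> f i \<in> carrier_mat N N"
  shows "mprod N f t \<in> carrier_mat N N"
  using assms by (induction t) (auto intro: mult_carrier_mat)

lemma mprod_append: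
  assumes "\<And>i. i \<in> set (s @ t) \<Longrightarrow> f i \<in> carrier_mat N N"
  shows "mprod N f (s @ t) = mprod N f s * mprod N f t"
  using assms
proof (induction s)
  case Nil
  then show ?case using mprod_carrier[of t f N] by simp
next
  case (Cons i s)
  then have "f i \<in> carrier_mat N N" "mprod N f s \<in> carrier_mat N N" "mprod N f t \<in> carrier_mat N N"
    by (auto intro: mprod_carrier)
  then show ?case using Cons by (simp add: assoc_mult_mat[of _ N N _ N _ N])
qed

lemma mprod_commute:
  assumes "\<And>i. i \<in> set t \<Longrightarrow> f i \<in> carrier_mat N N" "G \<in> carrier_mat N N" "\<And>i. i \<in> set t \<Longrightarrow> G * f i = f i * G"
  shows "G * mprod N f t = mprod N f t * G"
  using assms
proof (induction t)
  case (Cons i t)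
  then have c: "f i \<in> carrier_mat N N" "mprod N f t \<in> carrier_mat N N"
    by (auto intro: mprod_carrier)
  have "G * (f i * mprod N f t) = G * f i * mprod N f t"
    by (rule assoc_mult_mat[symmetric]) (use c Cons.prems in auto)
  also have "G * f i = f i * G" using Cons.prems by simp
  also have "f i * G * mprod N f t = f i * (G * mprod N f t)" by (rule assoc_mult_mat) (use c Cons.prems in auto)
  also have "\<dots> = f i * (mprod N f t * G)" using Cons by simp
  also have "\<dots> = f i * mprod N f t * G" by (rule assoc_mult_mat[symmetric]) (use c Cons.prems in auto)
  finally show ?case by simp
qed auto


text \<open>
  The coefficients are indexed up to \<open>m = k + 1\<close>, so that \<open>k = m - 1\<close> is the largest index of a
  Fiedler matrix in the middle range and the size \<open>m n\<close> is \<open>n + k n\<close>.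
\<close>

locale fiedler_matrices =
  fixes n k r :: nat and Ac :: "nat \<Rightarrow> complex mat" and A B C E :: "complex mat"
  assumes Ac: "i \<le> Suc k \<Longrightarrow> Ac i \<in> carrier_mat n n"
    and A: "A \<in> carrier_mat r r" and B: "B \<in> carrier_mat r n" and C: "C \<in> carrier_mat n r"
    and E: "E \<in> carrier_mat r r" and det_E: "det E \<noteq> 0"
begin

abbreviation F :: "int \<Rightarrow> complex mat" where
  "F \<equiv> fiedler_S n (Suc k) r Ac C A E B"

lemma F_zero: "F 0 = fiedler_S_zero n (Suc k) Ac C A B"
  by (simp add: fiedler_S_def)

lemma F_mid:
  assumes "0 < i" "i \<le> k"
  shows "F (int i) = 1\<^sub>m ((k - i) * n) \<boxplus> (fiedler_block n (n + (i - 1) * n) (Ac i) \<boxplus> 1\<^sub>m r)"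
  using assms Ac[of i] by (simp add: fiedler_S_def fiedler_S_mid_def fiedler_P_mid_eq diag_block_mat_dsum dsum_assoc del: diag_block_mat.simps)

lemma mid_size:
  assumes "0 < i" "i \<le> k"
  shows "(k - i) * n + (n + (n + (i - 1) * n)) = Suc k * n"
proof -
  obtain c where "k = i + c" using assms le_Suc_ex by blast
  moreover obtain i' where "i = Suc i'" using assms by (cases i) auto
  ultimately show ?thesis by (simp add: algebra_simps)
qed

lemma F_carrier:
  assumes "i \<le> k"
  shows "F (int i) \<in> carrier_mat (Suc k * n + r) (Suc k * n + r)"
proof (cases "i = 0")
  case True
  have "dim_row (Ac 0) = n" "dim_col (Ac 0) = n" using Ac[of 0] by auto
  then show ?thesis using True A B C Ac[of 0] by (auto simp: F_zero fiedler_S_zero_eq(2) intro!: carrier_matI)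
next
  case False
  have "dim_row (Ac i) = n" "dim_col (Ac i) = n" using Ac[of i] assms by auto
  then show ?thesis using False assms mid_size[of i] by (intro carrier_matI) (auto simp: F_mid)
qed

text \<open>
  If \<open>i + 2 \<le> j\<close>, then the nontrivial part of the factor with index \<open>j\<close> lies in the first
  \<open>m - j + 1\<close> blocks and that of the factor with index \<open>i\<close> in the remaining ones.
\<close>

lemma F_commute:
  assumes "i + 2 \<le> j" "j \<le> k"
  shows "F (int j) * F (int i) = F (int i) * F (int j)"
proof -
  obtain d where d: "k = j + d" using assms le_Suc_ex by blast
  then have "k - j = d" by simp
  obtain c where c: "j = i + 2 + c" using assms le_Suc_ex by blast
  \<comment> \<open>The split point: the first factor is trivial beyond s, the second one up to s.\<close>
  define s where "s = d * n + (n + n)"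
  define t where "t = (j - 1) * n + r"
  have dj: "dim_row (Ac j) = n" "dim_col (Ac j) = n" using Ac[of j] assms by auto
  have "F (int j) = (1\<^sub>m (d * n) \<boxplus> four_block_mat (- Ac j) (1\<^sub>m n) (1\<^sub>m n) (0\<^sub>m n n)) \<boxplus> 1\<^sub>m t"
    using assms dj \<open>k - j = d\<close> by (simp add: F_mid fiedler_block_dsum dsum_assoc t_def dsum_one)
  then obtain P where P: "F (int j) = P \<boxplus> 1\<^sub>m t" "dim_row P = s" "dim_col P = s"
    using dj that by (auto simp: s_def)
  obtain Q where Q: "F (int i) = 1\<^sub>m s \<boxplus> Q" "dim_row Q = t" "dim_col Q = t"
  proof (cases "i = 0")
    case True
    have d0: "dim_row (Ac 0) = n" "dim_col (Ac 0) = n" using Ac[of 0] by auto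
    have "k * n = s + c * n" using True by (simp add: s_def c d algebra_simps)
    then have "F 0 = 1\<^sub>m s \<boxplus> (1\<^sub>m (c * n) \<boxplus> four_block_mat (- Ac 0) (- C) (- B) (- A))"
      using A B C Ac[of 0] by (simp add: F_zero fiedler_S_zero_eq(2) dsum_one_one)
    then show thesis using that d0 A True by (auto simp: t_def c algebra_simps)
  next
    case False
    then obtain i' where i': "i = Suc i'" by (cases i) auto
    have di: "dim_row (Ac i) = n" "dim_col (Ac i) = n" using Ac[of i] assms by auto
    have "(k - i) * n = s + c * n" by (simp add: s_def c d algebra_simps)
    then have "F (int i) = 1\<^sub>m s \<boxplus> (1\<^sub>m (c * n) \<boxplus> (fiedler_block n (n + (i - 1) * n) (Ac i) \<boxplus> 1\<^sub>m r))"
      using assms False by (subst F_mid) (auto simp: dsum_one_one)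
    then show thesis using that di by (auto simp: t_def c i' algebra_simps)
  qed
  show ?thesis unfolding P(1) Q(1) using P Q by (simp add: dsum_mult)
qed

\<comment> \<open>Fiedler matrices are indexed by integers; the form int (Suc j) must survive simplification.\<close>
declare of_nat_Suc [simp del]

abbreviation N :: nat where "N \<equiv> Suc k * n + r"

text \<open>
  In a product of the factors with indices \<open>0, \<dots>, j + 1\<close>, the largest index fails to commute only
  with \<open>j\<close>.  If \<open>j\<close> stands to its right, it can be moved to the left end, otherwise to the
  right end; the remaining product is treated recursively.
\<close>

lemma fiedler_product_factorization:
  assumes "distinct \<sigma>" "set \<sigma> = {0..j}" "j \<le> k"
  shows "\<exists>L R. fiedler_factors n Ac j L R \<and>
    mprod N (\<lambda>i. F (int i)) \<sigma> = (1\<^sub>m ((k - j) * n) \<boxplus> (L \<boxplus> 1\<^sub>m r)) * F 0 * (1\<^sub>m ((k - j) * n) \<boxplus> (R \<boxplus> 1\<^sub>m r))"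
  using assms
proof (induction j arbitrary: \<sigma>)
  case 0
  then have "\<sigma> = [0]"
    by (cases \<sigma>; cases "tl \<sigma>") auto
  moreover have one: "1\<^sub>m ((k - 0) * n) \<boxplus> (1\<^sub>m n \<boxplus> 1\<^sub>m r) = 1\<^sub>m N" by (simp add: dsum_one add_ac)
  moreover have "F 0 \<in> carrier_mat N N" using F_carrier[of 0] by simp
  ultimately have "mprod N (\<lambda>i. F (int i)) \<sigma> = 1\<^sub>m N * F 0 * 1\<^sub>m N" by simp
  then show ?case
    by (intro exI[of _ "1\<^sub>m n"] conjI fiedler_factors.base) (simp only: one)
next
  case (Suc j)
  then have "Suc j \<in> set \<sigma>" by auto
  then obtain xs ys where \<sigma>: "\<sigma> = xs @ Suc j # ys" by (metis split_list)
  let ?G = "\<lambda>i. F (int i)" let ?J = "1\<^sub>m ((k - j) * n) :: complex mat"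
  have rest: "distinct (xs @ ys)" "set (xs @ ys) = {0..j}"
  proof -
    show "distinct (xs @ ys)" using Suc.prems \<sigma> by auto
    have "set (xs @ ys) = set \<sigma> - {Suc j}" using Suc.prems \<sigma> by auto
    also have "\<dots> = {0..j}" unfolding Suc.prems(2) by auto
    finally show "set (xs @ ys) = {0..j}" .
  qed
  then obtain L R where LR: "fiedler_factors n Ac j L R"
    "mprod N ?G (xs @ ys) = (?J \<boxplus> (L \<boxplus> 1\<^sub>m r)) * F 0 * (?J \<boxplus> (R \<boxplus> 1\<^sub>m r))"
    using Suc.IH[OF rest] Suc.prems by auto
  have car: "?G i \<in> carrier_mat N N" if "i \<in> set (xs @ ys) \<union> {Suc j}" for i
  proof (rule F_carrier)
    have "i \<in> {0..j} \<union> {Suc j}" using that unfolding rest(2) .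
    then show "i \<le> k" using Suc.prems(3) by auto
  qed
  have pc: "mprod N ?G xs \<in> carrier_mat N N" "mprod N ?G ys \<in> carrier_mat N N" "?G (Suc j) \<in> carrier_mat N N"
    using car by (auto intro!: mprod_carrier)
  then have pd: "dim_row (mprod N ?G xs) = N" "dim_col (mprod N ?G xs) = N" "dim_row (mprod N ?G ys) = N" "dim_col (mprod N ?G ys) = N"
     "dim_row (?G (Suc j)) = N" "dim_col (?G (Suc j)) = N" by auto
  have split: "mprod N ?G \<sigma> = mprod N ?G xs * (?G (Suc j) * mprod N ?G ys)" "mprod N ?G (xs @ ys) = mprod N ?G xs * mprod N ?G ys"
    unfolding \<sigma> using car by (subst mprod_append; auto)+
  have dims: "dim_row L = n + j * n" "dim_col L = n + j * n" "dim_row R = n + j * n" "dim_col R = n + j * n"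
    using fiedler_factors_dim[OF LR(1)] Suc.prems Ac by auto
  have dj: "dim_row (Ac (Suc j)) = n" "dim_col (Ac (Suc j)) = n" using Ac[of "Suc j"] Suc.prems by auto
  have "k - j = Suc (k - Suc j)" using Suc.prems by simp
  then have size: "(k - j) * n = (k - Suc j) * n + n" by simp
  let ?I = "1\<^sub>m ((k - Suc j) * n) :: complex mat"
  let ?B = "fiedler_block n (n + j * n) (Ac (Suc j))"
  have G: "?G (Suc j) = ?I \<boxplus> (?B \<boxplus> 1\<^sub>m r)" using Suc.prems by (simp add: F_mid)
  have expand: "?J \<boxplus> (M \<boxplus> 1\<^sub>m r) = ?I \<boxplus> ((1\<^sub>m n \<boxplus> M) \<boxplus> 1\<^sub>m r)" for M
    unfolding size by (simp add: dsum_assoc flip: dsum_one_one)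
  have F0: "dim_row (F 0) = N" "dim_col (F 0) = N" using F_carrier[of 0] by auto
  have N: "(k - Suc j) * n + (n + (n + j * n) + r) = N" "(k - Suc j) * n + (n + n + j * n + r) = N"
    using mid_size[of "Suc j"] Suc.prems by simp_all
  show ?case
  proof (cases "j \<in> set ys")
    case True
    have "?G (Suc j) * mprod N ?G xs = mprod N ?G xs * ?G (Suc j)"
    proof (rule mprod_commute[of _ _ N])
      fix i assume i: "i \<in> set xs"
      then have "i \<in> {0..j}" "i \<noteq> j" using rest True by auto
      then show "?G (Suc j) * ?G i = ?G i * ?G (Suc j)" using Suc.prems by (intro F_commute) auto
    qed (use car in auto)
    then have "mprod N ?G \<sigma> = ?G (Suc j) * mprod N ?G (xs @ ys)"
      unfolding split using pd by (simp flip: mat_mult_assoc)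
    also have "\<dots> = (?I \<boxplus> ((?B * (1\<^sub>m n \<boxplus> L)) \<boxplus> 1\<^sub>m r)) * F 0 * (?I \<boxplus> ((1\<^sub>m n \<boxplus> R) \<boxplus> 1\<^sub>m r))"
      unfolding LR G expand using dims dj F0 N by (simp add: dsum_mult flip: mat_mult_assoc)
    finally show ?thesis using fiedler_factors.left[OF LR(1)] by blast
  next
    case False
    have "?G (Suc j) * mprod N ?G ys = mprod N ?G ys * ?G (Suc j)"
    proof (rule mprod_commute[of _ _ N])
      fix i assume i: "i \<in> set ys"
      then have "i \<in> {0..j}" "i \<noteq> j" using rest False by auto
      then show "?G (Suc j) * ?G i = ?G i * ?G (Suc j)" using Suc.prems by (intro F_commute) auto
    qed (use car in auto)
    then have "mprod N ?G \<sigma> = mprod N ?G (xs @ ys) * ?G (Suc j)"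
      unfolding split using pd by (simp add: mat_mult_assoc)
    also have "\<dots> = (?I \<boxplus> ((1\<^sub>m n \<boxplus> L) \<boxplus> 1\<^sub>m r)) * F 0 * (?I \<boxplus> (((1\<^sub>m n \<boxplus> R) * ?B) \<boxplus> 1\<^sub>m r))"
      unfolding LR G expand using dims dj F0 N by (simp add: dsum_mult mat_mult_assoc)
    finally show ?thesis using fiedler_factors.right[OF LR(1)] by blast
  qed
qed

end

section \<open>Generalized Fiedler pencils\<close>

text \<open>
  Constant nonsingular matrices \<open>diag(M\<^sub>1, M\<^sub>0)\<close>.  These are the transformations that the definition
  of a Rosenbrock strong linearization allows without further conditions.
\<close>

definition block_invertible :: "nat \<Rightarrow> nat \<Rightarrow> complex mat \<Rightarrow> bool" where
  "block_invertible N r M \<longleftrightarrow> (\<exists>M1 M0. M = M1 \<boxplus> M0 \<and> invertible_over UNIV N M1 \<and> invertible_over UNIV r M0)"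

lemma invertible_over_one: "invertible_over UNIV N (1\<^sub>m N)"
  by (rule invertible_overI[of _ _ "1\<^sub>m N"]) auto

lemma block_invertible_carrier: "block_invertible N r M \<Longrightarrow> M \<in> carrier_mat (N + r) (N + r)"
  by (auto simp: block_invertible_def invertible_over_def)

lemma block_invertible_one: "block_invertible N r (1\<^sub>m (N + r))"
  unfolding block_invertible_def
  by (intro exI[of _ "1\<^sub>m N"] exI[of _ "1\<^sub>m r"] conjI invertible_over_one) (simp add: dsum_one)

lemma block_invertible_mult:
  assumes "block_invertible N r M" "block_invertible N r M'"
  shows "block_invertible N r (M * M')"
proof -
  from assms obtain M1 M0 M1' M0' where *: "M = M1 \<boxplus> M0" "invertible_over UNIV N M1" "invertible_over UNIV r M0"
    "M' = M1' \<boxplus> M0'" "invertible_over UNIV N M1'" "invertible_over UNIV r M0'"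
    unfolding block_invertible_def by blast
  then have "M * M' = (M1 * M1') \<boxplus> (M0 * M0')"
    by (simp add: dsum_mult invertible_overD)
  with * show ?thesis unfolding block_invertible_def by (blast intro: univ.invertible_over_mult)
qed

lemma block_invertible_inverse:
  assumes "block_invertible N r M"
  shows "block_invertible N r (inv_mat M)" "M * inv_mat M = 1\<^sub>m (N + r)" "inv_mat M * M = 1\<^sub>m (N + r)"
proof -
  from assms obtain M1 M0 where *: "M = M1 \<boxplus> M0" "invertible_over UNIV N M1" "invertible_over UNIV r M0"
    unfolding block_invertible_def by blast
  from *(2) obtain W1 where W1: "M1 \<in> carrier_mat N N" "W1 \<in> carrier_mat N N" "M1 * W1 = 1\<^sub>m N" "W1 * M1 = 1\<^sub>m N"
    unfolding invertible_over_def by blast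
  from *(3) obtain W0 where W0: "M0 \<in> carrier_mat r r" "W0 \<in> carrier_mat r r" "M0 * W0 = 1\<^sub>m r" "W0 * M0 = 1\<^sub>m r"
    unfolding invertible_over_def by blast
  have 1: "M * (W1 \<boxplus> W0) = 1\<^sub>m (N + r)" "(W1 \<boxplus> W0) * M = 1\<^sub>m (N + r)"
    using W1 W0 by (simp_all add: * dsum_mult dsum_one)
  have "inv_mat M = W1 \<boxplus> W0"
    by (rule inv_mat_unique[of _ "N + r"]) (use 1 W1 W0 in \<open>auto simp: *\<close>)
  moreover have "block_invertible N r (W1 \<boxplus> W0)"
  proof -
    have "invertible_over UNIV N W1" by (rule invertible_overI[of _ _ M1]) (use W1 in auto)
    moreover have "invertible_over UNIV r W0" by (rule invertible_overI[of _ _ M0]) (use W0 in auto)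
    ultimately show ?thesis unfolding block_invertible_def by blast
  qed
  ultimately show "block_invertible N r (inv_mat M)" "M * inv_mat M = 1\<^sub>m (N + r)" "inv_mat M * M = 1\<^sub>m (N + r)"
    using 1 by simp_all
qed

lemma det_nonzero_imp_invertible_over:
  fixes M :: "'a :: field mat"
  assumes "M \<in> carrier_mat N N" "det M \<noteq> 0"
  shows "invertible_over UNIV N M"
proof -
  from det_non_zero_imp_unit[OF assms, unfolded Units_def, of "()"] assms(1) show ?thesis
    by (auto simp: ring_mat_simps invertible_over_def)
qed

lemma invertible_over_imp_det_nonzero:
  fixes M :: "'a :: field mat"
  assumes "invertible_over UNIV N M"
  shows "det M \<noteq> 0"
proof -
  from assms obtain W where "M \<in> carrier_mat N N" "W \<in> carrier_mat N N" "M * W = 1\<^sub>m N"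
    unfolding invertible_over_def by blast
  then have "det M * det W = 1" using det_mult[of M N W] by simp
  then show ?thesis by auto
qed

lemma invertible_over_dsum:
  assumes "invertible_over UNIV N U" "invertible_over UNIV N' U'"
  shows "invertible_over UNIV (N + N') (U \<boxplus> U')"
proof -
  from assms(1) obtain W1 where W1: "U \<in> carrier_mat N N" "W1 \<in> carrier_mat N N" "U * W1 = 1\<^sub>m N" "W1 * U = 1\<^sub>m N"
    unfolding invertible_over_def by blast
  from assms(2) obtain W0 where W0: "U' \<in> carrier_mat N' N'" "W0 \<in> carrier_mat N' N'" "U' * W0 = 1\<^sub>m N'" "W0 * U' = 1\<^sub>m N'"
    unfolding invertible_over_def by blast
  show ?thesis
    by (rule invertible_overI[of _ _ "W1 \<boxplus> W0"]) (use W1 W0 in \<open>auto simp: dsum_mult dsum_one\<close>)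
qed

context fiedler_matrices begin

lemma block_invertible_F_mid:
  assumes "0 < i" "i \<le> k"
  shows "block_invertible (Suc k * n) r (F (int i))"
proof -
  have [simp]: "dim_row (Ac i) = n" "dim_col (Ac i) = n" using Ac[of i] assms by auto
  have "invertible_over UNIV ((k - i) * n + (n + (n + (i - 1) * n))) (1\<^sub>m ((k - i) * n) \<boxplus> fiedler_block n (n + (i - 1) * n) (Ac i))"
    by (intro univ.invertible_over_dsum_one fiedler_block_invertible) auto
  then show ?thesis
    unfolding block_invertible_def mid_size[OF assms] F_mid[OF assms]
    by (intro exI[of _ "1\<^sub>m ((k - i) * n) \<boxplus> fiedler_block n (n + (i - 1) * n) (Ac i)"] exI[of _ "1\<^sub>m r"])
      (simp add: dsum_assoc invertible_over_one)
qed

lemma F_neg_mid: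
  assumes "0 < i" "i \<le> k"
  shows "F (- int i) = inv_mat (F (int i))"
  using assms by (simp add: fiedler_S_def)

lemma F_neg_top: "F (- int (Suc k)) = (Ac (Suc k) \<boxplus> 1\<^sub>m (k * n)) \<boxplus> - E"
  by (simp add: fiedler_S_def fiedler_S_neg_m_def fiedler_P_neg_m_def diag_block_mat_dsum del: diag_block_mat.simps)

lemma F_pos_top: "F (int (Suc k)) = inv_mat (F (- int (Suc k)))"
  by (simp add: fiedler_S_def)

lemma block_invertible_F_neg_top:
  assumes "det (Ac (Suc k)) \<noteq> 0"
  shows "block_invertible (Suc k * n) r (F (- int (Suc k)))"
proof -
  have "invertible_over UNIV n (Ac (Suc k))" using assms Ac by (intro det_nonzero_imp_invertible_over) auto
  moreover have "invertible_over UNIV r (- E)"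
  proof -
    have "invertible_over UNIV r E" using E det_E by (rule det_nonzero_imp_invertible_over)
    then obtain W where W: "E \<in> carrier_mat r r" "W \<in> carrier_mat r r" "E * W = 1\<^sub>m r" "W * E = 1\<^sub>m r"
      unfolding invertible_over_def by blast
    then have "(- E) * (- W) = 1\<^sub>m r" "(- W) * (- E) = 1\<^sub>m r"
      by (simp_all add: mat_distribs(5,6))
    then show ?thesis by (intro invertible_overI[of _ _ "- W"]) (use W in auto)
  qed
  ultimately show ?thesis unfolding block_invertible_def F_neg_top
    using invertible_over_dsum[OF _ invertible_over_one[of "k * n"]] by (intro exI conjI) auto
qed

\<comment> \<open>The size Suc k * n must stay as it is for the products below to match.\<close>
declare mult_Suc [simp del]

abbreviation Pos :: "nat list \<Rightarrow> complex mat" where "Pos \<equiv> mprod N (\<lambda>i. F (int i))"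
abbreviation Neg :: "nat list \<Rightarrow> complex mat" where "Neg \<equiv> mprod N (\<lambda>i. F (- int i))"

lemma block_invertible_prod:
  assumes "set t \<subseteq> {1..k}"
  shows "block_invertible (Suc k * n) r (Pos t)" "block_invertible (Suc k * n) r (Neg t)"
proof -
  have "block_invertible (Suc k * n) r (F (int i))" "block_invertible (Suc k * n) r (F (- int i))" if "i \<in> {1..k}" for i
    using that block_invertible_F_mid[of i] F_neg_mid[of i] block_invertible_inverse(1)[of "Suc k * n" r "F (int i)"] by auto
  with assms show "block_invertible (Suc k * n) r (Pos t)" "block_invertible (Suc k * n) r (Neg t)"
    by (induction t) (auto intro: block_invertible_mult block_invertible_one)
qed

lemma F_neg_carrier: "i \<in> {1..k} \<Longrightarrow> F (- int i) \<in> carrier_mat N N"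
  using block_invertible_F_mid[of i] F_neg_mid[of i] block_invertible_inverse(1)[of "Suc k * n" r "F (int i)"]
  by (auto dest: block_invertible_carrier)

lemma Pos_append: "set (s @ t) \<subseteq> {0..k} \<Longrightarrow> Pos (s @ t) = Pos s * Pos t"
  by (rule mprod_append, rule F_carrier) auto

lemma Pos_carrier: "set t \<subseteq> {0..k} \<Longrightarrow> Pos t \<in> carrier_mat N N"
  by (rule mprod_carrier, rule F_carrier) auto

lemma Neg_carrier: "set t \<subseteq> {1..k} \<Longrightarrow> Neg t \<in> carrier_mat N N"
  by (rule mprod_carrier, rule F_neg_carrier) auto

lemma Neg_Pos_rev:
  assumes "set t \<subseteq> {1..k}"
  shows "Neg t * Pos (rev t) = 1\<^sub>m N" "Pos (rev t) * Neg t = 1\<^sub>m N"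
proof -
  \<comment> \<open>Inverting a product reverses the order of its factors.\<close>
  show 1: "Neg t * Pos (rev t) = 1\<^sub>m N"
    using assms
  proof (induction t)
    case (Cons i t)
    have i: "F (- int i) * F (int i) = 1\<^sub>m N" "F (int i) \<in> carrier_mat N N" "F (- int i) \<in> carrier_mat N N"
      using Cons.prems block_invertible_F_mid[of i] F_neg_mid[of i] block_invertible_inverse(3)[of "Suc k * n" r "F (int i)"]
       F_neg_carrier[of i] F_carrier[of i] by auto
    have c: "Neg t \<in> carrier_mat N N" "Pos (rev t) \<in> carrier_mat N N"
      using Cons.prems by (intro Neg_carrier Pos_carrier; auto)+
    have "Pos (rev (i # t)) = Pos (rev t) * F (int i)"
      using Cons.prems i by (simp add: Pos_append[of "rev t" "[i]", simplified] subset_iff)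
    then have "Neg (i # t) * Pos (rev (i # t)) = F (- int i) * (Neg t * Pos (rev t)) * F (int i)"
      using i c by (simp add: assoc_mult_mat[of _ N N _ N _ N])
    then show ?case using Cons i by simp
  qed auto
  show "Pos (rev t) * Neg t = 1\<^sub>m N"
  proof (rule mat_mult_left_right_inverse[OF _ _ 1])
    show "Neg t \<in> carrier_mat N N" using assms by (rule Neg_carrier)
    show "Pos (rev t) \<in> carrier_mat N N" using assms by (intro Pos_carrier) auto
  qed
qed

lemma Pos_Neg_dims:
  assumes "set t \<subseteq> {1..k}"
  shows "dim_row (Neg t) = N" "dim_col (Neg t) = N" "dim_row (Pos t) = N" "dim_col (Pos t) = N"
    "dim_row (Neg (rev t)) = N" "dim_col (Neg (rev t)) = N" "dim_row (Pos (rev t)) = N" "dim_col (Pos (rev t)) = N"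
proof -
  have "set t \<subseteq> {0..k}" using assms by auto
  then show "dim_row (Neg t) = N" "dim_col (Neg t) = N" "dim_row (Pos t) = N" "dim_col (Pos t) = N"
    "dim_row (Neg (rev t)) = N" "dim_col (Neg (rev t)) = N" "dim_row (Pos (rev t)) = N" "dim_col (Pos (rev t)) = N"
    using Neg_carrier[of t] Neg_carrier[of "rev t"] Pos_carrier[of t] Pos_carrier[of "rev t"] assms by auto
qed

lemma Neg_Pos_cancel:
  assumes "set t \<subseteq> {1..k}" "dim_row X = N"
  shows "Neg t * (Pos (rev t) * X) = X" "Pos (rev t) * (Neg t * X) = X"
    "Pos t * (Neg (rev t) * X) = X" "Neg (rev t) * (Pos t * X) = X"
  using assms Pos_Neg_dims[OF assms(1)] Neg_Pos_rev[OF assms(1)] Neg_Pos_rev[of "rev t"] by (simp_all flip: mat_mult_assoc)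

text \<open>
  Every generalized Fiedler pencil is \<open>U (\<lambda> M\<^sub>-\<^sub>m - M\<^sub>\<sigma>) V\<close> for a Fiedler pencil in which
  \<open>\<sigma>\<close> is a permutation of \<open>0, \<dots>, m - 1\<close>.  The factors with index \<open>\<plusminus>i\<close>, \<open>0 < i < m\<close>, are of
  the form \<open>diag(M, I)\<close> with \<open>M\<close> nonsingular and can be moved to the other side.  If \<open>m\<close> occurs in
  \<open>\<omega>\<^sub>1\<close>, this clears everything around \<open>M\<^sub>-\<^sub>m\<close>.  If \<open>m\<close> occurs in
  \<open>\<omega>\<^sub>0 = (\<xi>, m, \<eta>)\<close>, then all of \<open>\<omega>\<^sub>1\<close> is moved to \<open>\<omega>\<^sub>0\<close>, and it remains to
  multiply by the inverse of \<open>M\<^sub>m M\<^sub>\<eta>\<close> or of \<open>M\<^sub>\<xi> M\<^sub>m\<close>, whichever is free of the possibly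
  singular factor with index 0; the cyclic rotation \<open>(\<eta>, rev \<omega>\<^sub>1, \<xi>)\<close> is \<open>\<sigma>\<close>.
\<close>

lemma GFP_to_fiedler_pencil:
  assumes perm: "distinct (\<omega>\<^sub>0 @ \<omega>\<^sub>1)" "set (\<omega>\<^sub>0 @ \<omega>\<^sub>1) = {0..Suc k}" "0 \<in> set \<omega>\<^sub>0"
    and nonsing: "Suc k \<in> set \<omega>\<^sub>0 \<Longrightarrow> det (Ac (Suc k)) \<noteq> 0"
  shows "\<exists>U V \<sigma>. block_invertible (Suc k * n) r U \<and> block_invertible (Suc k * n) r V \<and> 
     distinct \<sigma> \<and> set \<sigma> = {0..k} \<and>
     Neg \<omega>\<^sub>1 = U * F (- int (Suc k)) * V \<and> Pos \<omega>\<^sub>0 = U * Pos \<sigma> * V"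
proof -
  let ?m = "Suc k"
  let ?D = "F (- int ?m)"
  have D: "?D \<in> carrier_mat N N"
    using Ac[of ?m] E by (auto simp: F_neg_top mult_Suc intro!: carrier_matI)
  have range: "{0..Suc k} - {0, Suc k} = {1..k}" by auto
  have range': "{0..Suc k} - {Suc k} = {0..k}" by auto
  have Dd: "dim_row ?D = N" "dim_col ?D = N" using D by auto
  have Pos_dims: "dim_row (Pos t) = N" "dim_col (Pos t) = N" if "set t \<subseteq> {0..k}" for t
    using Pos_carrier[OF that] by auto
  note dims = Pos_Neg_dims
  show ?thesis
  proof (cases "?m \<in> set \<omega>\<^sub>0")
    case False
    then have "?m \<in> set \<omega>\<^sub>1" using perm by auto
    then obtain xs ys where \<omega>: "\<omega>\<^sub>1 = xs @ ?m # ys" by (metis split_list)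
    have sub: "set xs \<subseteq> {1..k}" "set ys \<subseteq> {1..k}"
      and sub0: "set \<omega>\<^sub>0 \<subseteq> {0..k}"
    proof -
      have "set xs \<union> set ys \<subseteq> {0..?m} - {0, ?m}" using perm \<omega> by auto
      then show "set xs \<subseteq> {1..k}" "set ys \<subseteq> {1..k}" unfolding range by auto
      show "set \<omega>\<^sub>0 \<subseteq> {0..k}" using perm False by (auto simp: le_Suc_eq)
    qed
    let ?\<sigma> = "rev xs @ \<omega>\<^sub>0 @ rev ys"
    have "set ?\<sigma> = set (\<omega>\<^sub>0 @ \<omega>\<^sub>1) - {?m}" using perm \<omega> by auto
    then have "set ?\<sigma> = {0..k}" unfolding perm(2) range' .
    moreover have "distinct ?\<sigma>" using perm(1) \<omega> by auto
    ultimately have \<sigma>: "distinct ?\<sigma>" "set ?\<sigma> = {0..k}" by blast+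
    have "F (- int i) \<in> carrier_mat N N" if "i \<in> set \<omega>\<^sub>1" for i
      using that \<omega> sub D F_neg_carrier[of i] by auto
    then have "Neg \<omega>\<^sub>1 = Neg xs * (?D * Neg ys)"
      unfolding \<omega> by (subst mprod_append) auto
    moreover have "Pos ?\<sigma> = Pos (rev xs) * (Pos \<omega>\<^sub>0 * Pos (rev ys))"
    proof -
      have "set (rev xs @ (\<omega>\<^sub>0 @ rev ys)) \<subseteq> {0..k}" "set (\<omega>\<^sub>0 @ rev ys) \<subseteq> {0..k}"
        using \<sigma>(2) by auto
      then show ?thesis by (simp only: Pos_append)
    qed
    moreover note dims[OF sub(1)] dims[OF sub(2)] Pos_dims[OF sub0]
    ultimately have "Neg \<omega>\<^sub>1 = Neg xs * ?D * Neg ys" "Pos \<omega>\<^sub>0 = Neg xs * Pos ?\<sigma> * Neg ys"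
      by (simp_all add: mat_mult_assoc Dd Neg_Pos_cancel[OF sub(1)] Neg_Pos_rev[OF sub(2)])
    with \<sigma> block_invertible_prod[OF sub(1)] block_invertible_prod[OF sub(2)] show ?thesis by blast
  next
    case True
    let ?Dm = "F (int ?m)"
    have inv: "block_invertible (Suc k * n) r ?D" using block_invertible_F_neg_top nonsing True by simp
    note D_inv = block_invertible_inverse[OF inv, folded F_pos_top]
    have Dm: "?Dm \<in> carrier_mat N N" using D_inv(1) by (rule block_invertible_carrier)
    then have Dmd: "dim_row ?Dm = N" "dim_col ?Dm = N" by auto
    have D_cancel: "?D * (?Dm * X) = X" "?Dm * (?D * X) = X" if "dim_row X = N" for X
      using that D_inv Dd Dmd by (simp_all flip: mat_mult_assoc)
    from True obtain xs ys where \<omega>: "\<omega>\<^sub>0 = xs @ ?m # ys" by (metis split_list)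
    have sub1: "set \<omega>\<^sub>1 \<subseteq> {1..k}"
    proof -
      have "set \<omega>\<^sub>1 \<subseteq> {0..?m} - {0, ?m}" using perm True by auto
      then show ?thesis unfolding range .
    qed
    let ?\<sigma> = "ys @ rev \<omega>\<^sub>1 @ xs"
    have "set ?\<sigma> = set (\<omega>\<^sub>0 @ \<omega>\<^sub>1) - {?m}" using perm \<omega> by auto
    then have "set ?\<sigma> = {0..k}" unfolding perm(2) range' .
    moreover have "distinct ?\<sigma>" using perm(1) \<omega> by auto
    ultimately have \<sigma>: "distinct ?\<sigma>" "set ?\<sigma> = {0..k}" by blast+
    have sub: "set xs \<subseteq> {0..k}" "set ys \<subseteq> {0..k}" using \<sigma> by auto
    have "F (int i) \<in> carrier_mat N N" if "i \<in> set \<omega>\<^sub>0" for i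
      using that \<omega> sub Dm F_carrier[of i] by auto
    then have P0: "Pos \<omega>\<^sub>0 = Pos xs * (?Dm * Pos ys)"
      unfolding \<omega> by (subst mprod_append) auto
    have P\<sigma>: "Pos ?\<sigma> = Pos ys * (Pos (rev \<omega>\<^sub>1) * Pos xs)"
    proof -
      have "set (ys @ (rev \<omega>\<^sub>1 @ xs)) \<subseteq> {0..k}" "set (rev \<omega>\<^sub>1 @ xs) \<subseteq> {0..k}"
        using \<sigma>(2) by auto
      then show ?thesis by (simp only: Pos_append)
    qed
    note d = Pos_dims[OF sub(1)] Pos_dims[OF sub(2)] dims[OF sub1] Dd Dmd
    have "0 \<in> set xs \<and> set ys \<subseteq> {1..k} \<or> 0 \<in> set ys \<and> set xs \<subseteq> {1..k}"
    proof -
      have "0 \<in> set xs \<union> set ys" using perm(3) \<omega> by auto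
      moreover have "set xs \<inter> set ys = {}" using perm(1) \<omega> by auto
      moreover have "t \<subseteq> {1..k}" if "t \<subseteq> {0..k}" "0 \<notin> t" for t
      proof
        fix x assume "x \<in> t"
        with that show "x \<in> {1..k}" by (cases x) auto
      qed
      ultimately show ?thesis using sub by blast
    qed
    then show ?thesis
    proof (elim disjE conjE)
      assume ys: "set ys \<subseteq> {1..k}"
      then have rev: "set (rev ys) \<subseteq> {1..k}" by simp
      have "Neg \<omega>\<^sub>1 = (Neg \<omega>\<^sub>1 * Neg (rev ys)) * ?D * (?Dm * Pos ys)"
        using d dims[OF ys] Neg_Pos_rev(1)[OF rev] by (simp add: mat_mult_assoc D_cancel)
      moreover have "Pos \<omega>\<^sub>0 = (Neg \<omega>\<^sub>1 * Neg (rev ys)) * Pos ?\<sigma> * (?Dm * Pos ys)"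
        unfolding P0 P\<sigma> using d dims[OF ys] by (simp add: mat_mult_assoc Neg_Pos_cancel[OF ys] Neg_Pos_cancel[OF sub1])
      moreover have "block_invertible (Suc k * n) r (Neg \<omega>\<^sub>1 * Neg (rev ys))" "block_invertible (Suc k * n) r (?Dm * Pos ys)"
        using sub1 rev ys D_inv(1) by (auto intro!: block_invertible_mult block_invertible_prod)
      ultimately show ?thesis using \<sigma> by blast
    next
      assume xs: "set xs \<subseteq> {1..k}"
      then have rev: "set (rev xs) \<subseteq> {1..k}" by simp
      have "Neg \<omega>\<^sub>1 = (Pos xs * ?Dm) * ?D * (Neg (rev xs) * Neg \<omega>\<^sub>1)"
        using d dims[OF xs] by (simp add: mat_mult_assoc D_cancel Neg_Pos_cancel[OF xs])
      moreover have "Pos \<omega>\<^sub>0 = (Pos xs * ?Dm) * Pos ?\<sigma> * (Neg (rev xs) * Neg \<omega>\<^sub>1)"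
        unfolding P0 P\<sigma> using d dims[OF xs] by (simp add: mat_mult_assoc Neg_Pos_cancel[OF xs] Neg_Pos_rev[OF sub1])
      moreover have "block_invertible (Suc k * n) r (Pos xs * ?Dm)" "block_invertible (Suc k * n) r (Neg (rev xs) * Neg \<omega>\<^sub>1)"
        using sub1 rev xs D_inv(1) by (auto intro!: block_invertible_mult block_invertible_prod)
      ultimately show ?thesis using \<sigma> by blast
    qed
  qed
qed

end

section \<open>The strong linearization\<close>

lemma last_block_map: "h 0 = 0 \<Longrightarrow> h 1 = 1 \<Longrightarrow> map_mat h (last_block n k) = last_block n k"
  by (intro eq_matI) (auto simp: index_top_zero)

lemma last_block_mult:
  fixes Cx :: "'a :: comm_ring_1 mat"
  shows "dim_row Cx = n \<Longrightarrow> last_block n k * Cx = top_zero (k * n) Cx"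
    "dim_col Bx = n \<Longrightarrow> Bx * (last_block n k)\<^sup>T = (top_zero (k * n) ((Bx :: 'a mat)\<^sup>T))\<^sup>T"
proof -
  show 1: "last_block n k * Cx = top_zero (k * n) Cx" if "dim_row Cx = n" for Cx :: "'a mat"
    using that by (simp add: top_zero_mult)
  assume "dim_col Bx = n"
  then have "Bx * (last_block n k)\<^sup>T = (last_block n k * Bx\<^sup>T)\<^sup>T"
    by (simp add: mat_transpose_mult)
  then show "Bx * (last_block n k)\<^sup>T = (top_zero (k * n) (Bx\<^sup>T))\<^sup>T"
    using \<open>dim_col Bx = n\<close> by (simp add: 1)
qed

lemma dsum_one_four_block:
  fixes X :: "'a :: comm_ring_1 mat"
  assumes "dim_row X = n" "dim_col X = n" "dim_row Cx = n" "dim_col Cx = r" "dim_row Bx = r" "dim_col Bx = n" "dim_row W = r" "dim_col W = r"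
  shows "four_block_mat (1\<^sub>m (k * n) \<boxplus> X) (last_block n k * Cx) (Bx * (last_block n k)\<^sup>T) W
    = 1\<^sub>m (k * n) \<boxplus> four_block_mat X Cx Bx W"
proof (rule eq_matI)
  fix i j assume "i < dim_row (1\<^sub>m (k * n) \<boxplus> four_block_mat X Cx Bx W)" "j < dim_col (1\<^sub>m (k * n) \<boxplus> four_block_mat X Cx Bx W)"
  then have "i < k * n + n + r" "j < k * n + n + r" using assms by auto
  then show "four_block_mat (1\<^sub>m (k * n) \<boxplus> X) (last_block n k * Cx) (Bx * (last_block n k)\<^sup>T) W $$ (i, j)
    = (1\<^sub>m (k * n) \<boxplus> four_block_mat X Cx Bx W) $$ (i, j)"
    unfolding last_block_mult(1)[OF assms(3)] last_block_mult(2)[OF assms(6)] using assms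
    by (cases "i < k * n"; cases "j < k * n"; cases "i < k * n + n"; cases "j < k * n + n") (auto simp: index_dsum index_top_zero)
qed (use assms in auto)

text \<open>
  Irreducibility in terms of row and column vectors instead of ranks.
\<close>

lemma irreducible_systemI:
  assumes dims: "Cc \<in> carrier_mat N r" "H \<in> carrier_mat r r" "K \<in> carrier_mat r r" "Bb \<in> carrier_mat r N"
    and left: "\<And>w z. w \<in> carrier_mat 1 r \<Longrightarrow> w * Bb = 0\<^sub>m 1 N \<Longrightarrow> w * H = z \<cdot>\<^sub>m (w * K) \<Longrightarrow> w = 0\<^sub>m 1 r"
    and right: "\<And>v z. v \<in> carrier_mat r 1 \<Longrightarrow> Cc * v = 0\<^sub>m N 1 \<Longrightarrow> H * v = z \<cdot>\<^sub>m (K * v) \<Longrightarrow> v = 0\<^sub>m r 1"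
  shows "irreducible_system N r Cc H K Bb"
  unfolding irreducible_system_def
proof (intro allI conjI)
  fix z
  have d [simp]: "dim_row Cc = N" "dim_col Cc = r" "dim_row H = r" "dim_col H = r" "dim_row K = r" "dim_col K = r"
    "dim_row Bb = r" "dim_col Bb = N" using dims by blast+
  let ?M = "four_block_mat Bb (H - z \<cdot>\<^sub>m K) (0\<^sub>m 0 N) (0\<^sub>m 0 r)"
  show "vec_space.rank r ?M = r"
  proof (rule full_row_rank)
    show "?M \<in> carrier_mat r (N + r)" by (intro carrier_matI) auto
    fix w :: "complex vec" assume w: "w \<in> carrier_vec r" "\<And>j. j < N + r \<Longrightarrow> w \<bullet> col ?M j = 0"
    let ?w = "mat 1 r (\<lambda>(i, j). w $ j)"
    have "vec r (($) w) = w" using w by (intro eq_vecI) auto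
    then have row: "row ?w 0 = w" "vec r (($) w) = w" by auto
    have "w \<bullet> col Bb j = 0" if "j < N" for j
    proof -
      have "col ?M j = col Bb j" using that by (intro eq_vecI) auto
      then show ?thesis using w(2)[of j] that by simp
    qed
    then have 1: "?w * Bb = 0\<^sub>m 1 N" by (intro eq_matI) (auto simp: row)
    have "w \<bullet> col (H - z \<cdot>\<^sub>m K) j = 0" if "j < r" for j
    proof -
      have "col ?M (N + j) = col (H - z \<cdot>\<^sub>m K) j" using that by (intro eq_vecI) auto
      then show ?thesis using w(2)[of "N + j"] that by simp
    qed
    then have "?w * (H - z \<cdot>\<^sub>m K) = 0\<^sub>m 1 r" by (intro eq_matI) (auto simp: row)
    then have 2: "?w * H - z \<cdot>\<^sub>m (?w * K) = 0\<^sub>m 1 r" by (simp add: mat_ring)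
    have "?w * H = z \<cdot>\<^sub>m (?w * K)"
    proof (rule eq_matI)
      fix i j assume "i < dim_row (z \<cdot>\<^sub>m (?w * K))" "j < dim_col (z \<cdot>\<^sub>m (?w * K))"
      then have "(?w * H - z \<cdot>\<^sub>m (?w * K)) $$ (i, j) = (?w * H) $$ (i, j) - (z \<cdot>\<^sub>m (?w * K)) $$ (i, j)" "i < 1" "j < r"
        by (auto simp del: index_mult_mat(1))
      then show "(?w * H) $$ (i, j) = (z \<cdot>\<^sub>m (?w * K)) $$ (i, j)" unfolding 2 by simp
    qed auto
    from left[OF _ 1 this] have "?w = 0\<^sub>m 1 r" by simp
    then have "row ?w 0 = 0\<^sub>v r" by simp
    then show "w = 0\<^sub>v r" using row by simp
  qed
  show "vec_space.rank (N + r) (Cc @\<^sub>r (H - z \<cdot>\<^sub>m K)) = r"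
  proof (rule full_column_rank)
    show "Cc @\<^sub>r (H - z \<cdot>\<^sub>m K) \<in> carrier_mat (N + r) r" by (intro carrier_append_rows carrier_matI) auto
    fix v :: "complex vec" assume v: "v \<in> carrier_vec r" "(Cc @\<^sub>r (H - z \<cdot>\<^sub>m K)) *\<^sub>v v = 0\<^sub>v (N + r)"
    have "(Cc @\<^sub>r (H - z \<cdot>\<^sub>m K)) *\<^sub>v v = (Cc *\<^sub>v v) @\<^sub>v ((H - z \<cdot>\<^sub>m K) *\<^sub>v v)"
      by (rule mat_mult_append[OF dims(1) _ v(1)]) (auto intro!: carrier_matI)
    moreover have "0\<^sub>v N @\<^sub>v 0\<^sub>v r = (0\<^sub>v (N + r) :: complex vec)" by (intro eq_vecI) auto
    ultimately have split: "(Cc *\<^sub>v v) @\<^sub>v ((H - z \<cdot>\<^sub>m K) *\<^sub>v v) = 0\<^sub>v N @\<^sub>v 0\<^sub>v r"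
      using v(2) by simp
    have "Cc *\<^sub>v v = 0\<^sub>v N \<and> (H - z \<cdot>\<^sub>m K) *\<^sub>v v = 0\<^sub>v r"
      using split by (subst (asm) append_vec_eq[of _ N]) (auto intro!: carrier_vecI)
    then have ker: "Cc *\<^sub>v v = 0\<^sub>v N" "(H - z \<cdot>\<^sub>m K) *\<^sub>v v = 0\<^sub>v r" by auto
    have z1: "row Cc i \<bullet> v = 0" if "i < N" for i
      using arg_cong[OF ker(1), of "\<lambda>x. vec_index x i"] that by simp
    have z2: "row (H - z \<cdot>\<^sub>m K) i \<bullet> v = 0" if "i < r" for i
      using arg_cong[OF ker(2), of "\<lambda>x. vec_index x i"] that by simp
    let ?v = "mat r 1 (\<lambda>(i, j). v $ i)"
    have "vec r (($) v) = v" using v by (intro eq_vecI) auto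
    then have col: "col ?v 0 = v" "vec r (($) v) = v" by auto
    have 1: "Cc * ?v = 0\<^sub>m N 1" by (intro eq_matI) (auto simp: col z1)
    have "(H - z \<cdot>\<^sub>m K) * ?v = 0\<^sub>m r 1" by (intro eq_matI) (auto simp: col z2)
    then have 2: "H * ?v - z \<cdot>\<^sub>m (K * ?v) = 0\<^sub>m r 1" by (simp add: mat_ring)
    have "H * ?v = z \<cdot>\<^sub>m (K * ?v)"
    proof (rule eq_matI)
      fix i j assume "i < dim_row (z \<cdot>\<^sub>m (K * ?v))" "j < dim_col (z \<cdot>\<^sub>m (K * ?v))"
      then have "(H * ?v - z \<cdot>\<^sub>m (K * ?v)) $$ (i, j) = (H * ?v) $$ (i, j) - (z \<cdot>\<^sub>m (K * ?v)) $$ (i, j)" "i < r" "j < 1"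
        by (auto simp del: index_mult_mat(1))
      then show "(H * ?v) $$ (i, j) = (z \<cdot>\<^sub>m (K * ?v)) $$ (i, j)" unfolding 2 by simp
    qed auto
    from right[OF _ 1 this] have "?v = 0\<^sub>m r 1" by simp
    then have "col ?v 0 = 0\<^sub>v r" by simp
    then show "v = 0\<^sub>v r" using col by simp
  qed
qed

lemma poly_value_matrix_poly:
  assumes "\<And>i. i \<le> Suc k \<Longrightarrow> Ac i \<in> carrier_mat n n"
  shows "poly_value n lam (\<lambda>i. const_mat (Ac i)) k (const_mat (Ac (Suc k))) = matrix_poly n (Suc k) Ac"
proof (rule eq_matI)
  fix i j assume "i < dim_row (matrix_poly n (Suc k) Ac)" "j < dim_col (matrix_poly n (Suc k) Ac)"
  then have ij: "i < n" "j < n" by (auto simp: matrix_poly_def)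
  have m: "lam ^ l * [:a:] = monom a l" for l and a :: complex
    by (induction l) (auto simp: monom_0 monom_Suc)
  have e: "const_mat (Ac l) $$ (i, j) = [:Ac l $$ (i, j):]" if "l \<le> Suc k" for l
    using assms[OF that] ij by auto
  have "poly_value n lam (\<lambda>i. const_mat (Ac i)) k (const_mat (Ac (Suc k))) $$ (i, j)
     = lam ^ Suc k * [:Ac (Suc k) $$ (i, j):] + (\<Sum>l\<le>k. lam ^ l * [:Ac l $$ (i, j):])"
    using ij e by (simp add: poly_value_def del: power_Suc)
  also have "\<dots> = matrix_poly n (Suc k) Ac $$ (i, j)"
    unfolding m using ij by (simp add: matrix_poly_def)
  finally show "poly_value n lam (\<lambda>i. const_mat (Ac i)) k (const_mat (Ac (Suc k))) $$ (i, j) = matrix_poly n (Suc k) Ac $$ (i, j)" .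
qed (auto simp: poly_value_def matrix_poly_def)

text \<open>
  The constant coefficient has weight \<open>\<lambda>\<^sup>-\<^sup>m\<close> in the reversed polynomial, so a rational summand
  \<open>Q\<close> of it contributes \<open>\<lambda>\<^sup>-\<^sup>m Q\<close>, which is what the division of \<open>P + Q\<close> by
  \<open>\<lambda>\<^sup>m\<close> requires.
\<close>

lemma rev_value_matrix_poly:
  assumes Ac: "\<And>i. i \<le> Suc k \<Longrightarrow> Ac i \<in> carrier_mat n n" and Q: "Q \<in> carrier_mat n n"
  shows "rev_value n (inverse \<Lambda>) (\<lambda>i. if i = 0 then fmat (Ac 0) + Q else fmat (Ac i)) k 0 (fmat (Ac (Suc k)))
    = inverse \<Lambda> ^ Suc k \<cdot>\<^sub>m (rat_mat (matrix_poly n (Suc k) Ac) + Q)"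
proof (rule eq_matI)
  let ?\<mu> = "inverse \<Lambda>"
  fix i j assume "i < dim_row (?\<mu> ^ Suc k \<cdot>\<^sub>m (rat_mat (matrix_poly n (Suc k) Ac) + Q))" "j < dim_col (?\<mu> ^ Suc k \<cdot>\<^sub>m (rat_mat (matrix_poly n (Suc k) Ac) + Q))"
  then have ij: "i < n" "j < n" using Q by auto
  let ?a = "\<lambda>l. frac_const (Ac l $$ (i, j))"
  have m: "to_fract (monom a l) = \<Lambda> ^ l * frac_const a" for l and a :: complex
  proof (induction l)
    case (Suc l)
    have "monom a (Suc l) = lam * monom a l" by (simp add: monom_Suc)
    then have "to_fract (monom a (Suc l)) = \<Lambda> * to_fract (monom a l)" by (simp only: to_fract_mult)
    with Suc show ?case by simp
  qed (simp add: monom_0)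
  have ts: "to_fract (sum f S) = (\<Sum>x\<in>S. to_fract (f x))" for f :: "nat \<Rightarrow> complex poly" and S
    by (induction S rule: infinite_finite_induct) auto
  have e: "fmat (Ac l) $$ (i, j) = ?a l" if "l \<le> Suc k" for l
    using Ac[OF that] ij by auto
  have mu: "?\<mu> ^ (Suc k - l) * x = ?\<mu> ^ Suc k * (\<Lambda> ^ l * x)" if "l \<le> Suc k" for l x
  proof -
    have "?\<mu> ^ Suc k = ?\<mu> ^ (Suc k - l) * ?\<mu> ^ l" using that by (simp flip: power_add)
    then have "?\<mu> ^ Suc k * (\<Lambda> ^ l * x) = ?\<mu> ^ (Suc k - l) * (?\<mu> ^ l * \<Lambda> ^ l) * x" by (simp only: mult_ac)
    also have "?\<mu> ^ l * \<Lambda> ^ l = 1" using Lam_nonzero by (simp flip: power_mult_distrib)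
    finally show ?thesis by (simp only: mult_1_right)
  qed
  have G: "(rat_mat (matrix_poly n (Suc k) Ac) + Q) $$ (i, j) = (\<Sum>l\<le>Suc k. \<Lambda> ^ l * ?a l) + Q $$ (i, j)"
    using ij Q by (simp add: matrix_poly_def ts m del: sum.atMost_Suc)
  have "rev_value n ?\<mu> (\<lambda>i. if i = 0 then fmat (Ac 0) + Q else fmat (Ac i)) k 0 (fmat (Ac (Suc k))) $$ (i, j)
    = ?a (Suc k) + (\<Sum>l\<le>k. ?\<mu> ^ (Suc k - l) * (if l = 0 then ?a 0 + Q $$ (i, j) else ?a l))"
    using ij e Q by (simp add: rev_value_def del: power_Suc) (rule sum.cong, auto)
  also have "(\<Sum>l\<le>k. ?\<mu> ^ (Suc k - l) * (if l = 0 then ?a 0 + Q $$ (i, j) else ?a l))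
    = (\<Sum>l\<le>k. ?\<mu> ^ (Suc k - l) * ?a l + (if l = 0 then ?\<mu> ^ Suc k * Q $$ (i, j) else 0))"
    by (rule sum.cong) (auto simp: algebra_simps)
  also have "\<dots> = (\<Sum>l\<le>k. ?\<mu> ^ (Suc k - l) * ?a l) + ?\<mu> ^ Suc k * Q $$ (i, j)"
    by (simp add: sum.distrib)
  also have "?a (Suc k) + \<dots> = (\<Sum>l\<le>Suc k. ?\<mu> ^ (Suc k - l) * ?a l) + ?\<mu> ^ Suc k * Q $$ (i, j)"
    by simp
  also have "(\<Sum>l\<le>Suc k. ?\<mu> ^ (Suc k - l) * ?a l) = (\<Sum>l\<le>Suc k. ?\<mu> ^ Suc k * (\<Lambda> ^ l * ?a l))"
    by (rule sum.cong) (auto simp: mu simp del: power_Suc)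
  also have "\<dots> + ?\<mu> ^ Suc k * Q $$ (i, j) = ?\<mu> ^ Suc k * ((\<Sum>l\<le>Suc k. \<Lambda> ^ l * ?a l) + Q $$ (i, j))"
    by (simp only: sum_distrib_left distrib_left)
  also have "\<dots> = (?\<mu> ^ Suc k \<cdot>\<^sub>m (rat_mat (matrix_poly n (Suc k) Ac) + Q)) $$ (i, j)"
    unfolding G[symmetric] using ij Q by simp
  finally show "rev_value n ?\<mu> (\<lambda>i. if i = 0 then fmat (Ac 0) + Q else fmat (Ac i)) k 0 (fmat (Ac (Suc k))) $$ (i, j)
    = (?\<mu> ^ Suc k \<cdot>\<^sub>m (rat_mat (matrix_poly n (Suc k) Ac) + Q)) $$ (i, j)" .
qed (use Q in \<open>auto simp: rev_value_def\<close>)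

lemma const_mat_simps:
  "dim_col X = dim_row Y \<Longrightarrow> const_mat (X * Y) = const_mat X * const_mat Y"
  "const_mat (- X) = - const_mat X"
  "const_mat (X \<boxplus> Y) = const_mat X \<boxplus> const_mat Y"
  "const_mat (1\<^sub>m l) = 1\<^sub>m l"
  "const_mat (X\<^sup>T) = (const_mat X)\<^sup>T"
proof -
  interpret h: comm_ring_hom "\<lambda>c::complex. [:c:]" by (rule comm_ring_hom_const)
  show "dim_col X = dim_row Y \<Longrightarrow> const_mat (X * Y) = const_mat X * const_mat Y"
    by (rule h.mat_hom_mult[of X "dim_row X" "dim_col X" Y "dim_col Y"]) auto
  show "const_mat (- X) = - const_mat X" by (rule eq_matI) auto
  show "const_mat (X \<boxplus> Y) = const_mat X \<boxplus> const_mat Y" by (simp add: dsum_map)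
  show "const_mat (1\<^sub>m l) = 1\<^sub>m l" by (rule h.mat_hom_one)
  show "const_mat (X\<^sup>T) = (const_mat X)\<^sup>T" by (rule eq_matI) auto
qed

lemma const_mat_last_block: "const_mat (last_block n k) = last_block n k" "fmat (last_block n k) = last_block n k"
  by (rule last_block_map; simp flip: one_pCons)+

lemma inv_mat_invertible:
  fixes M :: "'a :: field mat"
  assumes "invertible_over UNIV N M"
  shows "dim_row (inv_mat M) = N" "dim_col (inv_mat M) = N" "M * inv_mat M = 1\<^sub>m N" "inv_mat M * M = 1\<^sub>m N"
    "invertible_over UNIV N (inv_mat M)"
proof -
  from assms obtain W where W: "M \<in> carrier_mat N N" "W \<in> carrier_mat N N" "M * W = 1\<^sub>m N" "W * M = 1\<^sub>m N"
    unfolding invertible_over_def by blast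
  have "inv_mat M = W" using W(1-3) by (rule inv_mat_unique)
  moreover have "invertible_over UNIV N W" by (rule invertible_overI[of _ _ M]) (use W in auto)
  ultimately show "dim_row (inv_mat M) = N" "dim_col (inv_mat M) = N" "M * inv_mat M = 1\<^sub>m N" "inv_mat M * M = 1\<^sub>m N"
    "invertible_over UNIV N (inv_mat M)" using W by auto
qed

lemma inverse_cancel:
  fixes M :: "'a :: comm_ring_1 mat"
  assumes "M * W = 1\<^sub>m l" "dim_col M = dim_row W" "dim_col W = dim_row X" "dim_row X = l" 
  shows "M * (W * X) = X"
  using assms by (simp flip: mat_mult_assoc)

text \<open>
  A generalized Fiedler pencil after both reductions: the factors \<open>U = diag(U\<^sub>1, U\<^sub>0)\<close> and
  \<open>V = diag(V\<^sub>1, V\<^sub>0)\<close> come from the passage to a Fiedler pencil, \<open>L\<close> and \<open>R\<close> from the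
  factorization of the latter.  The definitions name the blocks of the pencil as in the definition of a
  Rosenbrock strong linearization.
\<close>

locale reduced_pencil = fiedler_matrices +
  fixes L R U1 V1 U0 V0 :: "complex mat"
  assumes ff: "fiedler_factors n Ac k L R"
    and U1: "invertible_over UNIV (n + k * n) U1" and V1: "invertible_over UNIV (n + k * n) V1"
    and U0: "invertible_over UNIV r U0" and V0: "invertible_over UNIV r V0"
begin

abbreviation J :: "'x :: comm_ring_1 mat" where "J \<equiv> last_block n k"

definition "X = - (U1 * (L * (1\<^sub>m (k * n) \<boxplus> - Ac 0) * R) * V1)"
definition "Y = - (U1 * (Ac (Suc k) \<boxplus> 1\<^sub>m (k * n)) * V1)"
definition "Cc = U1 * (L * J * C) * V0"
definition "Bb = U0 * (B * J\<^sup>T * R) * V1"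
definition "H = U0 * A * V0"
definition "K = U0 * E * V0"

lemmas pencil_defs = X_def Y_def Cc_def Bb_def H_def K_def

lemma dims [simp]:
  "dim_row L = n + k * n" "dim_col L = n + k * n" "dim_row R = n + k * n" "dim_col R = n + k * n"
  "dim_row U1 = n + k * n" "dim_col U1 = n + k * n" "dim_row V1 = n + k * n" "dim_col V1 = n + k * n"
  "dim_row U0 = r" "dim_col U0 = r" "dim_row V0 = r" "dim_col V0 = r"
  "dim_row A = r" "dim_col A = r" "dim_row E = r" "dim_col E = r" 
  "dim_row B = r" "dim_col B = n" "dim_row C = n" "dim_col C = r"
  "dim_row (Ac 0) = n" "dim_col (Ac 0) = n" "dim_row (Ac (Suc k)) = n" "dim_col (Ac (Suc k)) = n"
  using fiedler_factors_dim[OF ff] Ac[of 0] Ac[of "Suc k"] Ac A B C E invertible_overD[OF U1] invertible_overD[OF V1]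
    invertible_overD[OF U0] invertible_overD[OF V0] by auto

lemma pencil_dims [simp]:
  "dim_row X = n + k * n" "dim_col X = n + k * n" "dim_row Y = n + k * n" "dim_col Y = n + k * n"
  "dim_row Cc = n + k * n" "dim_col Cc = r" "dim_row Bb = r" "dim_col Bb = n + k * n"
  "dim_row H = r" "dim_col H = r" "dim_row K = r" "dim_col K = r"
  by (auto simp: pencil_defs)

lemma det_K: "det K \<noteq> 0"
proof -
  have "invertible_over UNIV r K"
    unfolding K_def using U0 V0 det_nonzero_imp_invertible_over[OF E det_E]
    by (blast intro: univ.invertible_over_mult)
  then show ?thesis by (rule invertible_over_imp_det_nonzero)
qed

lemma LR_invertible: "invertible_over UNIV (n + k * n) L" "invertible_over UNIV (n + k * n) R"
  using fiedler_factors_invertible[OF ff] Ac by auto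

abbreviation "Li \<equiv> inv_mat L"
abbreviation "Ri \<equiv> inv_mat R"
abbreviation "U1i \<equiv> inv_mat U1"
abbreviation "V1i \<equiv> inv_mat V1"
abbreviation "U0i \<equiv> inv_mat U0"
abbreviation "V0i \<equiv> inv_mat V0"

lemmas Li = inv_mat_invertible[OF LR_invertible(1)]
lemmas Ri = inv_mat_invertible[OF LR_invertible(2)]
lemmas U1i = inv_mat_invertible[OF U1]
lemmas V1i = inv_mat_invertible[OF V1]
lemmas U0i = inv_mat_invertible[OF U0]
lemmas V0i = inv_mat_invertible[OF V0]

lemma last_block_orthonormal: "J\<^sup>T * J = (1\<^sub>m n :: 'x :: comm_ring_1 mat)"
proof (rule eq_matI)
  fix i j assume "i < dim_row (1\<^sub>m n :: 'x mat)" "j < dim_col (1\<^sub>m n :: 'x mat)"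
  then have ij: "i < n" "j < n" by auto
  have J: "(J :: 'x mat) $$ (l, i') = (if l = k * n + i' then 1 else 0)" if "l < k * n + n" "i' < n" for l i'
    using that by (auto simp: index_top_zero)
  have "(J\<^sup>T * J :: 'x mat) $$ (i, j) = (\<Sum>l\<in>{0..<k * n + n}. (J :: 'x mat) $$ (l, i) * (J :: 'x mat) $$ (l, j))"
    using ij by (simp add: scalar_prod_def)
  also have "\<dots> = (\<Sum>l\<in>{0..<k * n + n}. if l = k * n + i then (if i = j then 1 else 0) else 0)"
    using ij by (intro sum.cong) (auto simp: J)
  finally show "(J\<^sup>T * J) $$ (i, j) = (1\<^sub>m n :: 'x mat) $$ (i, j)" using ij by simp
qed auto

text \<open>
  A left null vector of \<open>[Bb H - z K]\<close> gives one of \<open>[B A - z E]\<close> after multiplication by \<open>U\<^sub>0\<close>, since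
  \<open>Bb = U\<^sub>0 B (J\<^sup>T R V\<^sub>1)\<close>, and the last factor has the right inverse
  \<open>V\<^sub>1\<^sup>-\<^sup>1 R\<^sup>-\<^sup>1 J\<close>.  Columns are treated dually.
\<close>

lemma pencil_irreducible:
  assumes min: "minimal_realization n r P C A E B"
  shows "irreducible_system (n + k * n) r Cc H K Bb"
proof (rule irreducible_systemI)
  show "Cc \<in> carrier_mat (n + k * n) r" "H \<in> carrier_mat r r" "K \<in> carrier_mat r r" "Bb \<in> carrier_mat r (n + k * n)"
    by (auto intro!: carrier_matI)
  note inv = Li(1,2) Ri(1,2) U1i(1,2) V1i(1,2) U0i(1,2) V0i(1,2)
  {
    fix w z assume w: "w \<in> carrier_mat 1 r" "w * Bb = 0\<^sub>m 1 (n + k * n)" "w * H = z \<cdot>\<^sub>m (w * K)"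
    have wd: "dim_row w = 1" "dim_col w = r" using w(1) by auto
    have "w * Bb * (V1i * (Ri * J)) = w * U0 * B"
      unfolding Bb_def using wd inv
      by (simp add: mat_mult_assoc inverse_cancel[OF V1i(3)] inverse_cancel[OF Ri(3)] last_block_orthonormal)
    then have 1: "w * U0 * B = 0\<^sub>m 1 n" unfolding w using inv by simp
    have "w * H * V0i = w * U0 * A" "z \<cdot>\<^sub>m (w * K) * V0i = z \<cdot>\<^sub>m (w * U0 * E)"
      unfolding H_def K_def using wd inv by (simp_all add: mat_mult_assoc mat_smult_mult V0i)
    then have 2: "w * U0 * A = z \<cdot>\<^sub>m (w * U0 * E)" unfolding w by simp
    have "w * U0 = 0\<^sub>m 1 r"
      by (rule minimal_imp_controllable[OF min _ 1 2]) (use wd in \<open>auto intro!: carrier_matI\<close>)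
    moreover have "w * U0 * U0i = w" using wd inv by (simp add: mat_mult_assoc U0i)
    ultimately show "w = 0\<^sub>m 1 r" using inv by simp
  }
  {
    fix v z assume v: "v \<in> carrier_mat r 1" "Cc * v = 0\<^sub>m (n + k * n) 1" "H * v = z \<cdot>\<^sub>m (K * v)"
    have vd: "dim_row v = r" "dim_col v = 1" using v(1) by auto
    have "J\<^sup>T * (Li * (U1i * (Cc * v))) = C * (V0 * v)"
      unfolding Cc_def using vd inv
      by (simp add: mat_mult_assoc inverse_cancel[OF U1i(4)] inverse_cancel[OF Li(4)] inverse_cancel[OF last_block_orthonormal])
    then have 1: "C * (V0 * v) = 0\<^sub>m n 1" unfolding v using inv by simp
    have "U0i * (H * v) = A * (V0 * v)" "U0i * (z \<cdot>\<^sub>m (K * v)) = z \<cdot>\<^sub>m (E * (V0 * v))"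
      unfolding H_def K_def using vd inv by (simp_all add: mat_mult_assoc mat_smult_mult inverse_cancel[OF U0i(4)])
    then have 2: "A * (V0 * v) = z \<cdot>\<^sub>m (E * (V0 * v))" unfolding v by simp
    have "V0 * v = 0\<^sub>m r 1"
      by (rule minimal_imp_observable[OF min _ 1 2]) (use vd in \<open>auto intro!: carrier_matI\<close>)
    moreover have "V0i * (V0 * v) = v" using vd inv by (simp add: inverse_cancel[OF V0i(4)])
    ultimately show "v = 0\<^sub>m r 1" using inv by simp
  }
qed

end

lemma dsum_four_block_dsum:
  fixes P Q :: "'a :: comm_ring_1 mat"
  assumes "dim_row B = dim_row A" "dim_col C = dim_col A" "dim_row C = dim_row D" "dim_col B = dim_col D"
    "dim_col P = dim_row A" "dim_col Q = dim_row D" "dim_row P' = dim_col A" "dim_row Q' = dim_col D"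
  shows "(P \<boxplus> Q) * four_block_mat A B C D * (P' \<boxplus> Q')
     = four_block_mat (P * A * P') (P * B * Q') (Q * C * P') (Q * D * Q')"
  using assms by (simp add: dsum_def four_block_mult zero_mat_simps)

lemma last_block_sandwich:
  assumes "dim_row Q = n" "dim_col Q = n"
  shows "last_block n k * (Q * (last_block n k)\<^sup>T) = (0\<^sub>m (k * n) (k * n) \<boxplus> Q :: 'a :: comm_ring_1 mat)"
  using assms by (simp add: last_block_mult del: index_mult_mat(1)) (intro eq_matI, auto simp: index_dsum index_top_zero)

context reduced_pencil begin

text \<open>
  All blocks of the pencil arise from the Fiedler pencil bordered by \<open>J C\<close> and \<open>B J\<^sup>T\<close> by
  multiplication with constant nonsingular matrices.  These are undone, and the equivalence of the
  Fiedler pencil with \<open>diag(I, P)\<close> keeps \<open>J\<close>, so the borders become those of the system matrix.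
\<close>

lemma unimodular_reduction:
  "\<exists>U V U' V'. unimodular (n + k * n) U \<and> unimodular (n + k * n) V \<and>
     U' \<in> carrier_mat r r \<and> V' \<in> carrier_mat r r \<and> det U' \<noteq> 0 \<and> det V' \<noteq> 0 \<and>
     diag_block_mat [U, const_mat U'] *
       four_block_mat (const_mat X - lam \<cdot>\<^sub>m const_mat Y) (const_mat Cc) (const_mat Bb) (const_mat H - lam \<cdot>\<^sub>m const_mat K) *
     diag_block_mat [V, const_mat V'] =
     diag_block_mat [1\<^sub>m (k * n), system_matrix (matrix_poly n (Suc k) Ac) C A E B]"
proof -
  let ?c = const_mat
  have "fiedler_factors n (\<lambda>i. ?c (Ac i)) k (?c L) (?c R)"
    by (rule fiedler_factors_hom[OF ff comm_ring_hom_const]) (use Ac in auto)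
  note equiv = fiedler_pencil_system_equiv[OF this, of "?c (Ac (Suc k))" lam]
  let ?F = "lam \<cdot>\<^sub>m (?c (Ac (Suc k)) \<boxplus> 1\<^sub>m (k * n)) - ?c L * (1\<^sub>m (k * n) \<boxplus> - ?c (Ac 0)) * ?c R"
  let ?P = "matrix_poly n (Suc k) Ac"
  have P: "poly_value n lam (\<lambda>i. ?c (Ac i)) k (?c (Ac (Suc k))) = ?P"
    by (rule poly_value_matrix_poly) (rule Ac)
  have Pd: "dim_row ?P = n" "dim_col ?P = n" by (auto simp: matrix_poly_def)
  have "system_equiv (n + k * n) ?F (?c L * J) (J\<^sup>T * ?c R) (1\<^sub>m (k * n) \<boxplus> ?P) J (J\<^sup>T)"
    unfolding P[symmetric] using Ac by (intro equiv) auto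
  then obtain Up Vp where Up: "invertible_over UNIV (n + k * n) Up" and Vp: "invertible_over UNIV (n + k * n) Vp"
    and eqs: "Up * ?F * Vp = 1\<^sub>m (k * n) \<boxplus> ?P" "Up * (?c L * J) = J" "J\<^sup>T * ?c R * Vp = J\<^sup>T"
    unfolding system_equiv_def by blast
  note d = U1i(1,2) V1i(1,2) U0i(1,2) V0i(1,2) invertible_overD[OF Up] invertible_overD[OF Vp] Pd
  have inv: "?c U1i * ?c U1 = 1\<^sub>m (n + k * n)" "?c V1 * ?c V1i = 1\<^sub>m (n + k * n)" "?c U0i * ?c U0 = 1\<^sub>m r" "?c V0 * ?c V0i = 1\<^sub>m r"
    using U1i V1i U0i V0i by (simp_all flip: const_mat_simps(1) add: const_mat_simps(4))
  note simps = const_mat_simps const_mat_last_block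
  have b11: "?c X - lam \<cdot>\<^sub>m ?c Y = ?c U1 * ?F * ?c V1"
    unfolding X_def Y_def
    by (simp add: simps mat_ring) (rule eq_matI; simp del: index_mult_mat(1))
  have b12: "?c Cc = ?c U1 * (?c L * J * ?c C) * ?c V0"
    unfolding Cc_def by (simp add: simps)
  have b21: "?c Bb = ?c U0 * (?c B * J\<^sup>T * ?c R) * ?c V1"
    unfolding Bb_def by (simp add: simps)
  have b22: "?c H - lam \<cdot>\<^sub>m ?c K = ?c U0 * (?c A - lam \<cdot>\<^sub>m ?c E) * ?c V0"
    unfolding H_def K_def by (simp add: simps mat_ring)
  let ?U = "Up * ?c U1i" and ?V = "?c V1i * Vp"
  have r11: "?U * (?c X - lam \<cdot>\<^sub>m ?c Y) * ?V = 1\<^sub>m (k * n) \<boxplus> ?P"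
  proof -
    have "?U * (?c U1 * G * ?c V1) * ?V = Up * G * Vp" if "dim_row G = n + k * n" "dim_col G = n + k * n" for G
      using d that by (simp add: mat_mult_assoc inverse_cancel[OF inv(1)] inverse_cancel[OF inv(2)])
    then show ?thesis unfolding b11 eqs(1)[symmetric] by simp
  qed
  have r12: "?U * ?c Cc * ?c V0i = J * ?c C"
  proof -
    have "?U * ?c Cc * ?c V0i = Up * (?c L * J) * ?c C"
      unfolding b12 using d by (simp add: mat_mult_assoc inverse_cancel[OF inv(1)] inv(4))
    then show ?thesis unfolding eqs .
  qed
  have r21: "?c U0i * ?c Bb * ?V = ?c B * J\<^sup>T"
  proof -
    have "?c U0i * ?c Bb * ?V = ?c B * (J\<^sup>T * ?c R * Vp)"
      unfolding b21 using d by (simp add: mat_mult_assoc inverse_cancel[OF inv(3)] inverse_cancel[OF inv(2)])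
    then show ?thesis unfolding eqs .
  qed
  have r22: "?c U0i * (?c H - lam \<cdot>\<^sub>m ?c K) * ?c V0i = ?c A - lam \<cdot>\<^sub>m ?c E"
  proof -
    have "?c U0i * (?c U0 * G * ?c V0) * ?c V0i = G" if "dim_row G = r" "dim_col G = r" for G
      using d that by (simp add: mat_mult_assoc inverse_cancel[OF inv(3)] inv(4))
    then show ?thesis unfolding b22 by simp
  qed
  have "(?U \<boxplus> ?c U0i) * four_block_mat (?c X - lam \<cdot>\<^sub>m ?c Y) (?c Cc) (?c Bb) (?c H - lam \<cdot>\<^sub>m ?c K) * (?V \<boxplus> ?c V0i)
    = four_block_mat (1\<^sub>m (k * n) \<boxplus> ?P) (J * ?c C) (?c B * J\<^sup>T) (?c A - lam \<cdot>\<^sub>m ?c E)"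
    using d by (subst dsum_four_block_dsum) (simp_all add: r11 r12 r21 r22)
  also have "\<dots> = 1\<^sub>m (k * n) \<boxplus> system_matrix ?P C A E B"
    unfolding system_matrix_def using Pd by (intro dsum_one_four_block) auto
  finally have "(?U \<boxplus> ?c U0i) * four_block_mat (?c X - lam \<cdot>\<^sub>m ?c Y) (?c Cc) (?c Bb) (?c H - lam \<cdot>\<^sub>m ?c K) * (?V \<boxplus> ?c V0i)
    = 1\<^sub>m (k * n) \<boxplus> system_matrix ?P C A E B" .
  moreover have "unimodular (n + k * n) ?U" "unimodular (n + k * n) ?V"
    using Up Vp invertible_over_const_hom(1)[OF U1i(5)] invertible_over_const_hom(1)[OF V1i(5)]
    by (blast intro: invertible_over_imp_unimodular univ.invertible_over_mult)+
  moreover have "det U0i \<noteq> 0" "det V0i \<noteq> 0"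
    by (rule invertible_over_imp_det_nonzero, rule U0i(5)) (rule invertible_over_imp_det_nonzero, rule V0i(5))
  moreover have "U0i \<in> carrier_mat r r" "V0i \<in> carrier_mat r r" using d by auto
  ultimately show ?thesis unfolding diag_block_mat_dsum by blast
qed

text \<open>
  The transfer function of the pencil is the Schur complement of its last block.  Since \<open>J Q J\<^sup>T\<close> with
  \<open>Q = C (\<lambda> E - A)\<^sup>-\<^sup>1 B\<close> is zero except for \<open>Q\<close> in the last diagonal block, it is the Fiedler
  pencil of \<open>P\<close> with \<open>A\<^sub>0\<close> replaced by the proper matrix \<open>A\<^sub>0 + Q\<close>, up to \<open>U\<^sub>1\<close> and
  \<open>V\<^sub>1\<close>.  The reduction at infinity then ends in \<open>\<lambda>\<^sup>-\<^sup>m (P + Q)\<close>.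
\<close>

lemma biproper_reduction:
  "\<exists>Ol Or. biproper (n + k * n) Ol \<and> biproper (n + k * n) Or \<and>
     Ol * (inverse \<Lambda> \<cdot>\<^sub>m transfer_function (const_mat X - lam \<cdot>\<^sub>m const_mat Y) Cc H K Bb) * Or =
     diag_block_mat [1\<^sub>m (k * n), inverse \<Lambda> ^ Suc k \<cdot>\<^sub>m transfer_function (matrix_poly n (Suc k) Ac) C A E B]"
proof -
  let ?\<mu> = "inverse \<Lambda>"
  have mu: "?\<mu> * (\<Lambda> * x) = x" for x using Lam_nonzero by simp
  let ?P = "matrix_poly n (Suc k) Ac"
  obtain W where W: "W \<in> carrier_mat r r" "entries_in proper W" "(\<Lambda> \<cdot>\<^sub>m fmat E - fmat A) * W = 1\<^sub>m r"
    "\<And>P C B. transfer_function P C A E B = rat_mat P + fmat C * W * fmat B"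
    using resolvent[OF E A det_E] by metis
  have Wd: "dim_row W = r" "dim_col W = r" using W by auto
  define Q where "Q = fmat C * W * fmat B"
  have Qd: "dim_row Q = n" "dim_col Q = n" by (auto simp: Q_def)
  have proper_fmat: "entries_in proper (fmat M)" for M
    by (auto simp: entries_in_def proper_def intro: limit_at_inf_const)
  have Q_proper: "entries_in proper Q"
    unfolding Q_def using W(2) Wd by (intro proper.entries_mult proper_fmat) auto
  let ?Ac = "\<lambda>i. if i = 0 then fmat (Ac 0) + Q else fmat (Ac i)"
  have "fiedler_factors n ?Ac k (fmat L) (fmat R)"
    by (rule fiedler_factors_hom[OF ff comm_ring_hom_frac_const]) (use Ac in auto)
  note rev = coefficient_ring.fiedler_pencil_reversal_equiv[OF proper.coefficient_ring_axioms this, of "fmat (Ac (Suc k))" ?\<mu> 0 0]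
  let ?N = "fmat L * (1\<^sub>m (k * n) \<boxplus> - (fmat (Ac 0) + Q)) * fmat R"
  let ?F = "(fmat (Ac (Suc k)) \<boxplus> 1\<^sub>m (k * n)) - ?\<mu> \<cdot>\<^sub>m ?N"
  have one: "(1 :: complex poly fract) \<cdot>\<^sub>m 1\<^sub>m n = 1\<^sub>m n" by (rule eq_matI) auto
  have "equiv_over proper (n + k * n) ?F (1\<^sub>m (k * n) \<boxplus> rev_value n ?\<mu> ?Ac k 0 (fmat (Ac (Suc k))))"
  proof -
    have "?Ac i \<in> carrier_mat n n" if "i \<le> k" for i using that Ac[of i] Qd by (auto intro!: carrier_matI)
    moreover have "entries_in proper (?Ac i)" for i
      using proper_fmat proper.entries_add[OF _ _ proper_fmat Q_proper] Qd by auto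
    moreover have "?\<mu> \<in> proper" using limit_at_inf_inverse_lam by (auto simp: proper_def)
    ultimately show ?thesis using rev Ac[of "Suc k"] Qd by (simp add: one dsum_one mat_mult_assoc)
  qed
  also have "rev_value n ?\<mu> ?Ac k 0 (fmat (Ac (Suc k))) = ?\<mu> ^ Suc k \<cdot>\<^sub>m transfer_function ?P C A E B"
    unfolding W(4) Q_def[symmetric] by (rule rev_value_matrix_poly) (use Ac Qd in \<open>auto intro!: carrier_matI\<close>)
  finally obtain Ol Or where O: "invertible_over proper (n + k * n) Ol" "invertible_over proper (n + k * n) Or"
    "Ol * ?F * Or = 1\<^sub>m (k * n) \<boxplus> ?\<mu> ^ Suc k \<cdot>\<^sub>m transfer_function ?P C A E B"
    unfolding equiv_over_def by blast
  note d = U1i(1,2) V1i(1,2) U0i(1,2) V0i(1,2) invertible_overD[OF O(1)] invertible_overD[OF O(2)] Wd Qd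
  have inv: "fmat U1i * fmat U1 = 1\<^sub>m (n + k * n)" "fmat V1 * fmat V1i = 1\<^sub>m (n + k * n)"
    "fmat U0 * fmat U0i = 1\<^sub>m r" "fmat U0i * fmat U0 = 1\<^sub>m r" "fmat V0 * fmat V0i = 1\<^sub>m r" "fmat V0i * fmat V0 = 1\<^sub>m r"
    using U1i V1i U0i V0i by (simp_all flip: fmat_simps(2) add: fmat_simps(4))
  let ?G = "transfer_function (const_mat X - lam \<cdot>\<^sub>m const_mat Y) Cc H K Bb"
  have G: "?G = (fmat X - \<Lambda> \<cdot>\<^sub>m fmat Y) + fmat U1 * (fmat L * (J * (Q * J\<^sup>T)) * fmat R) * fmat V1"
  proof -
    let ?R = "\<Lambda> \<cdot>\<^sub>m fmat K - fmat H" and ?W = "fmat V0i * W * fmat U0i"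
    have R: "?R = fmat U0 * (\<Lambda> \<cdot>\<^sub>m fmat E - fmat A) * fmat V0"
      unfolding K_def H_def by (simp add: fmat_simps mat_ring)
    have "fmat U0 * M * fmat V0 * ?W = fmat U0 * (M * W) * fmat U0i" if "dim_row M = r" "dim_col M = r" for M
      using d that by (simp add: mat_mult_assoc inverse_cancel[OF inv(5)])
    then have "?R * ?W = fmat U0 * ((\<Lambda> \<cdot>\<^sub>m fmat E - fmat A) * W) * fmat U0i" unfolding R by simp
    also have "\<dots> = 1\<^sub>m r" unfolding W using d by (simp add: inv)
    finally have "inv_mat ?R = ?W"
      by (intro inv_mat_unique[of _ r]) (use d in \<open>auto intro!: carrier_matI\<close>)
    then have "?G = rat_mat (const_mat X - lam \<cdot>\<^sub>m const_mat Y) + fmat Cc * ?W * fmat Bb"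
      by (simp add: transfer_function_def fmat_simps)
    also have "rat_mat (const_mat X - lam \<cdot>\<^sub>m const_mat Y) = fmat X - \<Lambda> \<cdot>\<^sub>m fmat Y"
    proof -
      have "to_fract ([:x:] - lam * [:y:]) = frac_const x - \<Lambda> * frac_const y" for x y
        by (simp only: to_fract_diff to_fract_mult)
      then show ?thesis by (intro eq_matI) auto
    qed
    also have "fmat Cc * ?W * fmat Bb = fmat U1 * (fmat L * (J * (Q * J\<^sup>T)) * fmat R) * fmat V1"
      unfolding Cc_def Bb_def Q_def using d
      by (simp add: fmat_simps const_mat_last_block mat_mult_assoc inverse_cancel[OF inv(5)] inverse_cancel[OF inv(4)])
    finally show ?thesis .
  qed
  have N: "1\<^sub>m (k * n) \<boxplus> - (fmat (Ac 0) + Q) = (1\<^sub>m (k * n) \<boxplus> - fmat (Ac 0)) - J * (Q * J\<^sup>T)"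
    unfolding last_block_sandwich[OF Qd] using Qd by (intro eq_matI) (auto simp: index_dsum)
  have fX: "fmat X = - (fmat U1 * (fmat L * (1\<^sub>m (k * n) \<boxplus> - fmat (Ac 0)) * fmat R) * fmat V1)"
    "fmat Y = - (fmat U1 * (fmat (Ac (Suc k)) \<boxplus> 1\<^sub>m (k * n)) * fmat V1)"
    unfolding X_def Y_def by (simp_all add: fmat_simps dsum_map)
  \<comment> \<open>Dividing the transfer function by the indeterminate turns the leading coefficient into the constant one.\<close>
  have key: "?\<mu> \<cdot>\<^sub>m ?G = fmat U1 * ?F * fmat V1"
    unfolding G fX N using d
    by (simp add: mat_ring) (rule eq_matI; simp del: index_mult_mat(1) add: algebra_simps mu)
  let ?Ol = "Ol * fmat U1i" and ?Or = "fmat V1i * Or"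
  have "?Ol * (fmat U1 * M * fmat V1) * ?Or = Ol * M * Or" if "dim_row M = n + k * n" "dim_col M = n + k * n" for M
    using d that by (simp add: mat_mult_assoc inverse_cancel[OF inv(1)] inverse_cancel[OF inv(2)])
  then have "?Ol * (?\<mu> \<cdot>\<^sub>m ?G) * ?Or = 1\<^sub>m (k * n) \<boxplus> ?\<mu> ^ Suc k \<cdot>\<^sub>m transfer_function ?P C A E B"
    unfolding key O(3)[symmetric] using d by simp
  moreover have "biproper (n + k * n) ?Ol" "biproper (n + k * n) ?Or"
    using O(1,2) invertible_over_const_hom(2)[OF U1i(5)] invertible_over_const_hom(2)[OF V1i(5)]
    by (blast intro: invertible_over_proper_imp_biproper proper.invertible_over_mult)+
  ultimately show ?thesis unfolding diag_block_mat_dsum by blast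
qed

end

context fiedler_matrices begin

lemma fiedler_S_tuple_eq:
  "fiedler_S_tuple n (Suc k) r Ac C A E B (map int t) = mprod (Suc k * n + r) (\<lambda>i. F (int i)) t"
  "fiedler_S_tuple n (Suc k) r Ac C A E B (map (\<lambda>i. - int i) t) = mprod (Suc k * n + r) (\<lambda>i. F (- int i)) t"
proof -
  have *: "fiedler_S_tuple n (Suc k) r Ac C A E B s = mprod (Suc k * n + r) F s" for s
    by (simp add: fiedler_S_tuple_def mprod_def)
  show "fiedler_S_tuple n (Suc k) r Ac C A E B (map int t) = mprod (Suc k * n + r) (\<lambda>i. F (int i)) t"
    "fiedler_S_tuple n (Suc k) r Ac C A E B (map (\<lambda>i. - int i) t) = mprod (Suc k * n + r) (\<lambda>i. F (- int i)) t"
    unfolding * mprod_map by (rule refl)+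
qed

lemma GFP_strong_linearization:
  assumes min: "minimal_realization n r (matrix_poly n (Suc k) Ac) C A E B"
    and perm: "distinct (\<omega>\<^sub>0 @ \<omega>\<^sub>1)" "set (\<omega>\<^sub>0 @ \<omega>\<^sub>1) = {0..Suc k}" "0 \<in> set \<omega>\<^sub>0"
    and nonsing: "Suc k \<in> set \<omega>\<^sub>0 \<Longrightarrow> det (Ac (Suc k)) \<noteq> 0"
  shows "rosenbrock_strong_linearization n (Suc k) r (matrix_poly n (Suc k) Ac) C A E B
           (gen_fiedler_pencil n (Suc k) r Ac C A E B \<omega>\<^sub>0 \<omega>\<^sub>1)"
proof -
  have size: "Suc k * n = n + k * n" by (rule mult_Suc)
  from GFP_to_fiedler_pencil[OF perm nonsing] obtain U V \<sigma> where UV: "block_invertible (Suc k * n) r U" "block_invertible (Suc k * n) r V"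
    and \<sigma>: "distinct \<sigma>" "set \<sigma> = {0..k}" and prods: "Neg \<omega>\<^sub>1 = U * F (- int (Suc k)) * V" "Pos \<omega>\<^sub>0 = U * Pos \<sigma> * V"
    by blast
  from UV obtain U1 U0 V1 V0 where U: "U = U1 \<boxplus> U0" "invertible_over UNIV (n + k * n) U1" "invertible_over UNIV r U0"
    and V: "V = V1 \<boxplus> V0" "invertible_over UNIV (n + k * n) V1" "invertible_over UNIV r V0"
    unfolding block_invertible_def size by blast
  from fiedler_product_factorization[OF \<sigma> le_refl] obtain L R where ff: "fiedler_factors n Ac k L R"
    and LR: "Pos \<sigma> = (L \<boxplus> 1\<^sub>m r) * F 0 * (R \<boxplus> 1\<^sub>m r)" by auto
  interpret red: reduced_pencil n k r Ac A B C E L R U1 V1 U0 V0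
    by unfold_locales (use ff U V in auto)
  have UDV: "U * F (- int (Suc k)) * V = (- red.Y) \<boxplus> (- red.K)"
    unfolding U(1) V(1) F_neg_top by (simp add: dsum_mult red.Y_def red.K_def mat_ring)
  have "U * Pos \<sigma> * V = ((U1 * L) \<boxplus> U0) * F 0 * ((R * V1) \<boxplus> V0)"
  proof -
    have F0: "dim_row (F 0) = n + k * n + r" "dim_col (F 0) = n + k * n + r" using F_carrier[of 0] by (auto simp: mult_Suc)
    have "U * Pos \<sigma> * V = (U * (L \<boxplus> 1\<^sub>m r)) * F 0 * ((R \<boxplus> 1\<^sub>m r) * V)"
      unfolding LR U(1) V(1) using F0 by (simp add: mat_mult_assoc)
    then show ?thesis unfolding U(1) V(1) by (simp add: dsum_mult)
  qed
  also have "\<dots> = four_block_mat (- red.X) (- red.Cc) (- red.Bb) (- red.H)"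
    unfolding F_zero fiedler_S_zero_eq(1)[of Ac, OF Ac[OF le0] C B A]
    by (subst dsum_four_block_dsum) (simp_all add: red.pencil_defs mat_ring)
  finally have UPV: "U * Pos \<sigma> * V = four_block_mat (- red.X) (- red.Cc) (- red.Bb) (- red.H)" .
  have "gen_fiedler_pencil n (Suc k) r Ac C A E B \<omega>\<^sub>0 \<omega>\<^sub>1
     = lam \<cdot>\<^sub>m const_mat ((- red.Y) \<boxplus> (- red.K)) - const_mat (four_block_mat (- red.X) (- red.Cc) (- red.Bb) (- red.H))"
    unfolding gen_fiedler_pencil_def fiedler_S_tuple_eq prods UDV UPV ..
  also have "\<dots> = four_block_mat (const_mat red.X - lam \<cdot>\<^sub>m const_mat red.Y) (const_mat red.Cc)
       (const_mat red.Bb) (const_mat red.H - lam \<cdot>\<^sub>m const_mat red.K)"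
    by (rule eq_matI) (auto simp: index_dsum)
  finally have pencil: "gen_fiedler_pencil n (Suc k) r Ac C A E B \<omega>\<^sub>0 \<omega>\<^sub>1 = \<dots>" .
  show ?thesis
    unfolding rosenbrock_strong_linearization_def size pencil diff_Suc_1
    by (rule exI[of _ red.X], rule exI[of _ red.Y], rule exI[of _ red.Cc], rule exI[of _ red.Bb],
        rule exI[of _ red.H], rule exI[of _ red.K], intro conjI)
      ((rule refl | rule red.det_K | rule red.pencil_irreducible[OF min] | rule red.unimodular_reduction |
        rule red.biproper_reduction | (rule carrier_matI, simp, simp))+)
qed

end

theorem theorem3p23:
  fixes m n r :: nat
    and Ac :: "nat \<Rightarrow> complex mat"
    and A B C E :: "complex mat"
    and \<omega>\<^sub>0 \<omega>\<^sub>1 :: "nat list"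
  assumes "m \<ge> 1"
    and "\<And>i. i \<le> m \<Longrightarrow> Ac i \<in> carrier_mat n n"
    and "Ac m \<noteq> 0\<^sub>m n n"
    and "minimal_realization n r (matrix_poly n m Ac) C A E B"
    and "distinct (\<omega>\<^sub>0 @ \<omega>\<^sub>1)" and "set (\<omega>\<^sub>0 @ \<omega>\<^sub>1) = {0..m}"
    and "0 \<in> set \<omega>\<^sub>0"
    and "m \<in> set \<omega>\<^sub>0 \<Longrightarrow> det (Ac m) \<noteq> 0"
  shows "rosenbrock_strong_linearization n m r (matrix_poly n m Ac) C A E B
           (gen_fiedler_pencil n m r Ac C A E B \<omega>\<^sub>0 \<omega>\<^sub>1)"
proof -
  obtain k where m: "m = Suc k" using assms(1) by (cases m) auto
  interpret fiedler_matrices n k r Ac A B C E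
    by unfold_locales (use assms(2,4) m in \<open>auto simp: minimal_realization_def realization_def\<close>)
  show ?thesis
    unfolding m by (rule GFP_strong_linearization) (use assms(4-8) m in auto)
qed

end
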